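(* Let $k>1$ and $\gamma\in(1/2,1)$ with $\frac12+\frac1{2k}>\gamma$. Let $X_t$, started at time $t=1$, solve $$\mathrm{d}X_t=|X_t|^k\,\mathrm{d}t+t^{-\frac{\gamma}{2(1-\gamma)}}\,\mathrm{d}B_t .$$ Then $X_t\to\infty$ almost surely.
   Context: $(B_t)$ is a standard one-dimensional Brownian motion. The solution may explode to $+\infty$ in finite time; $X_t$ denotes the solution up to its (possibly infinite) explosion time $\zeta$, with the convention $X_t=+\infty$ for $t\ge\zeta$, so that explosion to $+\infty$ counts as $X_t\to\infty$. *)

theory Defs
  imports "HOL-Probability.Probability"
begin

text \<open>
  Brownian motion on the time set \<open>[0, \<infinity>)\<close> relative to a filtration, which need not be the one
  it generates. The library's filtrations are indexed by a whole type; the sigma-algebras at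
  negative times play no role.
\<close>

locale brownian_motion = prob_space M + filtration "space M" F
  for M :: "'a measure" and F :: "real \<Rightarrow> 'a measure" +
  fixes B :: "real \<Rightarrow> 'a \<Rightarrow> real"
  assumes subalg: "subalgebra M (F t)"
    and adapted: "0 \<le> t \<Longrightarrow> B t \<in> borel_measurable (F t)"
    and start_zero: "AE \<omega> in M. B 0 \<omega> = 0"
    and continuous_paths: "AE \<omega> in M. continuous_on {0..} (\<lambda>t. B t \<omega>)"
    and increment_normal: "0 \<le> s \<Longrightarrow> s < t \<Longrightarrow>
      distributed M lborel (\<lambda>\<omega>. B t \<omega> - B s \<omega>) (normal_density 0 (sqrt (t - s)))"
    and increment_indep: "0 \<le> s \<Longrightarrow> s < t \<Longrightarrow>
      indep_set (sets (F s)) {(\<lambda>\<omega>. B t \<omega> - B s \<omega>) -` A \<inter> space M | A. A \<in> sets borel}"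

text \<open>
  A simple integrand is a finite sum of elementary processes \<open>\<xi>(\<omega>) 1\<^bsub>(u, v]\<^esub>(s)\<close> with \<open>\<xi>\<close> bounded and
  \<open>F u\<close>-measurable, listed as triples \<open>(u, v, \<xi>)\<close>; the intervals may overlap.
\<close>

type_synonym 'a simple_process = "(real \<times> real \<times> ('a \<Rightarrow> real)) list"

definition simple_integrand ::
  "(real \<Rightarrow> 'a measure) \<Rightarrow> real \<Rightarrow> real \<Rightarrow> 'a simple_process \<Rightarrow> bool" where
  "simple_integrand F a b S \<longleftrightarrow> (\<forall>(u, v, \<xi>) \<in> set S.
     a \<le> u \<and> u \<le> v \<and> v \<le> b \<and> \<xi> \<in> borel_measurable (F u) \<and>
     (\<exists>C. \<forall>\<omega> \<in> space (F u). \<bar>\<xi> \<omega>\<bar> \<le> C))"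

definition simple_value :: "'a simple_process \<Rightarrow> real \<Rightarrow> 'a \<Rightarrow> real" where
  "simple_value S s \<omega> = (\<Sum>(u, v, \<xi>) \<leftarrow> S. \<xi> \<omega> * indicator {u<..v} s)"

definition simple_ito_integral ::
  "(real \<Rightarrow> 'a \<Rightarrow> real) \<Rightarrow> 'a simple_process \<Rightarrow> 'a \<Rightarrow> real" where
  "simple_ito_integral B S \<omega> = (\<Sum>(u, v, \<xi>) \<leftarrow> S. \<xi> \<omega> * (B v \<omega> - B u \<omega>))"

text \<open>
  The random variable \<open>I\<close> is (a version of) the Ito integral \<open>\<integral>\<^sub>a\<^sup>b H\<^sub>s dB\<^sub>s\<close>: simple integrands
  converge to \<open>H\<close> in \<open>L\<^sup>2([a, b] \<times> \<Omega>)\<close> and their integrals converge to \<open>I\<close> in \<open>L\<^sup>2(\<Omega>)\<close>. By the Ito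
  isometry \<open>I\<close> is unique up to null sets and does not depend on the approximating sequence.
\<close>

definition has_ito_integral ::
  "'a measure \<Rightarrow> (real \<Rightarrow> 'a measure) \<Rightarrow> (real \<Rightarrow> 'a \<Rightarrow> real) \<Rightarrow> (real \<Rightarrow> 'a \<Rightarrow> real)
     \<Rightarrow> real \<Rightarrow> real \<Rightarrow> ('a \<Rightarrow> real) \<Rightarrow> bool" where
  "has_ito_integral M F B H a b I \<longleftrightarrow>
     (\<lambda>(s, \<omega>). H s \<omega>) \<in> borel_measurable (lborel \<Otimes>\<^sub>M M) \<and>
     I \<in> borel_measurable M \<and>
     (\<exists>S :: nat \<Rightarrow> 'a simple_process.
        (\<forall>n. simple_integrand F a b (S n)) \<and>
        (\<lambda>n. \<integral>\<^sup>+ (s, \<omega>). ennreal ((simple_value (S n) s \<omega> - H s \<omega>)\<^sup>2) * indicator {a..b} s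
               \<partial>(lborel \<Otimes>\<^sub>M M)) \<longlonglongrightarrow> 0 \<and>
        (\<lambda>n. \<integral>\<^sup>+ \<omega>. ennreal ((simple_ito_integral B (S n) \<omega> - I \<omega>)\<^sup>2) \<partial>M) \<longlonglongrightarrow> 0)"

text \<open>The infimum is \<open>\<infinity>\<close> on paths that never leave the real line.\<close>

definition explosion_time :: "real \<Rightarrow> (real \<Rightarrow> 'a \<Rightarrow> ereal) \<Rightarrow> 'a \<Rightarrow> ereal" where
  "explosion_time t\<^sub>0 X \<omega> = (INF t \<in> {t. t\<^sub>0 \<le> t \<and> \<bar>X t \<omega>\<bar> = \<infinity>}. ereal t)"

text \<open>
  \<open>X\<close> solves \<open>dX\<^sub>t = b(t, X\<^sub>t) dt + \<sigma>(t) dB\<^sub>t\<close> from time \<open>t\<^sub>0\<close>, with an arbitrary finite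
  \<open>F t\<^sub>0\<close>-measurable initial value, up to its explosion time, and is \<open>+\<infinity>\<close> from then on. Continuity
  of the extended-real path makes \<open>X\<^sub>t\<close> tend to \<open>+\<infinity>\<close> at a finite explosion time. As \<open>\<sigma>\<close> is
  not random, the stochastic integral exists without localisation at the explosion time.
\<close>

definition solves_sde ::
  "'a measure \<Rightarrow> (real \<Rightarrow> 'a measure) \<Rightarrow> (real \<Rightarrow> 'a \<Rightarrow> real) \<Rightarrow> (real \<Rightarrow> real \<Rightarrow> real)
     \<Rightarrow> (real \<Rightarrow> real) \<Rightarrow> real \<Rightarrow> (real \<Rightarrow> 'a \<Rightarrow> ereal) \<Rightarrow> bool" where
  "solves_sde M F B b \<sigma> t\<^sub>0 X \<longleftrightarrow>
     (\<forall>t \<ge> t\<^sub>0. X t \<in> borel_measurable (F t)) \<and>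
     (AE \<omega> in M. \<bar>X t\<^sub>0 \<omega>\<bar> \<noteq> \<infinity>) \<and>
     (AE \<omega> in M. continuous_on {t\<^sub>0..} (\<lambda>t. X t \<omega>)) \<and>
     (AE \<omega> in M. \<forall>t \<ge> t\<^sub>0. explosion_time t\<^sub>0 X \<omega> \<le> ereal t \<longrightarrow> X t \<omega> = \<infinity>) \<and>
     (\<forall>t \<ge> t\<^sub>0. \<exists>I. has_ito_integral M F B (\<lambda>s \<omega>. \<sigma> s) t\<^sub>0 t I \<and>
        (AE \<omega> in M. ereal t < explosion_time t\<^sub>0 X \<omega> \<longrightarrow>
           real_of_ereal (X t \<omega>) = real_of_ereal (X t\<^sub>0 \<omega>)
             + (LBINT s:{t\<^sub>0..t}. b s (real_of_ereal (X s \<omega>))) + I \<omega>))"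

end

theory Submission
  imports Defs
begin

text \<open>
  Put \<open>\<alpha> = \<gamma> / (2 (1 - \<gamma>))\<close>, so that \<open>\<alpha> > 1/2\<close> and the noise \<open>t\<^sup>-\<^sup>\<alpha> dB\<^sub>t\<close> has finite total
  variance. Let \<open>N\<^sub>t\<close> be the noise still to come after time \<open>t\<close>. As long as \<open>X\<close> is finite,
  \<open>X\<^sub>t + N\<^sub>t\<close> is nondecreasing with derivative \<open>\<bar>X\<^sub>t\<bar>\<^sup>k\<close>, and \<open>N\<^sub>t\<close> tends to \<open>0\<close>. Hence a path that does
  not explode converges to some \<open>l\<close> in \<open>(-\<infinity>, \<infinity>]\<close>, and \<open>l\<close> is \<open>0\<close> or \<open>\<infinity>\<close> because a finite
  \<open>l \<noteq> 0\<close> would make the accumulated drift infinite. It remains to exclude \<open>l = 0\<close>. This is where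
  the condition on \<open>k\<close> and \<open>\<gamma>\<close> enters; with \<open>\<beta> = \<alpha> - 1/2\<close> it says \<open>(k - 1) \<beta> < 1\<close>.

  Suppose \<open>X\<^sub>t\<close> tends to \<open>0\<close>. Then \<open>X\<^sub>t = - (D\<^sub>t + N\<^sub>t)\<close> where \<open>D\<^sub>t \<ge> 0\<close> is the drift still to come,
  and \<open>D\<close> decreases at rate \<open>\<bar>D\<^sub>t + N\<^sub>t\<bar>\<^sup>k\<close>. The noise \<open>N\<^sub>t\<close> is of order \<open>t\<^sup>-\<^sup>\<beta>\<close> up to small powers.
  Where \<open>D\<close> dominates it, \<open>D\<close> decays like a solution of \<open>D' = - D\<^sup>k\<close>, that is like
  \<open>t\<close> to the power \<open>- 1 / (k - 1)\<close>, which is faster than \<open>t\<^sup>-\<^sup>\<beta>\<close>. So \<open>D\<close> is at most of the order of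
  the noise (\<open>ode_dichotomy\<close>). On the other hand \<open>D \<ge> 0\<close> forces the positive part of \<open>N\<close> below
  \<open>\<bar>X\<bar>\<close>, so the integral of \<open>max 0 N\<^sub>s\<close> to the power \<open>k\<close> over \<open>[2\<^sup>n, 2\<^sup>n\<^sup>+\<^sup>1]\<close> is at most the value of
  \<open>D\<close> at \<open>2\<^sup>n\<close>. Under the condition on \<open>k\<close>
  this makes the average over \<open>[2\<^sup>n, 2\<^sup>n\<^sup>+\<^sup>1]\<close> of \<open>max 0 (s\<^sup>\<beta> N\<^sub>s)\<close> tend to \<open>0\<close>
  (\<open>weighted_average_tendsto_0\<close>).

  That is impossible with positive probability. By scaling, \<open>s\<^sup>\<beta> N\<^sub>s\<close> does not become small in law, and
  it is built from increments after \<open>s\<close>, which are independent of the past: its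
  positive part has expectation at least \<open>c P(G)\<close> on every event \<open>G\<close> known at time \<open>s\<close>. An event on
  which the averages tend to \<open>0\<close> and which the whole filtration determines
  can be approximated by such events \<open>G\<close>, and is therefore
  null (\<open>null_if_averaged_tail_vanishes\<close>).

  The argument is pathwise as far as possible. Integration by parts turns the Ito integrals, which
  are given separately for each time and only up to null sets, into the functional
  \<open>\<alpha> \<integral> r\<^sup>-\<^sup>\<alpha>\<^sup>-\<^sup>1 (B\<^sub>r - B\<^sub>s) dr\<close> over \<open>[s, \<infinity>)\<close> of the path, which is \<open>N\<^sub>s\<close> for all \<open>s\<close>
  at once (\<open>ito_integral_by_parts\<close>, \<open>tail_noise_diff\<close>). The order of \<open>N\<^sub>s\<close> follows from the growth of
  the path (\<open>brownian_path_growth\<close>). Both the identification of the Ito integral and the maximal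
  inequality behind the growth bound come from the Ito isometry (\<open>simple_ito_isometry\<close>).
\<close>

section \<open>Increments of Brownian motion\<close>

lemma Int_stable_vimage: "Int_stable {f -` A \<inter> S |A. A \<in> sets N}"
proof (rule Int_stableI, safe)
  fix A B assume "A \<in> sets N" "B \<in> sets N"
  then show "\<exists>C. f -` A \<inter> S \<inter> (f -` B \<inter> S) = f -` C \<inter> S \<and> C \<in> sets N"
    by (intro exI[of _ "A \<inter> B"]) auto
qed

context brownian_motion
begin

lemma space_F: "space (F t) = space M"
  using subalg by (simp add: subalgebra_def)

lemma sets_F: "A \<in> sets (F t) \<Longrightarrow> A \<in> sets M"
  using subalg by (auto simp: subalgebra_def)

lemma F_mono: "s \<le> t \<Longrightarrow> subalgebra (F t) (F s)"
  using sets_F_mono space_F by (auto simp: subalgebra_def)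

lemma measurable_F_mono: "f \<in> borel_measurable (F s) \<Longrightarrow> s \<le> t \<Longrightarrow> f \<in> borel_measurable (F t)"
  using measurable_from_subalg[OF F_mono] by blast

lemma measurable_F_M: "f \<in> borel_measurable (F s) \<Longrightarrow> f \<in> borel_measurable M"
  using measurable_from_subalg[OF subalg] by blast

lemma B_measurable [measurable]: "0 \<le> t \<Longrightarrow> B t \<in> borel_measurable M"
  using adapted measurable_F_M by blast

lemma increment_measurable [measurable]:
  "0 \<le> s \<Longrightarrow> 0 \<le> t \<Longrightarrow> (\<lambda>\<omega>. B t \<omega> - B s \<omega>) \<in> borel_measurable M"
  by (intro borel_measurable_diff B_measurable)

lemma increment_measurable_F:
  "0 \<le> s \<Longrightarrow> 0 \<le> t \<Longrightarrow> s \<le> v \<Longrightarrow> t \<le> v \<Longrightarrow> (\<lambda>\<omega>. B t \<omega> - B s \<omega>) \<in> borel_measurable (F v)"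
  by (intro borel_measurable_diff) (auto intro: measurable_F_mono adapted)

text \<open>
  An increment is independent of the past as a family of events; this is the form in which that is
  used, as a product rule for expectations.
\<close>

lemma increment_indep_mult:
  fixes \<xi> :: "'a \<Rightarrow> real" and g :: "real \<Rightarrow> real"
  assumes "0 \<le> s" "s < t" and \<xi>: "\<xi> \<in> borel_measurable (F s)" "integrable M \<xi>"
    and g: "g \<in> borel_measurable borel" "integrable M (\<lambda>\<omega>. g (B t \<omega> - B s \<omega>))"
  shows "integrable M (\<lambda>\<omega>. \<xi> \<omega> * g (B t \<omega> - B s \<omega>))"
    and "(\<integral>\<omega>. \<xi> \<omega> * g (B t \<omega> - B s \<omega>) \<partial>M) = (\<integral>\<omega>. \<xi> \<omega> \<partial>M) * (\<integral>\<omega>. g (B t \<omega> - B s \<omega>) \<partial>M)"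
proof -
  let ?D = "\<lambda>\<omega>. B t \<omega> - B s \<omega>"
  let ?G = "{?D -` A \<inter> space M | A. A \<in> sets borel}"
  have "indep_var borel \<xi> borel (\<lambda>\<omega>. g (?D \<omega>))"
    unfolding indep_var_eq
  proof (intro conjI)
    show "random_variable borel \<xi>" using \<xi>(1) measurable_F_M by blast
    show "random_variable borel (\<lambda>\<omega>. g (?D \<omega>))"
      using measurable_compose[OF increment_measurable g(1)] assms(1,2) by simp
    show "indep_set (sigma_sets (space M) {\<xi> -` A \<inter> space M |A. A \<in> sets borel})
     (sigma_sets (space M) {(\<lambda>\<omega>. g (?D \<omega>)) -` A \<inter> space M |A. A \<in> sets borel})"
    proof (rule indep_set_sigma_sets)
      show "indep_set {\<xi> -` A \<inter> space M |A. A \<in> sets borel}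
            {(\<lambda>\<omega>. g (?D \<omega>)) -` A \<inter> space M |A. A \<in> sets borel}"
        unfolding indep_set_def
      proof (rule indep_sets_mono_sets[OF increment_indep[OF assms(1,2), unfolded indep_set_def]])
        fix i :: bool
        have "{\<xi> -` A \<inter> space M |A. A \<in> sets borel} \<subseteq> sets (F s)"
          using measurable_sets[OF \<xi>(1)] space_F by auto
        moreover have "{(\<lambda>\<omega>. g (?D \<omega>)) -` A \<inter> space M |A. A \<in> sets borel} \<subseteq> ?G"
        proof safe
          fix A :: "real set" assume A: "A \<in> sets borel"
          have "g -` A \<in> sets borel" using measurable_sets[OF g(1) A] by simp
          moreover have "(\<lambda>\<omega>. g (?D \<omega>)) -` A \<inter> space M = ?D -` (g -` A) \<inter> space M" by auto
          ultimately show "\<exists>A'. (\<lambda>\<omega>. g (?D \<omega>)) -` A \<inter> space M = ?D -` A' \<inter> space M \<and> A' \<in> sets borel"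
            by blast
        qed
        ultimately show "case_bool {\<xi> -` A \<inter> space M |A. A \<in> sets borel}
            {(\<lambda>\<omega>. g (?D \<omega>)) -` A \<inter> space M |A. A \<in> sets borel} i \<subseteq> case_bool (sets (F s)) ?G i"
          by (cases i) simp_all
      qed
    next
      show "Int_stable {\<xi> -` A \<inter> space M |A. A \<in> sets borel}"
        by (rule Int_stable_vimage)
      show "Int_stable {(\<lambda>\<omega>. g (?D \<omega>)) -` A \<inter> space M |A. A \<in> sets borel}"
        by (rule Int_stable_vimage)
    qed
  qed
  from indep_var_integrable[OF this \<xi>(2) g(2)] indep_var_lebesgue_integral[OF this \<xi>(2) g(2)]
  show "integrable M (\<lambda>\<omega>. \<xi> \<omega> * g (B t \<omega> - B s \<omega>))"
    and "(\<integral>\<omega>. \<xi> \<omega> * g (B t \<omega> - B s \<omega>) \<partial>M) = (\<integral>\<omega>. \<xi> \<omega> \<partial>M) * (\<integral>\<omega>. g (B t \<omega> - B s \<omega>) \<partial>M)" .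
qed

lemma increment_integrable:
  assumes "0 \<le> s" "s < t"
  shows "integrable M (\<lambda>\<omega>. (B t \<omega> - B s \<omega>) ^ n)"
    and "integrable M (\<lambda>\<omega>. \<bar>B t \<omega> - B s \<omega>\<bar>)"
proof -
  note D = increment_normal[OF assms]
  have p: "0 < sqrt (t - s)" using assms by simp
  show "integrable M (\<lambda>\<omega>. (B t \<omega> - B s \<omega>) ^ n)"
    using distributed_integrable[OF D, of "\<lambda>x. x^n"] integrable_normal_moment[OF p, of 0 n] by simp
  show "integrable M (\<lambda>\<omega>. \<bar>B t \<omega> - B s \<omega>\<bar>)"
    using distributed_integrable[OF D, of "\<lambda>x. \<bar>x\<bar>"] integrable_normal_moment_abs[OF p, of 0 1] by simp
qed

lemma increment_mean:
  assumes "0 \<le> s" "s < t" shows "(\<integral>\<omega>. B t \<omega> - B s \<omega> \<partial>M) = 0"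
proof -
  note D = increment_normal[OF assms]
  have p: "0 < sqrt (t - s)" using assms by simp
  show ?thesis using distributed_integral[OF D, of "\<lambda>x. x"] integral_normal_moment_nz_1[OF p, of 0] by simp
qed

lemma increment_second_moment:
  assumes "0 \<le> s" "s < t" shows "(\<integral>\<omega>. (B t \<omega> - B s \<omega>)\<^sup>2 \<partial>M) = t - s"
proof -
  note D = increment_normal[OF assms]
  have p: "0 < sqrt (t - s)" using assms by simp
  show ?thesis using distributed_integral[OF D, of "\<lambda>x. x^2"] integral_normal_moment_even[OF p, of 0 1] assms
    by (simp add: fact_numeral)
qed

lemma increment_abs_moment:
  assumes "0 \<le> s" "s < t" shows "(\<integral>\<omega>. \<bar>B t \<omega> - B s \<omega>\<bar> \<partial>M) = sqrt (2 * (t - s) / pi)"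
proof -
  note D = increment_normal[OF assms]
  have p: "0 < sqrt (t - s)" using assms by simp
  show ?thesis using distributed_integral[OF D, of "\<lambda>x. \<bar>x\<bar>"] integral_normal_moment_abs_odd[OF p, of 0 0] assms
      real_sqrt_mult[of "t - s" "2 / pi"] by (simp add: mult.commute)
qed

lemma increment_square_integrable:
  assumes "0 \<le> s" "s \<le> t"
  shows "integrable M (\<lambda>\<omega>. (B t \<omega> - B s \<omega>)\<^sup>2)"
  using increment_integrable(1)[of s t 2] assms by (cases "s = t") auto


lemma increment_martingale:
  assumes "0 \<le> s" "s \<le> t" "\<zeta> \<in> borel_measurable (F s)" "integrable M \<zeta>"
  shows "integrable M (\<lambda>\<omega>. \<zeta> \<omega> * (B t \<omega> - B s \<omega>))"
    and "(\<integral>\<omega>. \<zeta> \<omega> * (B t \<omega> - B s \<omega>) \<partial>M) = 0"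
proof -
  have "integrable M (\<lambda>\<omega>. \<zeta> \<omega> * (B t \<omega> - B s \<omega>)) \<and> (\<integral>\<omega>. \<zeta> \<omega> * (B t \<omega> - B s \<omega>) \<partial>M) = 0"
  proof (cases "s = t")
    case False
    then have st: "s < t" using assms by simp
    show ?thesis
      using increment_indep_mult[OF assms(1) st assms(3,4), of "\<lambda>x. x"]
        increment_integrable(1)[OF assms(1) st, of 1] increment_mean[OF assms(1) st] by simp
  qed simp
  then show "integrable M (\<lambda>\<omega>. \<zeta> \<omega> * (B t \<omega> - B s \<omega>))"
    and "(\<integral>\<omega>. \<zeta> \<omega> * (B t \<omega> - B s \<omega>) \<partial>M) = 0" by auto
qed

lemma bounded_mult_integrable:
  fixes \<zeta> f :: "'a \<Rightarrow> real"
  assumes "\<zeta> \<in> borel_measurable M" "\<And>\<omega>. \<omega> \<in> space M \<Longrightarrow> \<bar>\<zeta> \<omega>\<bar> \<le> C" "integrable M f"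
  shows "integrable M (\<lambda>\<omega>. \<zeta> \<omega> * f \<omega>)"
proof (rule Bochner_Integration.integrable_bound[where f="\<lambda>\<omega>. C * f \<omega>"])
  show "(\<lambda>\<omega>. \<zeta> \<omega> * f \<omega>) \<in> borel_measurable M" using assms by measurable
  show "AE \<omega> in M. norm (\<zeta> \<omega> * f \<omega>) \<le> norm (C * f \<omega>)"
  proof (rule AE_I2)
    fix \<omega> assume "\<omega> \<in> space M"
    then have "\<bar>\<zeta> \<omega>\<bar> \<le> \<bar>C\<bar>" using assms(2)[of \<omega>] by linarith
    then show "norm (\<zeta> \<omega> * f \<omega>) \<le> norm (C * f \<omega>)" by (simp add: abs_mult mult_right_mono)
  qed
qed (use assms in simp)

lemma increment_product_integrable:
  assumes "0 \<le> u" "u \<le> v" "0 \<le> x" "x \<le> y"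
  shows "integrable M (\<lambda>\<omega>. (B v \<omega> - B u \<omega>) * (B y \<omega> - B x \<omega>))"
proof (rule Bochner_Integration.integrable_bound[where f="\<lambda>\<omega>. (B v \<omega> - B u \<omega>)\<^sup>2 + (B y \<omega> - B x \<omega>)\<^sup>2"])
  show "integrable M (\<lambda>\<omega>. (B v \<omega> - B u \<omega>)\<^sup>2 + (B y \<omega> - B x \<omega>)\<^sup>2)"
    using assms by (intro Bochner_Integration.integrable_add increment_square_integrable)
  show "(\<lambda>\<omega>. (B v \<omega> - B u \<omega>) * (B y \<omega> - B x \<omega>)) \<in> borel_measurable M"
    using assms by (intro borel_measurable_times increment_measurable) auto
  have "\<bar>a * b\<bar> \<le> a\<^sup>2 + b\<^sup>2" for a b :: real
    using sum_squares_bound[of "\<bar>a\<bar>" "\<bar>b\<bar>"] mult_nonneg_nonneg[of "\<bar>a\<bar>" "\<bar>b\<bar>"] unfolding abs_mult power2_abs by linarith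
  then show "AE \<omega> in M. norm ((B v \<omega> - B u \<omega>) * (B y \<omega> - B x \<omega>)) \<le> norm ((B v \<omega> - B u \<omega>)\<^sup>2 + (B y \<omega> - B x \<omega>)\<^sup>2)"
    by (intro AE_I2) simp
qed

text \<open>
  Split the longer increment at \<open>p\<close>: the part after \<open>p\<close> has mean zero given the past of \<open>p\<close>, and
  the square of the part before \<open>p\<close> has mean \<open>p - x\<close> given the past of \<open>x\<close>.
\<close>

lemma increment_covariance_same_start:
  assumes "0 \<le> x" "x \<le> p" "p \<le> q" and \<zeta>: "\<zeta> \<in> borel_measurable (F x)"
    and bd: "\<And>\<omega>. \<omega> \<in> space M \<Longrightarrow> \<bar>\<zeta> \<omega>\<bar> \<le> C"
  shows "(\<integral>\<omega>. \<zeta> \<omega> * ((B p \<omega> - B x \<omega>) * (B q \<omega> - B x \<omega>)) \<partial>M) = (\<integral>\<omega>. \<zeta> \<omega> \<partial>M) * (p - x)"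
proof (cases "x = p")
  case False
  then have xp: "x < p" using assms by simp
  have \<zeta>M: "\<zeta> \<in> borel_measurable M" using measurable_F_M[OF \<zeta>] .
  have \<zeta>i: "integrable M \<zeta>" using bounded_mult_integrable[OF \<zeta>M bd, of "\<lambda>_. 1"] by simp
  note 1 = increment_indep_mult[OF assms(1) xp \<zeta> \<zeta>i, of "\<lambda>x. x\<^sup>2"]
  have "integrable M (\<lambda>\<omega>. \<zeta> \<omega> * (B p \<omega> - B x \<omega>))"
    using increment_martingale(1)[OF assms(1,2) \<zeta> \<zeta>i] .
  moreover have "(\<lambda>\<omega>. \<zeta> \<omega> * (B p \<omega> - B x \<omega>)) \<in> borel_measurable (F p)"
    using assms by (intro borel_measurable_times increment_measurable_F measurable_F_mono[OF \<zeta>]) auto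
  ultimately have 2: "integrable M (\<lambda>\<omega>. \<zeta> \<omega> * (B p \<omega> - B x \<omega>) * (B q \<omega> - B p \<omega>))"
      "(\<integral>\<omega>. \<zeta> \<omega> * (B p \<omega> - B x \<omega>) * (B q \<omega> - B p \<omega>) \<partial>M) = 0"
    using increment_martingale[of p q "\<lambda>\<omega>. \<zeta> \<omega> * (B p \<omega> - B x \<omega>)"] assms by auto
  have "(\<integral>\<omega>. \<zeta> \<omega> * ((B p \<omega> - B x \<omega>) * (B q \<omega> - B x \<omega>)) \<partial>M)
     = (\<integral>\<omega>. \<zeta> \<omega> * (B p \<omega> - B x \<omega>)\<^sup>2 + \<zeta> \<omega> * (B p \<omega> - B x \<omega>) * (B q \<omega> - B p \<omega>) \<partial>M)"
    by (intro Bochner_Integration.integral_cong refl) (simp add: algebra_simps power2_eq_square)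
  also have "\<dots> = (\<integral>\<omega>. \<zeta> \<omega> \<partial>M) * (p - x)"
    using 1 2 increment_second_moment[OF assms(1) xp] increment_integrable(1)[OF assms(1) xp, of 2] by simp
  finally show ?thesis .
qed simp

lemma increment_covariance_aux:
  assumes "0 \<le> u" "u \<le> v" "x \<le> y" "u \<le> x"
    and \<xi>: "\<xi> \<in> borel_measurable (F u)" "\<And>\<omega>. \<omega> \<in> space M \<Longrightarrow> \<bar>\<xi> \<omega>\<bar> \<le> C"
    and \<eta>: "\<eta> \<in> borel_measurable (F x)" "\<And>\<omega>. \<omega> \<in> space M \<Longrightarrow> \<bar>\<eta> \<omega>\<bar> \<le> D"
  shows "(\<integral>\<omega>. (\<xi> \<omega> * \<eta> \<omega>) * ((B v \<omega> - B u \<omega>) * (B y \<omega> - B x \<omega>)) \<partial>M)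
    = (\<integral>\<omega>. \<xi> \<omega> * \<eta> \<omega> \<partial>M) * max 0 (min v y - max u x)"
proof -
  let ?\<zeta> = "\<lambda>\<omega>. \<xi> \<omega> * \<eta> \<omega>"
  have \<zeta>: "?\<zeta> \<in> borel_measurable (F x)"
    using measurable_F_mono[OF \<xi>(1) \<open>u \<le> x\<close>] \<eta>(1) by measurable
  have \<zeta>M: "?\<zeta> \<in> borel_measurable M" using measurable_F_M[OF \<zeta>] .
  have bd: "\<bar>?\<zeta> \<omega>\<bar> \<le> C * D" if "\<omega> \<in> space M" for \<omega>
    using mult_mono[OF \<xi>(2)[OF that] \<eta>(2)[OF that]] abs_ge_zero[of "\<xi> \<omega>"] \<xi>(2)[OF that]
    unfolding abs_mult by linarith
  \<comment> \<open>whatever happens before \<open>x\<close> is orthogonal to the second increment\<close>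
  have past: "(\<integral>\<omega>. ?\<zeta> \<omega> * ((B w \<omega> - B u \<omega>) * (B y \<omega> - B x \<omega>)) \<partial>M) = 0" if "u \<le> w" "w \<le> x" for w
  proof -
    have I: "integrable M (\<lambda>\<omega>. B w \<omega> - B u \<omega>)"
      using increment_integrable(1)[of u w 1] assms that by (cases "u = w") auto
    have "integrable M (\<lambda>\<omega>. ?\<zeta> \<omega> * (B w \<omega> - B u \<omega>))"
      by (rule bounded_mult_integrable[OF \<zeta>M bd I])
    moreover have "(\<lambda>\<omega>. ?\<zeta> \<omega> * (B w \<omega> - B u \<omega>)) \<in> borel_measurable (F x)"
      using assms that by (intro borel_measurable_times[OF \<zeta>] increment_measurable_F) auto
    ultimately show ?thesis
      using increment_martingale(2)[of x y "\<lambda>\<omega>. ?\<zeta> \<omega> * (B w \<omega> - B u \<omega>)"] assms by (simp add: mult.assoc)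
  qed
  show ?thesis
  proof (cases "v \<le> x")
    case True
    then show ?thesis using past[of v] assms by (simp add: max_def min_def)
  next
    case False
    have i1: "integrable M (\<lambda>\<omega>. ?\<zeta> \<omega> * ((B x \<omega> - B u \<omega>) * (B y \<omega> - B x \<omega>)))"
      using assms by (intro bounded_mult_integrable[OF \<zeta>M bd] increment_product_integrable) auto
    have i2: "integrable M (\<lambda>\<omega>. ?\<zeta> \<omega> * ((B v \<omega> - B x \<omega>) * (B y \<omega> - B x \<omega>)))"
      using assms False by (intro bounded_mult_integrable[OF \<zeta>M bd] increment_product_integrable) auto
    have "(\<integral>\<omega>. ?\<zeta> \<omega> * ((B v \<omega> - B u \<omega>) * (B y \<omega> - B x \<omega>)) \<partial>M) =
      (\<integral>\<omega>. ?\<zeta> \<omega> * ((B x \<omega> - B u \<omega>) * (B y \<omega> - B x \<omega>)) + ?\<zeta> \<omega> * ((B v \<omega> - B x \<omega>) * (B y \<omega> - B x \<omega>)) \<partial>M)"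
      by (intro Bochner_Integration.integral_cong refl) (simp add: algebra_simps)
    also have "\<dots> = (\<integral>\<omega>. ?\<zeta> \<omega> * ((B v \<omega> - B x \<omega>) * (B y \<omega> - B x \<omega>)) \<partial>M)"
      using i1 i2 past[of x] assms by simp
    also have "\<dots> = (\<integral>\<omega>. ?\<zeta> \<omega> \<partial>M) * (min v y - x)"
    proof (cases "v \<le> y")
      case True
      then show ?thesis using increment_covariance_same_start[OF _ _ True \<zeta> bd] assms False by (simp add: mult.commute)
    next
      case F: False
      then show ?thesis using increment_covariance_same_start[of x y v, OF _ _ _ \<zeta> bd] assms False by (simp add: mult.commute)
    qed
    finally show ?thesis using assms False by (simp add: max_def min_def)
  qed
qed

text \<open>
  The factor \<open>max 0 (min v y - max u x)\<close> is the length of the overlap of the two intervals: only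
  the part of the increments over the overlap is correlated. This bilinear form of the isometry
  covers simple integrands with overlapping intervals.
\<close>

lemma increment_covariance:
  assumes "0 \<le> u" "u \<le> v" "0 \<le> x" "x \<le> y"
    and \<xi>: "\<xi> \<in> borel_measurable (F u)" "\<And>\<omega>. \<omega> \<in> space M \<Longrightarrow> \<bar>\<xi> \<omega>\<bar> \<le> C"
    and \<eta>: "\<eta> \<in> borel_measurable (F x)" "\<And>\<omega>. \<omega> \<in> space M \<Longrightarrow> \<bar>\<eta> \<omega>\<bar> \<le> D"
  shows "(\<integral>\<omega>. (\<xi> \<omega> * (B v \<omega> - B u \<omega>)) * (\<eta> \<omega> * (B y \<omega> - B x \<omega>)) \<partial>M)
    = (\<integral>\<omega>. \<xi> \<omega> * \<eta> \<omega> \<partial>M) * max 0 (min v y - max u x)"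
proof (cases "u \<le> x")
  case True
  show ?thesis using increment_covariance_aux[OF assms(1,2,4) True \<xi> \<eta>] by (simp add: ac_simps)
next
  case False
  then show ?thesis using increment_covariance_aux[OF assms(3,4,2) _ \<eta> \<xi>]
    by (simp add: ac_simps)
qed

end

section \<open>The Ito isometry for simple integrands\<close>

lemma simple_value_eq:
  "simple_value S s \<omega> = (\<Sum>i<length S. snd (snd (S!i)) \<omega> * indicator {fst (S!i)<..fst (snd (S!i))} s)"
  unfolding simple_value_def sum_list_sum_nth
  by (simp add: case_prod_beta atLeast0LessThan)

lemma simple_ito_integral_eq:
  "simple_ito_integral B S \<omega> = (\<Sum>i<length S. snd (snd (S!i)) \<omega> * (B (fst (snd (S!i))) \<omega> - B (fst (S!i)) \<omega>))"
  unfolding simple_ito_integral_def sum_list_sum_nth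
  by (simp add: case_prod_beta atLeast0LessThan)

lemma integral_double_sum:
  fixes f :: "'i \<Rightarrow> 'j \<Rightarrow> 'b \<Rightarrow> real"
  assumes "\<And>i j. i \<in> I \<Longrightarrow> j \<in> J \<Longrightarrow> integrable N (f i j)"
  shows "integrable N (\<lambda>x. \<Sum>i\<in>I. \<Sum>j\<in>J. f i j x)"
    and "(\<integral>x. (\<Sum>i\<in>I. \<Sum>j\<in>J. f i j x) \<partial>N) = (\<Sum>i\<in>I. \<Sum>j\<in>J. \<integral>x. f i j x \<partial>N)"
proof -
  have *: "integrable N (\<lambda>x. \<Sum>j\<in>J. f i j x)" if "i \<in> I" for i
    using assms that by (intro Bochner_Integration.integrable_sum) auto
  then show "integrable N (\<lambda>x. \<Sum>i\<in>I. \<Sum>j\<in>J. f i j x)" by (rule Bochner_Integration.integrable_sum)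
  show "(\<integral>x. (\<Sum>i\<in>I. \<Sum>j\<in>J. f i j x) \<partial>N) = (\<Sum>i\<in>I. \<Sum>j\<in>J. \<integral>x. f i j x \<partial>N)"
    using assms by (subst Bochner_Integration.integral_sum[OF *])
      (auto intro!: sum.cong Bochner_Integration.integral_sum)
qed

lemma integral_indicator_overlap:
  fixes u v x y :: real
  shows "integrable lborel (\<lambda>s. indicator {u<..v} s * indicator {x<..y} s :: real)"
    and "(LBINT s. indicator {u<..v} s * indicator {x<..y} s) = max 0 (min v y - max u x)"
proof -
  have eq: "(\<lambda>s. indicator {u<..v} s * indicator {x<..y} s :: real) = indicator {max u x<..min v y}"
    by (auto simp: fun_eq_iff indicator_def)
  show "integrable lborel (\<lambda>s. indicator {u<..v} s * indicator {x<..y} s :: real)"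
    unfolding eq by (cases "max u x \<le> min v y") auto
  show "(LBINT s. indicator {u<..v} s * indicator {x<..y} s) = max 0 (min v y - max u x)"
    unfolding eq by (cases "max u x \<le> min v y") (auto simp: max_def)
qed

context brownian_motion
begin

lemma simple_value_measurable:
  assumes "simple_integrand F a b S"
  shows "(\<lambda>(s, \<omega>). simple_value S s \<omega>) \<in> borel_measurable (lborel \<Otimes>\<^sub>M M)"
proof -
  have \<xi>: "snd (snd (S!i)) \<in> borel_measurable M" if i: "i < length S" for i
  proof -
    obtain u v \<xi> where e: "S!i = (u, v, \<xi>)" by (cases "S!i")
    then have "(u, v, \<xi>) \<in> set S" using nth_mem[OF i] by simp
    then have "\<xi> \<in> borel_measurable (F u)" using assms unfolding simple_integrand_def by auto
    then show ?thesis using measurable_F_M e by simp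
  qed
  have "(\<lambda>p. snd (snd (S!i)) (snd p) * indicator {fst (S!i)<..fst (snd (S!i))} (fst p)) \<in> borel_measurable (lborel \<Otimes>\<^sub>M M)"
    if "i < length S" for i
  proof -
    note [measurable] = \<xi>[OF that]
    show ?thesis by measurable
  qed
  then show ?thesis
    unfolding simple_value_eq case_prod_beta by (intro borel_measurable_sum) auto
qed

text \<open>
  Expanding both squares as double sums reduces the identity to the covariance of two increments,
  since the overlap of two intervals is the integral of the product of their indicators.
\<close>

lemma simple_ito_isometry:
  assumes "simple_integrand F a b S" "0 \<le> a"
  shows "(\<integral>\<^sup>+ \<omega>. ennreal ((simple_ito_integral B S \<omega>)\<^sup>2) \<partial>M)
       = (\<integral>\<^sup>+ (s, \<omega>). ennreal ((simple_value S s \<omega>)\<^sup>2) \<partial>(lborel \<Otimes>\<^sub>M M))"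
proof -
  interpret lM: pair_sigma_finite lborel M ..
  define n where "n = length S"
  define u where "u i = fst (S!i)" for i
  define v where "v i = fst (snd (S!i))" for i
  define \<xi> where "\<xi> i = snd (snd (S!i))" for i
  have S: "0 \<le> u i" "u i \<le> v i" "\<xi> i \<in> borel_measurable (F (u i))"
    "\<exists>C. \<forall>\<omega>\<in>space M. \<bar>\<xi> i \<omega>\<bar> \<le> C" if "i < n" for i
  proof -
    have "S!i \<in> set S" using that by (simp add: n_def)
    then show "0 \<le> u i" "u i \<le> v i" "\<xi> i \<in> borel_measurable (F (u i))"
        "\<exists>C. \<forall>\<omega>\<in>space M. \<bar>\<xi> i \<omega>\<bar> \<le> C"
      using assms unfolding simple_integrand_def u_def v_def \<xi>_def space_F by (cases "S!i"; fastforce)+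
  qed
  have \<xi>M: "\<xi> i \<in> borel_measurable M" if "i < n" for i using S(3)[OF that] measurable_F_M by blast
  from S(4) obtain C where C: "\<And>i \<omega>. i < n \<Longrightarrow> \<omega> \<in> space M \<Longrightarrow> \<bar>\<xi> i \<omega>\<bar> \<le> C i" by metis
  define l where "l i j = max 0 (min (v i) (v j) - max (u i) (u j))" for i j
  have \<xi>\<xi>M: "(\<lambda>\<omega>. \<xi> i \<omega> * \<xi> j \<omega>) \<in> borel_measurable M" if "i < n" "j < n" for i j
    using \<xi>M that by (intro borel_measurable_times) auto
  have \<xi>\<xi>b: "\<bar>\<xi> i \<omega> * \<xi> j \<omega>\<bar> \<le> C i * C j" if "i < n" "j < n" "\<omega> \<in> space M" for i j \<omega>
    using mult_mono[OF C C] that C[of i \<omega>] unfolding abs_mult by (meson abs_ge_zero order_trans)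
  have int1: "integrable M (\<lambda>\<omega>. (\<xi> i \<omega> * (B (v i) \<omega> - B (u i) \<omega>)) * (\<xi> j \<omega> * (B (v j) \<omega> - B (u j) \<omega>)))"
    if "i < n" "j < n" for i j
    using bounded_mult_integrable[OF \<xi>\<xi>M \<xi>\<xi>b increment_product_integrable[of "u i" "v i" "u j" "v j"]] that S
    by (simp add: ac_simps)
  have int2: "integrable M (\<lambda>\<omega>. \<xi> i \<omega> * \<xi> j \<omega>)" if "i < n" "j < n" for i j
    using bounded_mult_integrable[OF \<xi>\<xi>M \<xi>\<xi>b, of i j "\<lambda>_. 1"] that by simp
  have ito: "(simple_ito_integral B S \<omega>)\<^sup>2 =
    (\<Sum>i<n. \<Sum>j<n. (\<xi> i \<omega> * (B (v i) \<omega> - B (u i) \<omega>)) * (\<xi> j \<omega> * (B (v j) \<omega> - B (u j) \<omega>)))" for \<omega>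
    unfolding simple_ito_integral_eq power2_eq_square sum_product n_def u_def v_def \<xi>_def ..
  have val: "(simple_value S s \<omega>)\<^sup>2 =
    (\<Sum>i<n. \<Sum>j<n. (\<xi> i \<omega> * \<xi> j \<omega>) * (indicator {u i<..v i} s * indicator {u j<..v j} s))" for s \<omega>
    unfolding simple_value_eq power2_eq_square sum_product n_def u_def v_def \<xi>_def
    by (intro sum.cong refl) (simp add: ac_simps)
  have "(\<integral>\<^sup>+ \<omega>. ennreal ((simple_ito_integral B S \<omega>)\<^sup>2) \<partial>M) = ennreal (\<integral>\<omega>. (simple_ito_integral B S \<omega>)\<^sup>2 \<partial>M)"
  proof (rule nn_integral_eq_integral)
    show "integrable M (\<lambda>\<omega>. (simple_ito_integral B S \<omega>)\<^sup>2)"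
      unfolding ito by (rule integral_double_sum) (auto intro: int1)
  qed simp
  also have "(\<integral>\<omega>. (simple_ito_integral B S \<omega>)\<^sup>2 \<partial>M) = (\<Sum>i<n. \<Sum>j<n. (\<integral>\<omega>. \<xi> i \<omega> * \<xi> j \<omega> \<partial>M) * l i j)"
  proof -
    have "(\<integral>\<omega>. (simple_ito_integral B S \<omega>)\<^sup>2 \<partial>M) =
      (\<Sum>i<n. \<Sum>j<n. (\<integral>\<omega>. (\<xi> i \<omega> * (B (v i) \<omega> - B (u i) \<omega>)) * (\<xi> j \<omega> * (B (v j) \<omega> - B (u j) \<omega>)) \<partial>M))"
      unfolding ito by (rule integral_double_sum) (auto intro: int1)
    also have "\<dots> = (\<Sum>i<n. \<Sum>j<n. (\<integral>\<omega>. \<xi> i \<omega> * \<xi> j \<omega> \<partial>M) * l i j)"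
      unfolding l_def
      by (intro sum.cong refl, rule increment_covariance[OF _ _ _ _ _ C _ C]) (auto intro: S)
    finally show ?thesis .
  qed
  also have "\<dots> = (\<integral>\<omega>. (\<Sum>i<n. \<Sum>j<n. (\<xi> i \<omega> * \<xi> j \<omega>) * l i j) \<partial>M)"
    by (subst integral_double_sum(2)) (auto intro: int2)
  finally have L: "(\<integral>\<^sup>+ \<omega>. ennreal ((simple_ito_integral B S \<omega>)\<^sup>2) \<partial>M)
    = ennreal (\<integral>\<omega>. (\<Sum>i<n. \<Sum>j<n. (\<xi> i \<omega> * \<xi> j \<omega>) * l i j) \<partial>M)" .
  have inner: "integrable lborel (\<lambda>s. (simple_value S s \<omega>)\<^sup>2)"
     "(LBINT s. (simple_value S s \<omega>)\<^sup>2) = (\<Sum>i<n. \<Sum>j<n. (\<xi> i \<omega> * \<xi> j \<omega>) * l i j)" for \<omega>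
  proof -
    have *: "integrable lborel (\<lambda>s. (\<xi> i \<omega> * \<xi> j \<omega>) * (indicator {u i<..v i} s * indicator {u j<..v j} s))" for i j
      by (intro integrable_mult_right integral_indicator_overlap)
    show "integrable lborel (\<lambda>s. (simple_value S s \<omega>)\<^sup>2)"
      unfolding val by (rule integral_double_sum) (rule *)
    show "(LBINT s. (simple_value S s \<omega>)\<^sup>2) = (\<Sum>i<n. \<Sum>j<n. (\<xi> i \<omega> * \<xi> j \<omega>) * l i j)"
      unfolding val integral_double_sum(2)[OF *] l_def
      by (intro sum.cong refl) (simp only: integral_mult_right_zero integral_indicator_overlap(2))
  qed
  have pos: "0 \<le> (\<Sum>i<n. \<Sum>j<n. (\<xi> i \<omega> * \<xi> j \<omega>) * l i j)" for \<omega>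
    unfolding inner(2)[symmetric] by simp
  have "(\<integral>\<^sup>+ (s, \<omega>). ennreal ((simple_value S s \<omega>)\<^sup>2) \<partial>(lborel \<Otimes>\<^sub>M M)) = (\<integral>\<^sup>+ \<omega>. \<integral>\<^sup>+ s. ennreal ((simple_value S s \<omega>)\<^sup>2) \<partial>lborel \<partial>M)"
    using simple_value_measurable[OF assms(1)]
    by (subst lM.nn_integral_snd[symmetric]) (auto simp: case_prod_beta)
  also have "\<dots> = (\<integral>\<^sup>+ \<omega>. ennreal (\<Sum>i<n. \<Sum>j<n. (\<xi> i \<omega> * \<xi> j \<omega>) * l i j) \<partial>M)"
    using inner by (subst nn_integral_eq_integral) auto
  also have "\<dots> = ennreal (\<integral>\<omega>. (\<Sum>i<n. \<Sum>j<n. (\<xi> i \<omega> * \<xi> j \<omega>) * l i j) \<partial>M)"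
    using pos by (intro nn_integral_eq_integral integral_double_sum) (auto intro: int2)
  finally show ?thesis using L by simp
qed

end

section \<open>Ito integrals of deterministic integrands by parts\<close>

lemma simple_value_append: "simple_value (S @ T) s \<omega> = simple_value S s \<omega> + simple_value T s \<omega>"
  by (simp add: simple_value_def)

lemma simple_ito_integral_append:
  "simple_ito_integral B (S @ T) \<omega> = simple_ito_integral B S \<omega> + simple_ito_integral B T \<omega>"
  by (simp add: simple_ito_integral_def)

lemma simple_integrand_append:
  "simple_integrand F a b (S @ T) \<longleftrightarrow> simple_integrand F a b S \<and> simple_integrand F a b T"
  unfolding simple_integrand_def set_append ball_Un ..

lemma simple_value_outside:
  assumes "simple_integrand F a b S" "s \<notin> {a<..b}"
  shows "simple_value S s \<omega> = 0"
proof -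
  have "(case p of (u, v, \<xi>) \<Rightarrow> \<xi> \<omega> * indicator {u<..v} s) = 0" if "p \<in> set S" for p
    using assms that by (fastforce simp: simple_integrand_def indicator_def split: prod.splits)
  then show ?thesis unfolding simple_value_def by (simp add: sum_list_0 cong: map_cong)
qed

definition grid :: "real \<Rightarrow> real \<Rightarrow> nat \<Rightarrow> nat \<Rightarrow> real" where
  "grid a b m i = a + real i * (b - a) / real m"

lemma grid_0 [simp]: "grid a b m 0 = a"
  by (simp add: grid_def)

lemma grid_last [simp]: "0 < m \<Longrightarrow> grid a b m m = b"
  by (simp add: grid_def)

lemma grid_Suc: "grid a b m (Suc i) = grid a b m i + (b - a) / real m"
  by (simp add: grid_def add_divide_distrib distrib_right)

lemma grid_mono: "a \<le> b \<Longrightarrow> i \<le> j \<Longrightarrow> grid a b m i \<le> grid a b m j"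
  by (simp add: grid_def divide_right_mono mult_right_mono)

lemma grid_bounds:
  assumes "a \<le> b" "i \<le> m" "0 < m" shows "a \<le> grid a b m i" "grid a b m i \<le> b"
  using grid_mono[OF assms(1), of 0 i m] grid_mono[OF assms(1), of i m m] assms by auto

lemma sum_indicator_grid:
  assumes "a \<le> b"
  shows "(\<Sum>i<j. indicator {grid a b m i<..grid a b m (Suc i)} s) = (indicator {a<..grid a b m j} s :: real)"
proof (induction j)
  case (Suc j)
  then show ?case using grid_mono[OF assms, of 0 j m] grid_mono[OF assms, of j "Suc j" m]
    by (auto simp: indicator_def)
qed simp

text \<open>
  On each grid interval the left-point sum differs from the increment of
  \<open>\<sigma> f - \<integral> \<sigma>' f\<close> only by \<open>\<integral> \<sigma>' (s) (f s - f c') ds\<close> with \<open>c'\<close> the right end point, which the uniform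
  continuity of \<open>f\<close> makes small compared with the mesh.
\<close>

lemma stieltjes_sum_by_parts:
  fixes f \<sigma> \<sigma>' :: "real \<Rightarrow> real"
  assumes ab: "a \<le> b" and f: "continuous_on {a..b} f" and \<sigma>': "continuous_on {a..b} \<sigma>'"
    and der: "\<And>t. t \<in> {a..b} \<Longrightarrow> (\<sigma> has_real_derivative \<sigma>' t) (at t within {a..b})"
  shows "(\<lambda>m. \<Sum>i<m. \<sigma> (grid a b m i) * (f (grid a b m (Suc i)) - f (grid a b m i)))
     \<longlonglongrightarrow> \<sigma> b * f b - \<sigma> a * f a - integral {a..b} (\<lambda>s. \<sigma>' s * f s)"
proof (rule LIMSEQ_I)
  fix e :: real assume "e > 0"
  obtain L where L: "L > 0" "\<And>t. t \<in> {a..b} \<Longrightarrow> \<bar>\<sigma>' t\<bar> \<le> L"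
    using compact_imp_bounded[OF compact_continuous_image[OF \<sigma>' compact_Icc]]
    unfolding bounded_pos by auto
  define \<epsilon> where "\<epsilon> = e / (2 * L * (b - a + 1))"
  have \<epsilon>: "\<epsilon> > 0" using \<open>e > 0\<close> L ab by (simp add: \<epsilon>_def)
  obtain d where d: "d > 0" "\<And>s t. s \<in> {a..b} \<Longrightarrow> t \<in> {a..b} \<Longrightarrow> \<bar>s - t\<bar> < d \<Longrightarrow> \<bar>f s - f t\<bar> < \<epsilon>"
    using compact_uniformly_continuous[OF f compact_Icc] \<epsilon> unfolding uniformly_continuous_on_def dist_real_def
    by metis
  obtain N :: nat where N: "(b - a) / d < N" using reals_Archimedean2 by blast
  have int: "(\<lambda>s. \<sigma>' s * g s) integrable_on {c..c'}" if "a \<le> c" "c' \<le> b" "continuous_on {a..b} g" for c c' g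
    using that by (intro integrable_continuous_interval continuous_on_mult continuous_on_subset[OF \<sigma>']
        continuous_on_subset[OF that(3)]) auto
  define G where "G t = \<sigma> t * f t - integral {a..t} (\<lambda>s. \<sigma>' s * f s)" for t
  have "norm ((\<Sum>i<m. \<sigma> (grid a b m i) * (f (grid a b m (Suc i)) - f (grid a b m i)))
     - (\<sigma> b * f b - \<sigma> a * f a - integral {a..b} (\<lambda>s. \<sigma>' s * f s))) < e" if "m \<ge> Suc N" for m
  proof -
    define h where "h = (b - a) / m"
    have m: "m > 0" "real N < m" using that by auto
    have h: "0 \<le> h" "h < d" "m * h = b - a"
      using N m ab d by (auto simp: h_def divide_simps mult.commute intro: less_trans)
    let ?g = "grid a b m"
    have step: "\<bar>\<sigma> (?g i) * (f (?g (Suc i)) - f (?g i)) - (G (?g (Suc i)) - G (?g i))\<bar> \<le> L * \<epsilon> * h"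
      if i: "i < m" for i
    proof -
      define c c' where "c = ?g i" and "c' = ?g (Suc i)"
      have c: "a \<le> c" "c \<le> c'" "c' \<le> b" "c' = c + h"
        using grid_bounds[OF ab, of i m] grid_bounds[OF ab, of "Suc i" m] grid_Suc[of a b m i] i h(1)
        by (auto simp: c_def c'_def h_def)
      have "((\<lambda>s. \<sigma>' s) has_integral (\<sigma> c' - \<sigma> c)) {c..c'}"
        using c by (intro fundamental_theorem_of_calculus)
          (auto simp flip: has_real_derivative_iff_has_vector_derivative intro!: DERIV_subset[OF der])
      then have 1: "integral {c..c'} (\<lambda>s. \<sigma>' s * f c') = (\<sigma> c' - \<sigma> c) * f c'"
        by (simp add: integral_unique has_integral_mult_left)
      have 2: "integral {a..c'} (\<lambda>s. \<sigma>' s * f s) = integral {a..c} (\<lambda>s. \<sigma>' s * f s) + integral {c..c'} (\<lambda>s. \<sigma>' s * f s)"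
        using c by (intro Henstock_Kurzweil_Integration.integral_combine[symmetric] int f) auto
      have 3: "integral {c..c'} (\<lambda>s. \<sigma>' s * (f s - f c'))
          = integral {c..c'} (\<lambda>s. \<sigma>' s * f s) - integral {c..c'} (\<lambda>s. \<sigma>' s * f c')"
        unfolding right_diff_distrib using c
        by (intro Henstock_Kurzweil_Integration.integral_diff int f continuous_on_const) auto
      have "\<sigma> c * (f c' - f c) - (G c' - G c) = integral {c..c'} (\<lambda>s. \<sigma>' s * (f s - f c'))"
        unfolding 3 1 G_def 2 by (simp add: algebra_simps)
      also have "norm \<dots> \<le> (L * \<epsilon>) * (c' - c)"
      proof (rule integral_bound)
        show "continuous_on {c..c'} (\<lambda>s. \<sigma>' s * (f s - f c'))"
          using c by (intro continuous_intros continuous_on_subset[OF \<sigma>'] continuous_on_subset[OF f]) auto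
        fix s assume s: "s \<in> {c..c'}"
        then have "\<bar>f s - f c'\<bar> \<le> \<epsilon>" using d(2)[of s c'] c h by (auto intro: less_imp_le)
        then show "norm (\<sigma>' s * (f s - f c')) \<le> L * \<epsilon>"
          using L s c by (auto simp: abs_mult intro!: mult_mono)
      qed (use c in auto)
      finally show ?thesis using c unfolding c_def c'_def by simp
    qed
    have "(\<Sum>i<m. G (?g (Suc i)) - G (?g i)) = G b - G a"
      using sum_lessThan_telescope[of "\<lambda>i. G (?g i)" m] m by simp
    moreover have "G b - G a = \<sigma> b * f b - \<sigma> a * f a - integral {a..b} (\<lambda>s. \<sigma>' s * f s)"
      by (simp add: G_def)
    ultimately have "norm ((\<Sum>i<m. \<sigma> (?g i) * (f (?g (Suc i)) - f (?g i)))
         - (\<sigma> b * f b - \<sigma> a * f a - integral {a..b} (\<lambda>s. \<sigma>' s * f s)))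
      = norm (\<Sum>i<m. \<sigma> (?g i) * (f (?g (Suc i)) - f (?g i)) - (G (?g (Suc i)) - G (?g i)))"
      by (simp add: sum_subtractf)
    also have "\<dots> \<le> (\<Sum>i<m. L * \<epsilon> * h)"
      using step by (intro sum_norm_le) auto
    also have "\<dots> = L * \<epsilon> * (b - a)" by (simp add: mult_ac flip: h(3))
    also have "\<dots> \<le> L * \<epsilon> * (b - a + 1)" using L \<epsilon> by simp
    also have "\<dots> = e / 2"
    proof -
      have "L * (e / (2 * L * w)) * w = e / 2" if "w \<noteq> 0" for w using L(1) that by (simp add: field_simps)
      then show ?thesis using ab unfolding \<epsilon>_def by simp
    qed
    also have "\<dots> < e" using \<open>e > 0\<close> by simp
    finally show ?thesis .
  qed
  then show "\<exists>no. \<forall>n\<ge>no. norm ((\<Sum>i<n. \<sigma> (grid a b n i) * (f (grid a b n (Suc i)) - f (grid a b n i)))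
     - (\<sigma> b * f b - \<sigma> a * f a - integral {a..b} (\<lambda>s. \<sigma>' s * f s))) < e" by blast
qed

definition step_process :: "(real \<Rightarrow> real) \<Rightarrow> real \<Rightarrow> real \<Rightarrow> nat \<Rightarrow> 'a simple_process" where
  "step_process \<sigma> a b m = map (\<lambda>i. (grid a b m i, grid a b m (Suc i), \<lambda>_. \<sigma> (grid a b m i))) [0..<m]"

lemma simple_ito_integral_step_process:
  "simple_ito_integral B (step_process \<sigma> a b m) \<omega>
    = (\<Sum>i<m. \<sigma> (grid a b m i) * (B (grid a b m (Suc i)) \<omega> - B (grid a b m i) \<omega>))"
  by (simp add: simple_ito_integral_def step_process_def comp_def interv_sum_list_conv_sum_set_nat atLeast0LessThan)

lemma simple_value_step_process:
  "simple_value (step_process \<sigma> a b m) s \<omega>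
    = (\<Sum>i<m. \<sigma> (grid a b m i) * indicator {grid a b m i<..grid a b m (Suc i)} s)"
  by (simp add: simple_value_def step_process_def comp_def interv_sum_list_conv_sum_set_nat atLeast0LessThan)

lemma simple_integrand_step_process:
  "a \<le> b \<Longrightarrow> simple_integrand F a b (step_process \<sigma> a b m)"
  using grid_bounds[of a b] grid_mono[of a b]
  by (fastforce simp: simple_integrand_def step_process_def)

lemma step_process_approximates:
  assumes ab: "a \<le> b" and m: "0 < m"
    and L: "\<And>s t. s \<in> {a..b} \<Longrightarrow> t \<in> {a..b} \<Longrightarrow> \<bar>\<sigma> s - \<sigma> t\<bar> \<le> L * \<bar>s - t\<bar>" "0 \<le> L"
    and s: "s \<in> {a<..b}"
  shows "\<bar>simple_value (step_process \<sigma> a b m) s \<omega> - \<sigma> s\<bar> \<le> L * ((b - a) / m)"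
proof -
  let ?I = "\<lambda>i. indicator {grid a b m i<..grid a b m (Suc i)} s :: real"
  have one: "(\<Sum>i<m. ?I i) = 1" using sum_indicator_grid[OF ab, where m=m and j=m and s=s] m s by simp
  have "(\<Sum>i<m. (\<sigma> (grid a b m i) - \<sigma> s) * ?I i) = simple_value (step_process \<sigma> a b m) s \<omega> - \<sigma> s * (\<Sum>i<m. ?I i)"
    by (simp only: simple_value_step_process sum_distrib_left sum_subtractf left_diff_distrib)
  then have "\<bar>simple_value (step_process \<sigma> a b m) s \<omega> - \<sigma> s\<bar> = \<bar>\<Sum>i<m. (\<sigma> (grid a b m i) - \<sigma> s) * ?I i\<bar>"
    unfolding one by simp
  also have "\<dots> \<le> (\<Sum>i<m. L * ((b - a) / m) * ?I i)"
  proof (intro sum_norm_le[where 'a=real, unfolded real_norm_def])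
    fix i assume "i \<in> {..<m}"
    then have i: "i < m" by simp
    show "\<bar>(\<sigma> (grid a b m i) - \<sigma> s) * ?I i\<bar> \<le> L * ((b - a) / m) * ?I i"
    proof (cases "s \<in> {grid a b m i<..grid a b m (Suc i)}")
      case True
      then have "\<bar>grid a b m i - s\<bar> \<le> (b - a) / m" using grid_Suc[of a b m i] by auto
      moreover have "\<bar>\<sigma> (grid a b m i) - \<sigma> s\<bar> \<le> L * \<bar>grid a b m i - s\<bar>"
        using L(1) s i grid_bounds[OF ab, of i m] by auto
      moreover have "L * \<bar>grid a b m i - s\<bar> \<le> L * ((b - a) / m)"
        using calculation(1) L(2) by (rule mult_left_mono)
      ultimately have "\<bar>\<sigma> (grid a b m i) - \<sigma> s\<bar> \<le> L * ((b - a) / m)" by linarith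
      then show ?thesis using True by simp
    qed simp
  qed
  also have "\<dots> = L * ((b - a) / m)" unfolding sum_distrib_left[symmetric] one by simp
  finally show ?thesis .
qed

context brownian_motion
begin

lemma simple_ito_integral_measurable:
  assumes "simple_integrand F a b S" "0 \<le> a"
  shows "simple_ito_integral B S \<in> borel_measurable M"
proof -
  have "(\<lambda>\<omega>. snd (snd (S!i)) \<omega> * (B (fst (snd (S!i))) \<omega> - B (fst (S!i)) \<omega>)) \<in> borel_measurable M" if i: "i < length S" for i
  proof -
    obtain u v \<xi> where e: "S!i = (u, v, \<xi>)" by (cases "S!i")
    then have "(u, v, \<xi>) \<in> set S" using nth_mem[OF i] by simp
    then have "\<xi> \<in> borel_measurable (F u)" "0 \<le> u" "u \<le> v" using assms unfolding simple_integrand_def by auto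
    then have "\<xi> \<in> borel_measurable M" "(\<lambda>\<omega>. B v \<omega> - B u \<omega>) \<in> borel_measurable M"
      using measurable_F_M increment_measurable[of u v] by auto
    then show ?thesis using e by simp
  qed
  then show ?thesis unfolding simple_ito_integral_eq[abs_def] by (intro borel_measurable_sum) auto
qed

text \<open>
  The approximating simple integrands in the definition of the Ito integral are arbitrary and may be
  random. By the isometry, applied to the concatenation of such an integrand with a negated step
  function, the integrals of the step functions of \<open>\<sigma>\<close> converge to \<open>I\<close> in \<open>L\<^sup>2\<close> as well. They also
  converge along every continuous path, and Fatou's lemma identifies the two limits.
\<close>

lemma ito_integral_by_parts:
  assumes ab: "0 \<le> a" "a \<le> b" and \<sigma>': "continuous_on {a..b} \<sigma>'"
    and der: "\<And>t. t \<in> {a..b} \<Longrightarrow> (\<sigma> has_real_derivative \<sigma>' t) (at t within {a..b})"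
    and I: "has_ito_integral M F B (\<lambda>s \<omega>. \<sigma> s) a b I"
  shows "AE \<omega> in M. I \<omega> = \<sigma> b * B b \<omega> - \<sigma> a * B a \<omega> - integral {a..b} (\<lambda>s. \<sigma>' s * B s \<omega>)"
proof -
  from I obtain S :: "nat \<Rightarrow> 'a simple_process" where
    \<sigma>M: "(\<lambda>(s, \<omega>). \<sigma> s) \<in> borel_measurable (lborel \<Otimes>\<^sub>M M)" and
    IM [measurable]: "I \<in> borel_measurable M" and S: "\<And>n. simple_integrand F a b (S n)" and
    S1: "(\<lambda>n. \<integral>\<^sup>+ (s, \<omega>). ennreal ((simple_value (S n) s \<omega> - \<sigma> s)\<^sup>2) * indicator {a..b} s
               \<partial>(lborel \<Otimes>\<^sub>M M)) \<longlonglongrightarrow> 0" and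
    S2: "(\<lambda>n. \<integral>\<^sup>+ \<omega>. ennreal ((simple_ito_integral B (S n) \<omega> - I \<omega>)\<^sup>2) \<partial>M) \<longlonglongrightarrow> 0"
    unfolding has_ito_integral_def by auto
  obtain L where L: "L > 0" "\<And>t. t \<in> {a..b} \<Longrightarrow> \<bar>\<sigma>' t\<bar> \<le> L"
    using compact_imp_bounded[OF compact_continuous_image[OF \<sigma>' compact_Icc]]
    unfolding bounded_pos by auto
  have lip: "\<bar>\<sigma> s - \<sigma> t\<bar> \<le> L * \<bar>s - t\<bar>" if "s \<in> {a..b}" "t \<in> {a..b}" for s t
    using field_differentiable_bound[of "{a..b}" \<sigma> \<sigma>' L s t] der L that by simp
  define D :: "nat \<Rightarrow> 'a simple_process" where "D m = step_process \<sigma> a b m" for m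
  have sq: "(x + y)\<^sup>2 \<le> 2 * x\<^sup>2 + 2 * y\<^sup>2" for x y :: real
    using sum_squares_bound[of x y] by (simp add: power2_sum)
  \<comment> \<open>the factor \<open>4\<close> comes from using \<open>sq\<close> twice, for integrands and for integrals\<close>
  have dist: "(\<integral>\<^sup>+ \<omega>. ennreal ((simple_ito_integral B (D m) \<omega> - I \<omega>)\<^sup>2) \<partial>M)
     \<le> ennreal (4 * (L * ((b - a) / m))\<^sup>2 * (b - a))" if m: "m > 0" for m
  proof -
    define D' :: "'a simple_process" where "D' = step_process (\<lambda>s. - \<sigma> s) a b m"
    define c where "c = 2 * (L * ((b - a) / m))\<^sup>2"
    have c: "c \<ge> 0" by (simp add: c_def)
    have D': "simple_ito_integral B D' \<omega> = - simple_ito_integral B (D m) \<omega>"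
      "simple_value D' s \<omega> = - simple_value (D m) s \<omega>" for s \<omega>
      by (simp_all add: D_def D'_def simple_ito_integral_step_process simple_value_step_process sum_negf)
    have iD: "simple_integrand F a b (D m)" "simple_integrand F a b D'"
      unfolding D_def D'_def by (intro simple_integrand_step_process ab)+
    have ap: "simple_integrand F a b (S n @ D')" for n
      using S iD by (simp add: simple_integrand_append)
    define \<delta> where "\<delta> n = (\<integral>\<^sup>+ (s, \<omega>). ennreal ((simple_value (S n) s \<omega> - \<sigma> s)\<^sup>2) * indicator {a..b} s
               \<partial>(lborel \<Otimes>\<^sub>M M))" for n
    define \<eta> where "\<eta> n = (\<integral>\<^sup>+ \<omega>. ennreal ((simple_ito_integral B (S n) \<omega> - I \<omega>)\<^sup>2) \<partial>M)" for n
    have pw: "ennreal ((simple_value (S n @ D') s \<omega>)\<^sup>2)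
       \<le> 2 * (ennreal ((simple_value (S n) s \<omega> - \<sigma> s)\<^sup>2) * indicator {a..b} s) + ennreal c * indicator {a..b} s" for n s \<omega>
    proof (cases "s \<in> {a<..b}")
      case False
      then show ?thesis using simple_value_outside[OF ap] by simp
    next
      case True
      have "\<bar>\<sigma> s - simple_value (D m) s \<omega>\<bar> \<le> L * ((b - a) / m)"
        using step_process_approximates[where \<sigma>=\<sigma>, OF ab(2) m lip _ True] L(1) unfolding D_def by (simp add: abs_minus_commute)
      then have "(\<sigma> s - simple_value (D m) s \<omega>)\<^sup>2 \<le> (L * ((b - a) / m))\<^sup>2"
        using abs_le_square_iff[of "\<sigma> s - simple_value (D m) s \<omega>" "L * ((b - a) / m)"] L(1) ab by simp
      then have "(simple_value (S n @ D') s \<omega>)\<^sup>2 \<le> 2 * (simple_value (S n) s \<omega> - \<sigma> s)\<^sup>2 + c"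
        using sq[of "simple_value (S n) s \<omega> - \<sigma> s" "\<sigma> s - simple_value (D m) s \<omega>"]
        by (simp add: simple_value_append D' c_def)
      then have "ennreal ((simple_value (S n @ D') s \<omega>)\<^sup>2) \<le> ennreal (2 * (simple_value (S n) s \<omega> - \<sigma> s)\<^sup>2 + c)"
        by (rule ennreal_leI)
      then show ?thesis using True c by (simp add: ennreal_plus ennreal_mult')
    qed
    have "(\<integral>\<^sup>+ \<omega>. ennreal ((simple_ito_integral B (S n @ D') \<omega>)\<^sup>2) \<partial>M) \<le> 2 * \<delta> n + ennreal c * ennreal (b - a)" for n
    proof -
      have m1: "(\<lambda>(s, \<omega>). ennreal ((simple_value (S n) s \<omega> - \<sigma> s)\<^sup>2) * indicator {a..b} s) \<in> borel_measurable (lborel \<Otimes>\<^sub>M M)"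
        using simple_value_measurable[OF S[of n]] \<sigma>M unfolding case_prod_beta by measurable
      have "(\<integral>\<^sup>+ \<omega>. ennreal ((simple_ito_integral B (S n @ D') \<omega>)\<^sup>2) \<partial>M)
         = (\<integral>\<^sup>+ (s, \<omega>). ennreal ((simple_value (S n @ D') s \<omega>)\<^sup>2) \<partial>(lborel \<Otimes>\<^sub>M M))"
        by (rule simple_ito_isometry[OF ap ab(1)])
      also have "\<dots> \<le> (\<integral>\<^sup>+ p. 2 * (\<lambda>(s, \<omega>). ennreal ((simple_value (S n) s \<omega> - \<sigma> s)\<^sup>2) * indicator {a..b} s) p
           + ennreal c * indicator {a..b} (fst p) \<partial>(lborel \<Otimes>\<^sub>M M))"
        using pw by (intro nn_integral_mono) (auto simp: case_prod_beta)
      also have "\<dots> = 2 * \<delta> n + ennreal c * (\<integral>\<^sup>+ p. indicator {a..b} (fst p) \<partial>(lborel \<Otimes>\<^sub>M M))"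
        unfolding \<delta>_def using m1 by (subst nn_integral_add) (auto simp: nn_integral_cmult)
      also have "(\<integral>\<^sup>+ p. indicator {a..b} (fst p) \<partial>(lborel \<Otimes>\<^sub>M M)) = ennreal (b - a)"
        by (subst nn_integral_fst[symmetric]) (auto simp: emeasure_space_1 ab)
      finally show ?thesis .
    qed
    note iso = this
    have "(\<integral>\<^sup>+ \<omega>. ennreal ((simple_ito_integral B (D m) \<omega> - I \<omega>)\<^sup>2) \<partial>M) \<le> 2 * \<eta> n + 2 * (2 * \<delta> n + ennreal c * ennreal (b - a))" for n
    proof -
      note [measurable] = simple_ito_integral_measurable[OF S[of n] ab(1)] simple_ito_integral_measurable[OF ap[of n] ab(1)]
      have "(\<integral>\<^sup>+ \<omega>. ennreal ((simple_ito_integral B (D m) \<omega> - I \<omega>)\<^sup>2) \<partial>M)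
        \<le> (\<integral>\<^sup>+ \<omega>. 2 * ennreal ((simple_ito_integral B (S n) \<omega> - I \<omega>)\<^sup>2) + 2 * ennreal ((simple_ito_integral B (S n @ D') \<omega>)\<^sup>2) \<partial>M)"
      proof (rule nn_integral_mono)
        fix \<omega>
        have "simple_ito_integral B (D m) \<omega> - I \<omega>
          = (simple_ito_integral B (S n) \<omega> - I \<omega>) + - simple_ito_integral B (S n @ D') \<omega>"
          by (simp add: simple_ito_integral_append D')
        then have "(simple_ito_integral B (D m) \<omega> - I \<omega>)\<^sup>2
          \<le> 2 * (simple_ito_integral B (S n) \<omega> - I \<omega>)\<^sup>2 + 2 * (simple_ito_integral B (S n @ D') \<omega>)\<^sup>2"
          using sq[of "simple_ito_integral B (S n) \<omega> - I \<omega>" "- simple_ito_integral B (S n @ D') \<omega>"]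
          by (simp only: power2_minus)
        then have "ennreal ((simple_ito_integral B (D m) \<omega> - I \<omega>)\<^sup>2)
          \<le> ennreal (2 * (simple_ito_integral B (S n) \<omega> - I \<omega>)\<^sup>2 + 2 * (simple_ito_integral B (S n @ D') \<omega>)\<^sup>2)"
          by (rule ennreal_leI)
        then show "ennreal ((simple_ito_integral B (D m) \<omega> - I \<omega>)\<^sup>2)
          \<le> 2 * ennreal ((simple_ito_integral B (S n) \<omega> - I \<omega>)\<^sup>2) + 2 * ennreal ((simple_ito_integral B (S n @ D') \<omega>)\<^sup>2)"
          by (simp add: ennreal_plus ennreal_mult')
      qed
      also have "\<dots> = 2 * \<eta> n + 2 * (\<integral>\<^sup>+ \<omega>. ennreal ((simple_ito_integral B (S n @ D') \<omega>)\<^sup>2) \<partial>M)"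
        unfolding \<eta>_def by (subst nn_integral_add) (auto simp: nn_integral_cmult)
      also have "\<dots> \<le> 2 * \<eta> n + 2 * (2 * \<delta> n + ennreal c * ennreal (b - a))"
        by (intro add_mono mult_left_mono iso) auto
      finally show ?thesis .
    qed
    moreover have "(\<lambda>n. 2 * \<eta> n + 2 * (2 * \<delta> n + ennreal c * ennreal (b - a))) \<longlonglongrightarrow> 2 * 0 + 2 * (2 * 0 + ennreal c * ennreal (b - a))"
      using S1 S2 unfolding \<eta>_def[symmetric] \<delta>_def[symmetric]
      by (intro tendsto_intros ennreal_tendsto_cmult tendsto_add) auto
    ultimately have "(\<integral>\<^sup>+ \<omega>. ennreal ((simple_ito_integral B (D m) \<omega> - I \<omega>)\<^sup>2) \<partial>M) \<le> 2 * 0 + 2 * (2 * 0 + ennreal c * ennreal (b - a))"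
      by (intro LIMSEQ_le_const) auto
    also have "\<dots> = ennreal (4 * (L * ((b - a) / m))\<^sup>2 * (b - a))"
      using ab by (simp add: c_def ennreal_mult'[symmetric] ennreal_mult''[symmetric] flip: ennreal_numeral)
    finally show ?thesis .
  qed
  have lim0: "(\<lambda>m. \<integral>\<^sup>+ \<omega>. ennreal ((simple_ito_integral B (D m) \<omega> - I \<omega>)\<^sup>2) \<partial>M) \<longlonglongrightarrow> 0"
  proof (rule tendsto_sandwich[OF _ _ tendsto_const])
    have "(\<lambda>m. 4 * (L * ((b - a) / real m))\<^sup>2 * (b - a)) \<longlonglongrightarrow> 4 * (L * 0)\<^sup>2 * (b - a)"
      by (intro tendsto_intros lim_const_over_n)
    then show "(\<lambda>m. ennreal (4 * (L * ((b - a) / real m))\<^sup>2 * (b - a))) \<longlonglongrightarrow> 0"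
      using tendsto_ennrealI by fastforce
    show "\<forall>\<^sub>F m in sequentially. (\<integral>\<^sup>+ \<omega>. ennreal ((simple_ito_integral B (D m) \<omega> - I \<omega>)\<^sup>2) \<partial>M)
       \<le> ennreal (4 * (L * ((b - a) / real m))\<^sup>2 * (b - a))"
      using eventually_gt_at_top[of "0::nat"] by eventually_elim (rule dist)
  qed simp
  have DM [measurable]: "simple_ito_integral B (D m) \<in> borel_measurable M" for m
    using simple_ito_integral_measurable[OF simple_integrand_step_process ab(1)] ab(2) unfolding D_def by blast
  have "(\<integral>\<^sup>+ \<omega>. liminf (\<lambda>m. ennreal ((simple_ito_integral B (D m) \<omega> - I \<omega>)\<^sup>2)) \<partial>M)
     \<le> liminf (\<lambda>m. \<integral>\<^sup>+ \<omega>. ennreal ((simple_ito_integral B (D m) \<omega> - I \<omega>)\<^sup>2) \<partial>M)"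
    by (rule nn_integral_liminf) measurable
  also have "\<dots> = 0" using lim_imp_Liminf[OF _ lim0] by simp
  finally have "AE \<omega> in M. liminf (\<lambda>m. ennreal ((simple_ito_integral B (D m) \<omega> - I \<omega>)\<^sup>2)) = 0"
    by (subst (asm) le_zero_eq, subst (asm) nn_integral_0_iff_AE) auto
  with continuous_paths show ?thesis
  proof eventually_elim
    case (elim \<omega>)
    let ?J = "\<sigma> b * B b \<omega> - \<sigma> a * B a \<omega> - integral {a..b} (\<lambda>s. \<sigma>' s * B s \<omega>)"
    have cont: "continuous_on {a..b} (\<lambda>t. B t \<omega>)" using elim(1) by (rule continuous_on_subset) (use ab in auto)
    from stieltjes_sum_by_parts[OF ab(2) cont \<sigma>' der]
    have "(\<lambda>m. simple_ito_integral B (D m) \<omega>) \<longlonglongrightarrow> ?J"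
      unfolding D_def simple_ito_integral_step_process .
    then have "(\<lambda>m. ennreal ((simple_ito_integral B (D m) \<omega> - I \<omega>)\<^sup>2)) \<longlonglongrightarrow> ennreal ((?J - I \<omega>)\<^sup>2)"
      by (intro tendsto_ennrealI tendsto_intros)
    from lim_imp_Liminf[OF _ this] have "ennreal ((?J - I \<omega>)\<^sup>2) = 0" using elim(2) by simp
    then show ?case by (simp add: ennreal_eq_0_iff)
  qed
qed

end

section \<open>Modification and growth of Brownian paths\<close>

context brownian_motion
begin

text \<open>
  Fubini arguments need a process that is measurable in time and chance together, which follows from
  continuity of every path. Changing \<open>B\<close> on a null set gives this but may destroy adaptedness, so the
  modification is used only for integration over time, and independence is
  always taken from \<open>B\<close> itself.
\<close>

lemma continuous_modification:
  obtains C :: "real \<Rightarrow> 'a \<Rightarrow> real" where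
    "\<And>\<omega>. continuous_on UNIV (\<lambda>r. C r \<omega>)"
    "(\<lambda>(r, \<omega>). C r \<omega>) \<in> borel_measurable (lborel \<Otimes>\<^sub>M M)"
    "AE \<omega> in M. \<forall>r\<ge>0. C r \<omega> = B r \<omega>"
proof -
  obtain N where N: "{\<omega> \<in> space M. \<not> continuous_on {0..} (\<lambda>t. B t \<omega>)} \<subseteq> N" "emeasure M N = 0" "N \<in> sets M"
    using AE_E[OF continuous_paths] by auto
  define C where "C r \<omega> = (if \<omega> \<in> space M - N then B (max 0 r) \<omega> else 0)" for r \<omega>
  have cont: "continuous_on UNIV (\<lambda>r. C r \<omega>)" for \<omega>
  proof (cases "\<omega> \<in> space M - N")
    case True
    then have "continuous_on {0..} (\<lambda>t. B t \<omega>)" using N by auto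
    then have "continuous_on UNIV (\<lambda>r. B (max 0 r) \<omega>)"
      by (rule continuous_on_compose2) (auto intro!: continuous_intros)
    then show ?thesis using True by (simp add: C_def)
  qed (simp add: C_def del: DiffE Diff_iff)
  have CM: "C r \<in> borel_measurable M" for r
    unfolding C_def using N(3) by (intro measurable_If_set) auto
  have "(\<lambda>p. C (fst p) (snd p)) \<in> borel_measurable (lborel \<Otimes>\<^sub>M M)"
  proof (rule borel_measurable_LIMSEQ_real)
    fix n :: nat
    have "(\<lambda>p. (\<lambda>(i::int) p. C (of_int i / Suc n) (snd p)) \<lfloor>real (Suc n) * fst p\<rfloor> p) \<in> borel_measurable (lborel \<Otimes>\<^sub>M M)"
      by (rule measurable_compose_countable) (use CM in measurable)
    then show "(\<lambda>p. C (of_int \<lfloor>real (Suc n) * fst p\<rfloor> / real (Suc n)) (snd p)) \<in> borel_measurable (lborel \<Otimes>\<^sub>M M)"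
      by simp
  next
    fix p :: "real \<times> 'a"
    have "(\<lambda>n. of_int \<lfloor>real (Suc n) * fst p\<rfloor> / real (Suc n)) \<longlonglongrightarrow> fst p"
    proof (rule tendsto_sandwich[OF _ _ _ tendsto_const])
      show "(\<lambda>n. fst p - 1 / real (Suc n)) \<longlonglongrightarrow> fst p"
        using tendsto_diff[OF tendsto_const LIMSEQ_Suc[OF lim_const_over_n], of "fst p" 1] by simp
      show "\<forall>\<^sub>F n in sequentially. fst p - 1 / real (Suc n) \<le> of_int \<lfloor>real (Suc n) * fst p\<rfloor> / real (Suc n)"
      proof (rule always_eventually, rule allI)
        fix n :: nat
        have "real (Suc n) * fst p - 1 \<le> of_int \<lfloor>real (Suc n) * fst p\<rfloor>" by linarith
        then have "(real (Suc n) * fst p - 1) / real (Suc n) \<le> of_int \<lfloor>real (Suc n) * fst p\<rfloor> / real (Suc n)"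
          by (rule divide_right_mono) simp
        then show "fst p - 1 / real (Suc n) \<le> of_int \<lfloor>real (Suc n) * fst p\<rfloor> / real (Suc n)"
          by (simp add: diff_divide_distrib del: of_nat_Suc)
      qed
      show "\<forall>\<^sub>F n in sequentially. of_int \<lfloor>real (Suc n) * fst p\<rfloor> / real (Suc n) \<le> fst p"
      proof (rule always_eventually, rule allI)
        fix n :: nat
        have "of_int \<lfloor>real (Suc n) * fst p\<rfloor> \<le> real (Suc n) * fst p" by linarith
        then have "of_int \<lfloor>real (Suc n) * fst p\<rfloor> / real (Suc n) \<le> real (Suc n) * fst p / real (Suc n)"
          by (rule divide_right_mono) simp
        then show "of_int \<lfloor>real (Suc n) * fst p\<rfloor> / real (Suc n) \<le> fst p"
          by (simp del: of_nat_Suc)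
      qed
    qed
    moreover have "isCont (\<lambda>r. C r (snd p)) (fst p)"
      using cont[of "snd p"] by (simp add: continuous_on_eq_continuous_at)
    ultimately show "(\<lambda>n. C (of_int \<lfloor>real (Suc n) * fst p\<rfloor> / real (Suc n)) (snd p)) \<longlonglongrightarrow> C (fst p) (snd p)"
      using isCont_tendsto_compose by blast
  qed
  moreover have "AE \<omega> in M. \<forall>r\<ge>0. C r \<omega> = B r \<omega>"
  proof (rule AE_I'[of N])
    show "{\<omega> \<in> space M. \<not> (\<forall>r\<ge>0. C r \<omega> = B r \<omega>)} \<subseteq> N" by (auto simp: C_def max_def split: if_splits)
  qed (use N in \<open>auto simp: null_sets_def\<close>)
  ultimately show ?thesis by (intro that[OF cont]) (auto simp: case_prod_beta)
qed

text \<open>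
  Kolmogorov's maximal inequality. The walk \<open>B - B a\<close> along the grid, stopped when it first leaves
  \<open>[- c, c]\<close>, is itself the Ito integral of a simple integrand with values in \<open>{0, 1}\<close>, so the isometry
  bounds its second moment by \<open>b - a\<close>; on the event in question its absolute value exceeds \<open>c\<close>.
\<close>

lemma kolmogorov_maximal_grid:
  assumes ab: "0 \<le> a" "a \<le> b" and c: "0 < c" and m: "0 < m"
  shows "measure M {\<omega> \<in> space M. \<exists>i\<le>m. c < \<bar>B (grid a b m i) \<omega> - B a \<omega>\<bar>} \<le> (b - a) / c\<^sup>2"
proof -
  let ?g = "grid a b m"
  let ?E = "{\<omega> \<in> space M. \<exists>i\<le>m. c < \<bar>B (?g i) \<omega> - B a \<omega>\<bar>}"
  define \<xi> where "\<xi> i \<omega> = (if \<forall>j\<in>{..i}. \<bar>B (?g j) \<omega> - B a \<omega>\<bar> \<le> c then 1 else 0 :: real)" for i \<omega>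
  define S where "S = map (\<lambda>i. (?g i, ?g (Suc i), \<xi> i)) [0..<m]"
  have pos: "a \<le> ?g i" for i using grid_mono[OF ab(2), of 0 i m] by simp
  have \<xi>: "\<xi> i \<in> borel_measurable (F (?g i))" for i
  proof -
    have [measurable]: "(\<lambda>\<omega>. B (?g j) \<omega> - B a \<omega>) \<in> borel_measurable (F (?g i))" if "j \<le> i" for j
      using pos[of j] pos[of i] ab grid_mono[OF ab(2) that] by (intro increment_measurable_F) auto
    have "Measurable.pred (F (?g i)) (\<lambda>\<omega>. \<forall>j\<in>{..i}. \<bar>B (?g j) \<omega> - B a \<omega>\<bar> \<le> c)"
      by (intro pred_intros_finite) auto
    then show ?thesis unfolding \<xi>_def by measurable
  qed
  have S: "simple_integrand F a b S"
    unfolding simple_integrand_def S_def using \<xi> grid_bounds[OF ab(2)] m grid_mono[OF ab(2)]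
    by (auto simp: \<xi>_def intro!: exI[of _ 1])
  have val: "simple_value S s \<omega> = (\<Sum>i<m. \<xi> i \<omega> * indicator {?g i<..?g (Suc i)} s)" for s \<omega>
    by (simp add: simple_value_def S_def comp_def interv_sum_list_conv_sum_set_nat atLeast0LessThan)
  have ito: "simple_ito_integral B S \<omega> = (\<Sum>i<m. \<xi> i \<omega> * (B (?g (Suc i)) \<omega> - B (?g i) \<omega>))" for \<omega>
    by (simp add: simple_ito_integral_def S_def comp_def interv_sum_list_conv_sum_set_nat atLeast0LessThan)
  have val_le: "(simple_value S s \<omega>)\<^sup>2 \<le> indicator {a..b} s" for s \<omega>
  proof -
    have "simple_value S s \<omega> \<le> (\<Sum>i<m. indicator {?g i<..?g (Suc i)} s)"
      unfolding val by (intro sum_mono) (auto simp: \<xi>_def)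
    also have "\<dots> = indicator {a<..b} s" using sum_indicator_grid[OF ab(2), where j=m and m=m and s=s] m by simp
    finally have "simple_value S s \<omega> \<le> indicator {a<..b} s" .
    moreover have "0 \<le> simple_value S s \<omega>" unfolding val by (intro sum_nonneg) (auto simp: \<xi>_def)
    ultimately have "(simple_value S s \<omega>)\<^sup>2 \<le> (indicator {a<..b} s)\<^sup>2" by (rule power_mono)
    also have "\<dots> \<le> indicator {a..b} s" by (auto simp: indicator_def)
    finally show ?thesis .
  qed
  have exceed: "c\<^sup>2 \<le> (simple_ito_integral B S \<omega>)\<^sup>2" if "\<omega> \<in> ?E" for \<omega>
  proof -
    define J where "J = (LEAST i. c < \<bar>B (?g i) \<omega> - B a \<omega>\<bar>)"
    obtain i where i: "i \<le> m" "c < \<bar>B (?g i) \<omega> - B a \<omega>\<bar>" using \<open>\<omega> \<in> ?E\<close> by auto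
    have J: "c < \<bar>B (?g J) \<omega> - B a \<omega>\<bar>" "J \<le> m"
      unfolding J_def using LeastI[of "\<lambda>i. c < \<bar>B (?g i) \<omega> - B a \<omega>\<bar>", OF i(2)]
        Least_le[of "\<lambda>i. c < \<bar>B (?g i) \<omega> - B a \<omega>\<bar>", OF i(2)] i(1) by auto
    have lt: "\<bar>B (?g j) \<omega> - B a \<omega>\<bar> \<le> c" if "j < J" for j
      using not_less_Least[of j "\<lambda>i. c < \<bar>B (?g i) \<omega> - B a \<omega>\<bar>"] that unfolding J_def by auto
    have \<xi>J: "\<xi> j \<omega> = (if j < J then 1 else 0)" for j
    proof (cases "j < J")
      case True
      then show ?thesis using lt by (auto simp: \<xi>_def)
    next
      case False
      then show ?thesis using J(1) by (auto simp: \<xi>_def intro!: bexI[of _ J])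
    qed
    have "simple_ito_integral B S \<omega> = (\<Sum>j<m. if j < J then B (?g (Suc j)) \<omega> - B (?g j) \<omega> else 0)"
      unfolding ito \<xi>J by (intro sum.cong) auto
    also have "\<dots> = (\<Sum>j<J. B (?g (Suc j)) \<omega> - B (?g j) \<omega>)"
      using J(2) by (intro sum.mono_neutral_cong_right) auto
    also have "\<dots> = B (?g J) \<omega> - B a \<omega>" using sum_lessThan_telescope[of "\<lambda>j. B (?g j) \<omega>" J] by simp
    finally show ?thesis using J(1) c by (metis abs_le_square_iff abs_of_pos less_imp_le)
  qed
  have [measurable]: "(\<lambda>\<omega>. B (?g i) \<omega> - B a \<omega>) \<in> borel_measurable M" for i
    using pos[of i] ab by (intro increment_measurable) auto
  have EM: "?E \<in> sets M" by measurable
  have "ennreal (c\<^sup>2) * emeasure M ?E = (\<integral>\<^sup>+ \<omega>. ennreal (c\<^sup>2) * indicator ?E \<omega> \<partial>M)"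
    using EM by (simp add: nn_integral_cmult_indicator)
  also have "\<dots> \<le> (\<integral>\<^sup>+ \<omega>. ennreal ((simple_ito_integral B S \<omega>)\<^sup>2) \<partial>M)"
    using exceed by (intro nn_integral_mono) (auto simp: indicator_def intro!: ennreal_leI)
  also have "\<dots> = (\<integral>\<^sup>+ (s, \<omega>). ennreal ((simple_value S s \<omega>)\<^sup>2) \<partial>(lborel \<Otimes>\<^sub>M M))"
    by (rule simple_ito_isometry[OF S ab(1)])
  also have "\<dots> \<le> (\<integral>\<^sup>+ p. indicator {a..b} (fst p) \<partial>(lborel \<Otimes>\<^sub>M M))"
    using val_le by (intro nn_integral_mono) (auto simp: case_prod_beta ennreal_indicator[symmetric] intro!: ennreal_leI simp del: ennreal_indicator)
  also have "\<dots> = ennreal (b - a)"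
    by (subst nn_integral_fst[symmetric]) (auto simp: emeasure_space_1 ab)
  finally have "ennreal (c\<^sup>2 * measure M ?E) \<le> ennreal (b - a)"
    by (simp add: emeasure_eq_measure ennreal_mult)
  then have "c\<^sup>2 * measure M ?E \<le> b - a" using ab by (simp add: ennreal_le_iff)
  then show ?thesis using c by (simp add: field_simps)
qed

text \<open>
  Since \<open>\<theta> > 1/2\<close>, the maximal inequality bounds the probability that the path exceeds
  \<open>2\<^sup>n\<^sup>\<theta>\<close> before time \<open>2\<^sup>n\<close> by a summable sequence, and Borel and Cantelli apply.
\<close>

lemma brownian_path_growth:
  assumes \<theta>: "1/2 < \<theta>"
  shows "AE \<omega> in M. \<exists>K. \<forall>t\<ge>1. \<bar>B t \<omega>\<bar> \<le> K * t powr \<theta>"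
proof -
  define c where "c n = (2 ^ n) powr \<theta>" for n :: nat
  have c: "c n > 0" for n by (simp add: c_def)
  define E where "E n m = {\<omega> \<in> space M. \<exists>i\<le>m. c n < \<bar>B (grid 0 (2 ^ n) m i) \<omega> - B 0 \<omega>\<bar>}" for n m :: nat
  \<comment> \<open>by continuity, a path that exceeds \<open>c n\<close> somewhere does so on all sufficiently fine grids\<close>
  define A where "A n = (\<Union>N. \<Inter>m\<in>{Suc N..}. E n m)" for n
  have [measurable]: "(\<lambda>\<omega>. B (grid 0 (2 ^ n) m i) \<omega> - B 0 \<omega>) \<in> borel_measurable M" for i n m
    using grid_mono[of 0 "2^n" 0 i m] by (intro increment_measurable) auto
  have EM [measurable]: "E n m \<in> sets M" for n m unfolding E_def by measurable
  have AM: "A n \<in> sets M" for n unfolding A_def by (intro sets.countable_UN image_subsetI sets.countable_INT') auto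
  have "measure M (A n) \<le> 2 ^ n / (c n)\<^sup>2" for n
  proof -
    have inc: "incseq (\<lambda>N. \<Inter>m\<in>{Suc N..}. E n m)"
      by (intro monoI INF_superset_mono) auto
    have sets: "range (\<lambda>N. \<Inter>m\<in>{Suc N..}. E n m) \<subseteq> sets M" by (intro image_subsetI sets.countable_INT') auto
    have "(\<lambda>N. measure M (\<Inter>m\<in>{Suc N..}. E n m)) \<longlonglongrightarrow> measure M (A n)"
      unfolding A_def by (rule finite_Lim_measure_incseq[OF sets inc])
    moreover have "measure M (\<Inter>m\<in>{Suc N..}. E n m) \<le> 2 ^ n / (c n)\<^sup>2" for N
    proof -
      have "measure M (\<Inter>m\<in>{Suc N..}. E n m) \<le> measure M (E n (Suc N))"
        by (intro finite_measure_mono) auto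
      also have "\<dots> \<le> 2 ^ n / (c n)\<^sup>2"
        using kolmogorov_maximal_grid[of 0 "2^n" "c n" "Suc N"] c unfolding E_def by simp
      finally show ?thesis .
    qed
    ultimately show ?thesis by (intro LIMSEQ_le_const2) auto
  qed
  also have "2 ^ n / (c n)\<^sup>2 = (2 powr (1 - 2 * \<theta>)) ^ n" for n
    by (simp add: c_def powr_powr powr_add[symmetric] powr_realpow[symmetric] powr_diff[symmetric] power2_eq_square algebra_simps)
  finally have Ale: "measure M (A n) \<le> (2 powr (1 - 2 * \<theta>)) ^ n" for n .
  have "summable (\<lambda>n. (2 powr (1 - 2 * \<theta>)) ^ n)"
    using \<theta> by (intro summable_geometric) (simp add: powr_less_one)
  then have "summable (\<lambda>n. measure M (A n))"
    by (rule summable_comparison_test'[where N=0]) (use Ale in simp)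
  then have "AE \<omega> in M. eventually (\<lambda>n. \<omega> \<in> space M - A n) sequentially"
    using AM by (intro borel_cantelli_AE1) (auto simp: emeasure_eq_measure)
  with continuous_paths start_zero show ?thesis
  proof eventually_elim
    case (elim \<omega>)
    obtain N where N: "\<And>n. n \<ge> N \<Longrightarrow> \<omega> \<in> space M - A n" using elim(3) by (auto simp: eventually_sequentially)
    have bound: "\<bar>B t \<omega>\<bar> \<le> c n" if n: "n \<ge> N" and t: "0 \<le> t" "t \<le> 2 ^ n" for n t
    proof (rule ccontr)
      assume "\<not> ?thesis"
      then have exc: "c n < \<bar>B t \<omega>\<bar>" by simp
      define i where "i m = nat \<lfloor>t * m / 2 ^ n\<rfloor>" for m :: nat
      have i: "i m \<le> m" if "m > 0" for m
      proof -
        have "t * m / 2 ^ n \<le> m" using t that by (simp add: field_simps)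
        then have "\<lfloor>t * m / 2 ^ n\<rfloor> \<le> int m" by linarith
        then show ?thesis by (simp add: i_def)
      qed
      have ri: "real (i m) = of_int \<lfloor>t * m / 2 ^ n\<rfloor>" for m using t by (simp add: i_def)
      have lim: "(\<lambda>m. grid 0 (2 ^ n) m (i m)) \<longlonglongrightarrow> t"
      proof (rule tendsto_sandwich[OF _ _ _ tendsto_const])
        have "(\<lambda>m. t - 2 ^ n / real m) \<longlonglongrightarrow> t - 0" by (intro tendsto_intros lim_const_over_n)
        then show "(\<lambda>m. t - 2 ^ n / real m) \<longlonglongrightarrow> t" by simp
        show "\<forall>\<^sub>F m in sequentially. t - 2 ^ n / real m \<le> grid 0 (2 ^ n) m (i m)"
          using eventually_gt_at_top[of "0::nat"]
        proof eventually_elim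
          case (elim m)
          have "t * m / 2 ^ n - 1 \<le> real (i m)" unfolding ri by linarith
          then have "(t * m / 2 ^ n - 1) * (2 ^ n / m) \<le> real (i m) * (2 ^ n / m)" by (rule mult_right_mono) simp
          then show ?case using elim by (simp add: grid_def left_diff_distrib diff_divide_distrib)
        qed
        show "\<forall>\<^sub>F m in sequentially. grid 0 (2 ^ n) m (i m) \<le> t"
          using eventually_gt_at_top[of "0::nat"]
        proof eventually_elim
          case (elim m)
          have "real (i m) \<le> t * m / 2 ^ n" unfolding ri by linarith
          then have "real (i m) * (2 ^ n / m) \<le> (t * m / 2 ^ n) * (2 ^ n / m)" by (rule mult_right_mono) simp
          then show ?case using elim by (simp add: grid_def)
        qed
      qed
      have "continuous_on {0..} (\<lambda>t. \<bar>B t \<omega>\<bar>)" using elim(1) by (intro continuous_intros)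
      from continuous_on_tendsto_compose[OF this lim]
      have "(\<lambda>m. \<bar>B (grid 0 (2 ^ n) m (i m)) \<omega>\<bar>) \<longlonglongrightarrow> \<bar>B t \<omega>\<bar>"
        using t by (auto simp: grid_def)
      then have "\<forall>\<^sub>F m in sequentially. c n < \<bar>B (grid 0 (2 ^ n) m (i m)) \<omega>\<bar>"
        using exc by (rule order_tendstoD)
      then obtain N' where N': "\<And>m. m \<ge> N' \<Longrightarrow> c n < \<bar>B (grid 0 (2 ^ n) m (i m)) \<omega>\<bar>"
        by (auto simp: eventually_sequentially)
      have "\<omega> \<in> E n m" if "m \<in> {Suc N'..}" for m
        using that N'[of m] i[of m] N[OF n] elim(2) by (auto simp: E_def)
      then have "\<omega> \<in> A n" unfolding A_def by blast
      then show False using N[OF n] by simp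
    qed
    have "\<bar>B t \<omega>\<bar> \<le> c (Suc N) * t powr \<theta>" if t: "t \<ge> 1" for t
    proof (cases "t \<le> 2 ^ N")
      case True
      have "\<bar>B t \<omega>\<bar> \<le> c N" using bound[of N t] t True by simp
      also have "\<dots> \<le> c (Suc N) * 1" using \<theta> by (simp add: c_def powr_mono2)
      also have "\<dots> \<le> c (Suc N) * t powr \<theta>" using t \<theta> c[of "Suc N"] by (intro mult_left_mono) (auto simp: ge_one_powr_ge_zero)
      finally show ?thesis .
    next
      case False
      define k where "k = (LEAST k. t \<le> 2 ^ k)"
      obtain k0 :: nat where "t < 2 ^ k0" using real_arch_pow[of 2 t] by auto
      then have k: "t \<le> 2 ^ k" unfolding k_def by (intro LeastI[of "\<lambda>k. t \<le> 2 ^ k" k0]) simp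
      have kN: "k > N"
      proof (rule ccontr)
        assume "\<not> k > N"
        then show False using power_increasing[of k N "2::real"] k False by linarith
      qed
      then obtain j where j: "k = Suc j" by (cases k) auto
      have "\<not> t \<le> 2 ^ j" using not_less_Least[of j "\<lambda>k. t \<le> 2 ^ k"] j unfolding k_def by simp
      then have "2 ^ k \<le> 2 * t" using j by simp
      have "\<bar>B t \<omega>\<bar> \<le> c k" using bound[of k t] kN k t by simp
      also have "\<dots> \<le> (2 * t) powr \<theta>" unfolding c_def using \<open>2 ^ k \<le> 2 * t\<close> \<theta> by (intro powr_mono2) auto
      also have "\<dots> = 2 powr \<theta> * t powr \<theta>" using t by (simp add: powr_mult)
      also have "\<dots> \<le> c (Suc N) * t powr \<theta>"
        unfolding c_def using \<theta> by (intro mult_right_mono powr_mono2) (auto simp: self_le_power)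
      finally show ?thesis .
    qed
    then show ?case by blast
  qed
qed

end

section \<open>The perturbed differential equation\<close>

lemma continuous_on_indefinite_integral_atLeast:
  fixes f :: "real \<Rightarrow> real"
  assumes f: "continuous_on {a..} f"
  shows "continuous_on {a..} (\<lambda>t. integral {a..t} f)"
  unfolding continuous_on_eq_continuous_within
proof
  fix t :: real assume t: "t \<in> {a..}"
  have "continuous_on {a..t + 1} (\<lambda>t. integral {a..t} f)"
    by (rule indefinite_integral_continuous_1)
      (intro integrable_continuous_interval continuous_on_subset[OF f], auto)
  then have "continuous (at t within {a..t + 1}) (\<lambda>t. integral {a..t} f)"
    using t by (auto simp: continuous_on_eq_continuous_within)
  moreover have "at t within {a..t + 1} = at t within {a..}"
    by (rule at_within_nhd[of t "{..<t + 1}"]) auto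
  ultimately show "continuous (at t within {a..}) (\<lambda>t. integral {a..t} f)" by simp
qed

text \<open>
  \<open>x + N\<close> is nondecreasing and \<open>N\<close> vanishes at infinity, so \<open>x\<close> has a limit; a finite limit must
  be \<open>0\<close> for the drift to have a finite integral. In that case let \<open>D t = - (x t + N t)\<close>, the drift still to
  come after \<open>t\<close>. If \<open>D\<close> at \<open>2\<^sup>n\<^sup>+\<^sup>1\<close> is at least twice the bound on the noise, then the drift over
  \<open>[2\<^sup>n, 2\<^sup>n\<^sup>+\<^sup>1]\<close> yields \<open>2\<^sup>n (D (2\<^sup>n\<^sup>+\<^sup>1) / 2)\<^sup>k \<le> D (2\<^sup>n)\<close>. Because \<open>(k - 1) b < 1\<close>, this
  recursion propagates the bound \<open>D (2\<^sup>n) \<le> C (2\<^sup>n)\<^sup>-\<^sup>b\<close> from \<open>n\<close> to \<open>n + 1\<close>.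
\<close>

lemma ode_dichotomy:
  fixes x N :: "real \<Rightarrow> real"
  assumes k: "1 < k" and b: "0 < b" "(k - 1) * b < 1"
    and contx: "continuous_on {1..} x"
    and eq: "\<And>t. 1 \<le> t \<Longrightarrow> x t = x 1 + integral {1..t} (\<lambda>s. \<bar>x s\<bar> powr k) + (N 1 - N t)"
    and N: "\<And>t. 1 \<le> t \<Longrightarrow> \<bar>N t\<bar> \<le> K * t powr (- b)"
  shows "filterlim x at_top at_top \<or> ((x \<longlongrightarrow> 0) at_top \<and>
    (\<exists>C. \<forall>n. integral {2 ^ n..2 ^ Suc n} (\<lambda>s. max 0 (N s) powr k) \<le> C * (2 ^ n) powr (- b)))"
proof -
  define g where "g s = \<bar>x s\<bar> powr k" for s
  have contg: "continuous_on {1..} g"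
    unfolding g_def using k by (intro continuous_on_powr' continuous_intros contx) auto
  have g_int: "g integrable_on {s..t}" if "1 \<le> s" for s t
    using that by (intro integrable_continuous_interval continuous_on_subset[OF contg]) auto
  have g0: "0 \<le> g s" for s by (simp add: g_def)
  define R where "R t = x t + N t" for t
  have R_diff: "R t = R s + integral {s..t} g" if "1 \<le> s" "s \<le> t" for s t
  proof -
    have "integral {1..t} g = integral {1..s} g + integral {s..t} g"
      using that by (intro Henstock_Kurzweil_Integration.integral_combine[symmetric] g_int) auto
    then show ?thesis using eq[of t] eq[of s] that unfolding R_def g_def by simp
  qed
  have R_mono: "R s \<le> R t" if "1 \<le> s" "s \<le> t" for s t
    using R_diff[OF that] integral_nonneg[OF g_int[OF that(1)], of t] g0 by simp
  have K: "0 \<le> K" using N[OF order_refl] abs_ge_zero[of "N 1"] unfolding powr_one_eq_one by linarith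
  have NK: "\<bar>N t\<bar> \<le> K" if "1 \<le> t" for t
  proof -
    have "K * t powr (- b) \<le> K * 1" using that b K by (intro mult_left_mono) (auto simp: powr_minus ge_one_powr_ge_zero inverse_le_1_iff)
    then show ?thesis using N[OF that] by simp
  qed
  have N0: "(N \<longlongrightarrow> 0) at_top"
  proof (rule Lim_null_comparison)
    show "\<forall>\<^sub>F t in at_top. norm (N t) \<le> K * t powr (- b)"
      using eventually_ge_at_top[of 1] by eventually_elim (use N in simp)
    have "((\<lambda>t. K * t powr (- b)) \<longlongrightarrow> K * 0) at_top"
      using b by (intro tendsto_intros tendsto_neg_powr filterlim_ident) auto
    then show "((\<lambda>t. K * t powr (- b)) \<longlongrightarrow> 0) at_top" by simp
  qed
  show ?thesis
  proof (cases "\<forall>M. \<exists>t\<ge>1. M \<le> R t")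
    case True
    have "filterlim x at_top at_top"
      unfolding filterlim_at_top
    proof
      fix Z
      obtain t0 where t0: "t0 \<ge> 1" "Z + K \<le> R t0" using True by blast
      have "Z \<le> x t" if "t \<ge> t0" for t
        using R_mono[OF t0(1) that] NK[of t] t0 that unfolding R_def by linarith
      then show "\<forall>\<^sub>F t in at_top. Z \<le> x t" by (auto simp: eventually_at_top_linorder)
    qed
    then show ?thesis ..
  next
    case False
    then obtain M where M: "\<And>t. t \<ge> 1 \<Longrightarrow> R t < M" by (meson not_le)
    define l where "l = (SUP t\<in>{1..}. R t)"
    have bdd: "bdd_above (R ` {1..})" using M by (intro bdd_aboveI[of _ M]) (auto intro: less_imp_le)
    have Rl: "R t \<le> l" if "t \<ge> 1" for t unfolding l_def using that bdd by (intro cSUP_upper) auto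
    have R_lim: "(R \<longlongrightarrow> l) at_top"
    proof (rule order_tendstoI)
      fix a assume "a < l"
      then obtain t0 where t0: "t0 \<ge> 1" "a < R t0" unfolding l_def using less_cSUP_iff[OF _ bdd, of a] by auto
      have "a < R t" if "t \<ge> t0" for t using R_mono[OF t0(1) that] t0 by linarith
      then show "\<forall>\<^sub>F t in at_top. a < R t" by (auto simp: eventually_at_top_linorder)
    next
      fix a assume "l < a"
      then have "R t < a" if "t \<ge> 1" for t using Rl[OF that] by linarith
      then show "\<forall>\<^sub>F t in at_top. R t < a" by (auto simp: eventually_at_top_linorder)
    qed
    have x_lim: "(x \<longlongrightarrow> l) at_top"
      using tendsto_diff[OF R_lim N0] unfolding R_def by simp
    have "l = 0"
    proof (rule ccontr)
      assume l: "l \<noteq> 0"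
      define q where "q = (\<bar>l\<bar> / 2) powr k"
      have q: "q > 0" using l by (simp add: q_def)
      have "\<forall>\<^sub>F t in at_top. \<bar>l\<bar> / 2 < \<bar>x t\<bar>"
        using order_tendstoD(1)[OF tendsto_rabs[OF x_lim], of "\<bar>l\<bar> / 2"] l by simp
      then obtain t1 where t1: "\<And>t. t \<ge> t1 \<Longrightarrow> \<bar>l\<bar> / 2 < \<bar>x t\<bar>" by (auto simp: eventually_at_top_linorder)
      define t0 where "t0 = max 1 t1"
      define t where "t = t0 + (M - R t0) / q"
      have t: "t0 \<le> t" "1 \<le> t0" "1 \<le> t" using M[of t0] q by (auto simp: t_def t0_def intro: add_increasing2)
      have "q * (t - t0) = integral {t0..t} (\<lambda>_. q)" using t by simp
      also have "\<dots> \<le> integral {t0..t} g"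
      proof (rule integral_le)
        fix s assume "s \<in> {t0..t}"
        then show "q \<le> g s" unfolding q_def g_def using t1[of s] k
          by (intro powr_mono2) (auto simp: t0_def)
      qed (use g_int t in auto)
      finally have "q * (t - t0) \<le> R t - R t0" using R_diff[of t0 t] t by simp
      moreover have "q * (t - t0) = M - R t0" using q by (simp add: t_def)
      ultimately show False using M[of t] t by simp
    qed
    define D where "D t = - R t" for t
    have D0: "0 \<le> D t" if "t \<ge> 1" for t using Rl[OF that] \<open>l = 0\<close> by (simp add: D_def)
    have xD: "x t = - (D t + N t)" for t by (simp add: D_def R_def)
    define y where "y n = (2 ^ n) powr (- b)" for n :: nat
    have y: "y n > 0" for n by (simp add: y_def)
    have ySuc: "y (Suc n) = y n * 2 powr (- b)" for n by (simp add: y_def powr_mult)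
    have one: "(1::real) \<le> 2 ^ n" for n by simp
    have D_step: "D (2 ^ n) = D (2 ^ Suc n) + integral {2 ^ n..2 ^ Suc n} g" for n
      using R_diff[of "2 ^ n" "2 ^ Suc n"] unfolding D_def by simp
    \<comment> \<open>the three terms start the induction, absorb the noise, and close the recursion\<close>
    define C where "C = max (D 1) (max (2 * K * 2 powr b) (2 powr ((b + 1) * k / (k - 1))))"
    have C: "D 1 \<le> C" "2 * K * 2 powr b \<le> C" "2 powr ((b + 1) * k / (k - 1)) \<le> C" unfolding C_def by auto
    have Cpos: "C > 0" using C(3) by (smt (verit) powr_gt_zero)
    have DC: "D (2 ^ n) \<le> C * y n" for n
    proof (induction n)
      case 0 then show ?case using C by (simp add: y_def)
    next
      case (Suc n)
      let ?u = "D (2 ^ Suc n)"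
      show ?case
      proof (rule ccontr)
        assume "\<not> ?thesis"
        then have big: "C * (y n * 2 powr (- b)) < ?u" by (simp add: ySuc)
        have "(2 * K * 2 powr b) * (y n * 2 powr (- b)) \<le> C * (y n * 2 powr (- b))"
          using C(2) y[of n] by (intro mult_right_mono) auto
        also have "(2 * K * 2 powr b) * (y n * 2 powr (- b)) = 2 * (K * y n)" by (simp add: powr_minus field_simps)
        finally have uK: "K * y n \<le> ?u / 2" using big by simp
        have u0: "?u \<ge> 0" using D0[of "2 ^ Suc n"] one[of "Suc n"] by blast
        have "2 ^ n * (?u / 2) powr k = integral {2 ^ n..2 ^ Suc n :: real} (\<lambda>_. (?u / 2) powr k)" by simp
        also have "\<dots> \<le> integral {2 ^ n..2 ^ Suc n} g"
        proof (rule integral_le)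
          fix s :: real assume s: "s \<in> {2 ^ n..2 ^ Suc n}"
          have s1: "1 \<le> s" using s one[of n] unfolding atLeastAtMost_iff by linarith
          have "D s \<ge> ?u" using R_mono[of s "2 ^ Suc n"] s s1 by (simp add: D_def)
          moreover have "\<bar>N s\<bar> \<le> K * y n"
          proof -
            have "s powr (- b) \<le> y n" unfolding y_def using s b by (intro powr_mono2') auto
            then show ?thesis using N[OF s1] mult_left_mono[OF _ K] by (meson order_trans)
          qed
          ultimately have "?u / 2 \<le> \<bar>x s\<bar>" using uK unfolding xD[of s] by linarith
          then show "(?u / 2) powr k \<le> g s" unfolding g_def using u0 k by (intro powr_mono2) auto
        qed (use g_int one in auto)
        also have "\<dots> \<le> D (2 ^ n)" using D_step[of n] u0 by linarith
        also have "\<dots> \<le> C * y n" by (rule Suc.IH)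
        finally have 1: "2 ^ n * (?u / 2) powr k \<le> C * y n" .
        define c where "c = 2 powr (- b - 1)"
        have c: "c > 0" by (simp add: c_def)
        have "C * y n * c < ?u / 2" using big by (simp add: c_def powr_diff)
        then have "(C * y n * c) powr k < (?u / 2) powr k" using Cpos y[of n] c k
          by (intro powr_less_mono2) auto
        then have "2 ^ n * (C * y n * c) powr k < 2 ^ n * (?u / 2) powr k" by simp
        then have "2 ^ n * (C * y n * c) powr k < C * y n" using 1 by linarith
        also have "(C * y n * c) powr k = (C * y n) * ((C * y n) powr (k - 1) * c powr k)"
          using Cpos y[of n] c by (simp add: powr_mult powr_diff)
        finally have "(C * y n) * (2 ^ n * ((C * y n) powr (k - 1) * c powr k)) < (C * y n) * 1" by (simp add: ac_simps)
        then have lt: "2 ^ n * ((C * y n) powr (k - 1) * c powr k) < 1" using Cpos y[of n] by (simp add: mult_less_cancel_left_pos)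
        have "2 powr ((b + 1) * k) = (2 powr ((b + 1) * k / (k - 1))) powr (k - 1)" using k by (simp add: powr_powr)
        also have "\<dots> \<le> C powr (k - 1)" using C(3) k by (intro powr_mono2) auto
        finally have "2 powr ((b + 1) * k) * c powr k \<le> C powr (k - 1) * c powr k" by (intro mult_right_mono) auto
        moreover have "2 powr ((b + 1) * k) * c powr k = 1"
          by (simp add: c_def powr_powr powr_add[symmetric] algebra_simps)
        ultimately have c1: "1 \<le> C powr (k - 1) * c powr k" by simp
        have "2 ^ n * y n powr (k - 1) = (2 ^ n) powr 1 * (2 ^ n) powr (- b * (k - 1))"
          by (simp add: y_def powr_powr)
        also have "\<dots> = (2 ^ n) powr (1 - (k - 1) * b)" unfolding powr_add[symmetric] by (simp add: algebra_simps)
        also have "\<dots> \<ge> 1" using b one[of n] by (intro ge_one_powr_ge_zero) auto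
        finally have c2: "1 \<le> 2 ^ n * y n powr (k - 1)" .
        have "1 * 1 \<le> (2 ^ n * y n powr (k - 1)) * (C powr (k - 1) * c powr k)"
          using c1 c2 by (intro mult_mono) auto
        also have "\<dots> = 2 ^ n * ((C * y n) powr (k - 1) * c powr k)" using Cpos y[of n] by (simp add: powr_mult ac_simps)
        finally show False using lt by simp
      qed
    qed
    have contN: "continuous_on {1..} N"
    proof (rule continuous_on_eq)
      show "continuous_on {1..} (\<lambda>t. R 1 + integral {1..t} g - x t)"
      proof -
        have "continuous_on {1..} (\<lambda>t. integral {1..t} g)"
          by (rule continuous_on_indefinite_integral_atLeast[OF contg])
        then show ?thesis by (intro continuous_intros contx)
      qed
      show "R 1 + integral {1..t} g - x t = N t" if "t \<in> {1..}" for t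
        using R_diff[of 1 t] that by (simp add: R_def)
    qed
    have "integral {2 ^ n..2 ^ Suc n} (\<lambda>s. max 0 (N s) powr k) \<le> C * (2 ^ n) powr (- b)" for n
    proof -
      have "integral {2 ^ n..2 ^ Suc n} (\<lambda>s. max 0 (N s) powr k) \<le> integral {2 ^ n..2 ^ Suc n} g"
      proof (rule integral_le)
        show "(\<lambda>s. max 0 (N s) powr k) integrable_on {2 ^ n..2 ^ Suc n}"
          using k one[of n] by (intro integrable_continuous_interval continuous_on_powr' continuous_intros continuous_on_subset[OF contN])
            (auto intro: order_trans)
        fix s :: real assume s: "s \<in> {2 ^ n..2 ^ Suc n}"
        then have "1 \<le> s" using one[of n] unfolding atLeastAtMost_iff by linarith
        then have "max 0 (N s) \<le> \<bar>x s\<bar>" using D0[of s] unfolding xD[of s] by auto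
        then show "max 0 (N s) powr k \<le> g s" unfolding g_def using k by (intro powr_mono2) auto
      qed (use g_int one in auto)
      also have "\<dots> \<le> D (2 ^ n)" using D_step[of n] D0[of "2 ^ Suc n"] one[of "Suc n"] by linarith
      also have "\<dots> \<le> C * (2 ^ n) powr (- b)" using DC[of n] by (simp add: y_def)
      finally show ?thesis .
    qed
    then show ?thesis using x_lim \<open>l = 0\<close> by blast
  qed
qed

text \<open>
  For every \<open>z > 0\<close> and \<open>w \<ge> 0\<close>, \<open>w \<le> z + z\<^sup>1\<^sup>-\<^sup>k w\<^sup>k\<close>. The choice \<open>z = (2\<^sup>n)\<close> to the power
  \<open>- (1 + b) / k\<close> balances the two terms, and \<open>k \<beta> < 1 + b\<close> says that \<open>z\<close> beats the weight \<open>s\<^sup>\<beta>\<close>.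
\<close>

lemma weighted_average_tendsto_0:
  fixes N :: "real \<Rightarrow> real"
  assumes k: "1 < k" and \<beta>: "0 < \<beta>" "k * \<beta> < 1 + b" and cont: "continuous_on {1..} N"
    and bound: "\<And>n. integral {2 ^ n..2 ^ Suc n} (\<lambda>s. max 0 (N s) powr k) \<le> C * (2 ^ n) powr (- b)"
  shows "(\<lambda>n. integral {2 ^ n..2 ^ Suc n} (\<lambda>s. max 0 (s powr \<beta> * N s)) / 2 ^ n) \<longlonglongrightarrow> 0"
proof -
  define e where "e = \<beta> - (1 + b) / k"
  have e: "e < 0" using k \<beta> by (simp add: e_def field_simps)
  have le: "norm (integral {2 ^ n..2 ^ Suc n} (\<lambda>s. max 0 (s powr \<beta> * N s)) / 2 ^ n) \<le> 2 powr \<beta> * (1 + C) * (2 powr e) ^ n" for n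
  proof -
    define z where "z = (2 ^ n) powr (- (1 + b) / k)"
    have z: "z > 0" by (simp add: z_def)
    have one: "(1::real) \<le> 2 ^ n" by simp
    have sub: "{2 ^ n..2 ^ Suc n} \<subseteq> {1::real..}" using one by (auto intro: order_trans)
    have i1: "(\<lambda>s. max 0 (s powr \<beta> * N s)) integrable_on {2 ^ n..2 ^ Suc n}"
      using \<beta> sub not_le[of "2 ^ n" "0::real"]
      by (intro integrable_continuous_interval continuous_intros continuous_on_subset[OF cont]) auto
    have i2: "(\<lambda>s. max 0 (N s) powr k) integrable_on {2 ^ n..2 ^ Suc n}"
      using k sub by (intro integrable_continuous_interval continuous_on_powr' continuous_intros continuous_on_subset[OF cont]) auto
    have "integral {2 ^ n..2 ^ Suc n} (\<lambda>s. max 0 (s powr \<beta> * N s))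
      \<le> integral {2 ^ n..2 ^ Suc n} (\<lambda>s. (2 ^ Suc n) powr \<beta> * (z + z powr (1 - k) * max 0 (N s) powr k))"
    proof (rule integral_le[OF i1])
      show "(\<lambda>s. (2 ^ Suc n) powr \<beta> * (z + z powr (1 - k) * max 0 (N s) powr k)) integrable_on {2 ^ n..2 ^ Suc n}"
        by (intro integrable_on_mult_right integrable_add integrable_const_ivl i2)
      fix s :: real assume s: "s \<in> {2 ^ n..2 ^ Suc n}"
      have pos: "0 < s" using s by (intro less_le_trans[of 0 "2 ^ n" s]) auto
      define w where "w = max 0 (N s)"
      have w: "w \<ge> 0" by (simp add: w_def)
      have "w \<le> z + z powr (1 - k) * w powr k"
      proof (cases "w \<le> z")
        case False
        then have wz: "w > z" "w > 0" using z by auto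
        have "w = w powr (1 - k) * w powr k" using wz by (simp add: powr_add[symmetric])
        also have "\<dots> \<le> z powr (1 - k) * w powr k"
          using wz z k by (intro mult_right_mono powr_mono2') auto
        finally show ?thesis using z by linarith
      next
        case True
        moreover have "0 \<le> z powr (1 - k) * w powr k" by simp
        ultimately show ?thesis by linarith
      qed
      moreover have "max 0 (s powr \<beta> * N s) = s powr \<beta> * w"
        using pos by (auto simp: w_def max_def mult_le_0_iff zero_le_mult_iff)
      moreover have "s powr \<beta> * w \<le> (2 ^ Suc n) powr \<beta> * w"
        using s pos \<beta> w by (intro mult_right_mono powr_mono2) auto
      moreover have "(2 ^ Suc n) powr \<beta> * w \<le> (2 ^ Suc n) powr \<beta> * (z + z powr (1 - k) * w powr k)"
        using calculation(1) by (intro mult_left_mono) auto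
      ultimately show "max 0 (s powr \<beta> * N s) \<le> (2 ^ Suc n) powr \<beta> * (z + z powr (1 - k) * max 0 (N s) powr k)"
        unfolding w_def by linarith
    qed
    also have "\<dots> = (2 ^ Suc n) powr \<beta> * (2 ^ n * z + z powr (1 - k) * integral {2 ^ n..2 ^ Suc n} (\<lambda>s. max 0 (N s) powr k))"
    proof -
      have "((\<lambda>s. z + z powr (1 - k) * max 0 (N s) powr k) has_integral
        (2 ^ n * z + z powr (1 - k) * integral {2 ^ n..2 ^ Suc n} (\<lambda>s. max 0 (N s) powr k))) {2 ^ n..2 ^ Suc n}"
        using has_integral_add[OF has_integral_const_real[of z "2 ^ n" "2 ^ Suc n"] has_integral_mult_right[OF integrable_integral[OF i2]]]
        by simp
      then show ?thesis by (simp only: integral_mult_right integral_unique)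
    qed
    also have "\<dots> \<le> (2 ^ Suc n) powr \<beta> * (2 ^ n * z + z powr (1 - k) * (C * (2 ^ n) powr (- b)))"
      using bound[of n] by (intro mult_left_mono add_left_mono) auto
    also have "z powr (1 - k) * (C * (2 ^ n) powr (- b)) = C * (2 ^ n * z)"
    proof -
      have "z powr (1 - k) * (2 ^ n) powr (- b) = (2 ^ n) powr (- (1 + b) / k * (1 - k) + (- b))"
        unfolding z_def powr_powr powr_add ..
      also have "- (1 + b) / k * (1 - k) + (- b) = 1 + (- (1 + b) / k)" using k by (simp add: field_simps)
      also have "(2 ^ n) powr (1 + (- (1 + b) / k)) = 2 ^ n * z" by (simp add: z_def powr_add)
      finally show ?thesis by (simp add: mult_ac)
    qed
    also have "(2 ^ Suc n) powr \<beta> * (2 ^ n * z + C * (2 ^ n * z)) = 2 powr \<beta> * (1 + C) * ((2 ^ n) powr \<beta> * z) * 2 ^ n"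
      by (simp add: powr_mult algebra_simps)
    also have "(2 ^ n) powr \<beta> * z = (2 powr e) ^ n"
    proof -
      have "(2 ^ n) powr \<beta> * z = (2 ^ n) powr e"
      proof -
        have "\<beta> + - (1 + b) / k = \<beta> - (1 + b) / k" using k by (simp add: field_simps)
        then show ?thesis unfolding z_def e_def powr_add[symmetric] by (rule arg_cong)
      qed
      also have "\<dots> = (2 powr e) ^ n" by (simp add: powr_realpow[symmetric] powr_powr mult.commute)
      finally show ?thesis .
    qed
    finally have "integral {2 ^ n..2 ^ Suc n} (\<lambda>s. max 0 (s powr \<beta> * N s)) \<le> 2 powr \<beta> * (1 + C) * (2 powr e) ^ n * 2 ^ n" .
    moreover have "0 \<le> integral {2 ^ n..2 ^ Suc n} (\<lambda>s. max 0 (s powr \<beta> * N s))" by (rule integral_nonneg[OF i1]) auto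
    ultimately show ?thesis by (simp add: divide_le_eq)
  qed
  have lim: "(\<lambda>n. 2 powr \<beta> * (1 + C) * (2 powr e) ^ n) \<longlonglongrightarrow> 2 powr \<beta> * (1 + C) * 0"
    using e by (intro tendsto_intros LIMSEQ_power_zero) (simp add: powr_less_one)
  show ?thesis
    by (rule Lim_null_comparison[OF always_eventually[OF allI[OF le]]]) (use lim in simp)
qed

section \<open>The noise still to come after a given time\<close>

lemma powr_tail_nn_integral:
  fixes a q :: real
  assumes a: "0 < a" and q: "0 < q"
  shows "(\<integral>\<^sup>+x. ennreal (x powr (- q - 1)) * indicator {a..} x \<partial>lborel) = ennreal (a powr (- q) / q)"
proof -
  have "(\<integral>\<^sup>+x. ennreal (x powr (- q - 1)) * indicator {a..} x \<partial>lborel) = ennreal (0 - (- (a powr (- q)) / q))"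
  proof (rule nn_integral_FTC_atLeast[where F="\<lambda>x. - (x powr (- q)) / q"])
    show "((\<lambda>x. - (x powr - q) / q) has_real_derivative x powr (- q - 1)) (at x)" if "a \<le> x" for x
      using that a q by (auto intro!: derivative_eq_intros simp: field_simps)
    have "((\<lambda>x. - (x powr - q) / q) \<longlongrightarrow> - 0 / q) at_top"
      using q by (intro tendsto_intros tendsto_neg_powr filterlim_ident) auto
    then show "((\<lambda>x. - (x powr - q) / q) \<longlongrightarrow> 0) at_top" by simp
  qed auto
  then show ?thesis by simp
qed

lemma powr_tail_integral:
  fixes a q :: real
  assumes a: "0 < a" and q: "0 < q"
  shows "set_integrable lborel {a..} (\<lambda>x. x powr (- q - 1))"
    and "(LBINT x:{a..}. x powr (- q - 1)) = a powr (- q) / q"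
proof -
  have "has_bochner_integral lborel (\<lambda>x. indicator {a..} x *\<^sub>R x powr (- q - 1)) (a powr (- q) / q)"
  proof (rule has_bochner_integral_nn_integral)
    have "(\<integral>\<^sup>+x. ennreal (indicator {a..} x *\<^sub>R x powr (- q - 1)) \<partial>lborel)
        = (\<integral>\<^sup>+x. ennreal (x powr (- q - 1)) * indicator {a..} x \<partial>lborel)"
      by (intro nn_integral_cong) (auto simp: indicator_def)
    then show "(\<integral>\<^sup>+x. ennreal (indicator {a..} x *\<^sub>R x powr (- q - 1)) \<partial>lborel) = ennreal (a powr (- q) / q)"
      using powr_tail_nn_integral[OF a q] by simp
  qed (use q in auto)
  then show "set_integrable lborel {a..} (\<lambda>x. x powr (- q - 1))"
    and "(LBINT x:{a..}. x powr (- q - 1)) = a powr (- q) / q"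
    unfolding set_integrable_def set_lebesgue_integral_def
    by (auto simp: has_bochner_integral_iff)
qed

text \<open>
  For \<open>c\<close> a Brownian path this is \<open>\<integral> r\<^sup>-\<^sup>\<alpha> dB\<^sub>r\<close> over \<open>[s, \<infinity>)\<close>, integrated by parts.
\<close>

definition tail_noise :: "real \<Rightarrow> (real \<Rightarrow> real) \<Rightarrow> real \<Rightarrow> real" where
  "tail_noise \<alpha> c s = (LBINT r:{s..}. \<alpha> * r powr (- \<alpha> - 1) * (c r - c s))"

context
  fixes c :: "real \<Rightarrow> real" and \<alpha> \<theta> K :: real
  assumes cont: "continuous_on UNIV c" and \<theta>: "0 < \<theta>" "\<theta> < \<alpha>"
    and growth: "\<And>t. 1 \<le> t \<Longrightarrow> \<bar>c t\<bar> \<le> K * t powr \<theta>"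
begin

lemma tail_integrand_integrable:
  assumes s: "1 \<le> s" shows "set_integrable lborel {s..} (\<lambda>r. r powr (- \<alpha> - 1) * c r)"
proof (rule set_integrable_bound)
  show "set_integrable lborel {s..} (\<lambda>r. K * r powr (- (\<alpha> - \<theta>) - 1))"
    using powr_tail_integral(1)[of s "\<alpha> - \<theta>"] s \<theta> by simp
  show "set_borel_measurable lborel {s..} (\<lambda>r. r powr (- \<alpha> - 1) * c r)"
    unfolding set_borel_measurable_def using borel_measurable_continuous_onI[OF cont] by measurable
  show "AE r in lborel. r \<in> {s..} \<longrightarrow> norm (r powr (- \<alpha> - 1) * c r) \<le> norm (K * r powr (- (\<alpha> - \<theta>) - 1))"
  proof (intro AE_I2 impI)
    fix r assume "r \<in> {s..}"
    then have r: "1 \<le> r" using s by simp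
    have "\<bar>r powr (- \<alpha> - 1) * c r\<bar> \<le> r powr (- \<alpha> - 1) * (K * r powr \<theta>)"
      using growth[OF r] by (simp add: abs_mult mult_left_mono)
    also have "\<dots> = K * r powr (- (\<alpha> - \<theta>) - 1)" using r by (simp add: powr_add[symmetric] algebra_simps)
    finally show "norm (r powr (- \<alpha> - 1) * c r) \<le> norm (K * r powr (- (\<alpha> - \<theta>) - 1))" by simp
  qed
qed

lemma tail_noise_eq:
  assumes s: "1 \<le> s"
  shows "tail_noise \<alpha> c s = \<alpha> * (LBINT r:{s..}. r powr (- \<alpha> - 1) * c r) - s powr (- \<alpha>) * c s"
proof -
  have \<alpha>: "\<alpha> > 0" using \<theta> by simp
  have i: "set_integrable lborel {s..} (\<lambda>r. \<alpha> * (r powr (- \<alpha> - 1) * c r))"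
    using tail_integrand_integrable[OF s] by simp
  have j: "set_integrable lborel {s..} (\<lambda>r. \<alpha> * c s * r powr (- \<alpha> - 1))"
    using powr_tail_integral(1)[of s \<alpha>] s \<alpha> by simp
  have "tail_noise \<alpha> c s = (LBINT r:{s..}. \<alpha> * (r powr (- \<alpha> - 1) * c r) - \<alpha> * c s * r powr (- \<alpha> - 1))"
    unfolding tail_noise_def by (simp add: algebra_simps)
  also have "\<dots> = \<alpha> * (LBINT r:{s..}. r powr (- \<alpha> - 1) * c r) - \<alpha> * c s * (LBINT r:{s..}. r powr (- \<alpha> - 1))"
    using set_integral_diff(2)[OF i j] by simp
  also have "\<dots> = \<alpha> * (LBINT r:{s..}. r powr (- \<alpha> - 1) * c r) - s powr (- \<alpha>) * c s"
    using powr_tail_integral(2)[of s \<alpha>] s \<alpha> by simp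
  finally show ?thesis .
qed

text \<open>
  The right-hand side is \<open>\<integral> r\<^sup>-\<^sup>\<alpha> dc\<close> over \<open>[1, t]\<close>, integrated by parts. So \<open>tail_noise\<close> turns the Ito
  integrals up to all times \<open>t\<close> into differences of one continuous function of \<open>t\<close>.
\<close>

lemma tail_noise_diff:
  assumes t: "1 \<le> t"
  shows "tail_noise \<alpha> c 1 - tail_noise \<alpha> c t
    = t powr (- \<alpha>) * c t - c 1 + \<alpha> * integral {1..t} (\<lambda>r. r powr (- \<alpha> - 1) * c r)"
proof -
  let ?f = "\<lambda>r. r powr (- \<alpha> - 1) * c r"
  have i: "set_integrable lborel {1..t} ?f"
    by (rule set_integrable_subset[OF tail_integrand_integrable[OF order_refl]]) auto
  have "(LBINT r:{1..t} \<union> {t..}. ?f r) = (LBINT r:{1..t}. ?f r) + (LBINT r:{t..}. ?f r)"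
  proof (rule set_integral_Un_AE)
    show "AE x in lborel. \<not> (x \<in> {1..t} \<and> x \<in> {t..})" using AE_lborel_singleton[of t] by eventually_elim auto
  qed (use i tail_integrand_integrable[OF t] in auto)
  moreover have "{1..t} \<union> {t..} = {1..}" using t by auto
  ultimately have "(LBINT r:{1..}. ?f r) = integral {1..t} ?f + (LBINT r:{t..}. ?f r)"
    using set_borel_integral_eq_integral(2)[OF i] by simp
  then show ?thesis unfolding tail_noise_eq[OF order_refl] tail_noise_eq[OF t] by (simp add: algebra_simps)
qed

lemma tail_noise_bound:
  assumes t: "1 \<le> t"
  shows "\<bar>tail_noise \<alpha> c t\<bar> \<le> (\<alpha> * K / (\<alpha> - \<theta>) + K) * t powr (- (\<alpha> - \<theta>))"
proof -
  have "\<bar>LBINT r:{t..}. r powr (- \<alpha> - 1) * c r\<bar> \<le> (LBINT r:{t..}. K * r powr (- (\<alpha> - \<theta>) - 1))"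
  proof -
    have i: "set_integrable lborel {t..} (\<lambda>r. K * r powr (- (\<alpha> - \<theta>) - 1))"
      using powr_tail_integral(1)[of t "\<alpha> - \<theta>"] t \<theta> by simp
    have "\<bar>LBINT r:{t..}. r powr (- \<alpha> - 1) * c r\<bar> \<le> (LBINT r:{t..}. \<bar>r powr (- \<alpha> - 1) * c r\<bar>)"
      using set_integral_norm_bound[OF tail_integrand_integrable[OF t]] by simp
    also have "\<dots> \<le> (LBINT r:{t..}. K * r powr (- (\<alpha> - \<theta>) - 1))"
    proof (rule set_integral_mono)
      show "set_integrable lborel {t..} (\<lambda>r. \<bar>r powr (- \<alpha> - 1) * c r\<bar>)"
        using set_integrable_norm[OF tail_integrand_integrable[OF t]] by simp
      fix r assume "r \<in> {t..}"
      then have r: "1 \<le> r" using t by simp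
      have "\<bar>r powr (- \<alpha> - 1) * c r\<bar> \<le> r powr (- \<alpha> - 1) * (K * r powr \<theta>)"
        using growth[OF r] by (simp add: abs_mult mult_left_mono)
      also have "\<dots> = K * r powr (- (\<alpha> - \<theta>) - 1)" using r by (simp add: powr_add[symmetric] algebra_simps)
      finally show "\<bar>r powr (- \<alpha> - 1) * c r\<bar> \<le> K * r powr (- (\<alpha> - \<theta>) - 1)" .
    qed (rule i)
    finally show ?thesis .
  qed
  also have "\<dots> = K * (t powr (- (\<alpha> - \<theta>)) / (\<alpha> - \<theta>))"
    using powr_tail_integral(2)[of t "\<alpha> - \<theta>"] t \<theta> by simp
  finally have 1: "\<alpha> * \<bar>LBINT r:{t..}. r powr (- \<alpha> - 1) * c r\<bar> \<le> \<alpha> * (K * (t powr (- (\<alpha> - \<theta>)) / (\<alpha> - \<theta>)))"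
    using \<theta> by (intro mult_left_mono) auto
  have "t powr (- \<alpha>) * \<bar>c t\<bar> \<le> t powr (- \<alpha>) * (K * t powr \<theta>)" using growth[OF t] by (intro mult_left_mono) auto
  also have "\<dots> = K * t powr (- (\<alpha> - \<theta>))" using t by (simp add: powr_add[symmetric] algebra_simps)
  finally have 2: "t powr (- \<alpha>) * \<bar>c t\<bar> \<le> K * t powr (- (\<alpha> - \<theta>))" .
  have "\<bar>tail_noise \<alpha> c t\<bar> \<le> \<alpha> * \<bar>LBINT r:{t..}. r powr (- \<alpha> - 1) * c r\<bar> + t powr (- \<alpha>) * \<bar>c t\<bar>"
    unfolding tail_noise_eq[OF t] using \<theta> by (intro order_trans[OF abs_triangle_ineq4]) (simp add: abs_mult)
  also have "\<dots> \<le> \<alpha> * (K * (t powr (- (\<alpha> - \<theta>)) / (\<alpha> - \<theta>))) + K * t powr (- (\<alpha> - \<theta>))"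
    using 1 2 by (rule add_mono)
  also have "\<dots> = (\<alpha> * K / (\<alpha> - \<theta>) + K) * t powr (- (\<alpha> - \<theta>))" by (simp add: algebra_simps)
  finally show ?thesis .
qed

lemma tail_noise_continuous: "continuous_on {1..} (tail_noise \<alpha> c)"
proof (rule continuous_on_eq)
  let ?f = "\<lambda>r. r powr (- \<alpha> - 1) * c r"
  have f: "continuous_on {1..} ?f" by (intro continuous_intros continuous_on_subset[OF cont]) auto
  have "continuous_on {1..} (\<lambda>t. integral {1..t} ?f)"
    by (rule continuous_on_indefinite_integral_atLeast[OF f])
  then show "continuous_on {1..} (\<lambda>t. tail_noise \<alpha> c 1 - (t powr (- \<alpha>) * c t - c 1 + \<alpha> * integral {1..t} ?f))"
    by (intro continuous_intros continuous_on_subset[OF cont]) auto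
  show "tail_noise \<alpha> c 1 - (t powr (- \<alpha>) * c t - c 1 + \<alpha> * integral {1..t} ?f) = tail_noise \<alpha> c t" if "t \<in> {1..}" for t
    using tail_noise_diff[of t] that by simp
qed

end

section \<open>Independence of the past\<close>

context brownian_motion
begin

lemma increment_positive_part:
  assumes "0 \<le> s" "s < t"
  shows "integrable M (\<lambda>\<omega>. max 0 (B t \<omega> - B s \<omega>))"
    and "(\<integral>\<omega>. max 0 (B t \<omega> - B s \<omega>) \<partial>M) = sqrt ((t - s) / (2 * pi))"
proof -
  have eq: "(\<lambda>\<omega>. max 0 (B t \<omega> - B s \<omega>)) = (\<lambda>\<omega>. (\<bar>B t \<omega> - B s \<omega>\<bar> + (B t \<omega> - B s \<omega>)) / 2)" by (auto simp: fun_eq_iff max_def)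
  note i = increment_integrable(2)[OF assms] increment_integrable(1)[OF assms, of 1]
  show "integrable M (\<lambda>\<omega>. max 0 (B t \<omega> - B s \<omega>))" unfolding eq using i by simp
  have "(\<integral>\<omega>. max 0 (B t \<omega> - B s \<omega>) \<partial>M) = sqrt (2 * (t - s) / pi) / 2"
    unfolding eq using i increment_mean[OF assms] increment_abs_moment[OF assms] by simp
  also have "\<dots> = sqrt (2 * (t - s) / pi / 4)" by (subst real_sqrt_divide[of _ 4]) simp
  finally show "(\<integral>\<omega>. max 0 (B t \<omega> - B s \<omega>) \<partial>M) = sqrt ((t - s) / (2 * pi))" by (simp add: field_simps)
qed

text \<open>
  Testing the tail noise against the event that the increment from \<open>s\<close> to \<open>2 s\<close> is positive avoids
  any computation of its distribution. For \<open>r < 2 s\<close> write \<open>U\<close> and \<open>V\<close> for the increments over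
  \<open>[s, r]\<close> and \<open>[r, 2 s]\<close>. Replacing the event \<open>U + V > 0\<close> by \<open>V > 0\<close> can only lower the
  expectation of \<open>U\<close> on it, and on the latter event that expectation is \<open>0\<close> by independence.
\<close>

lemma positive_increment_correlation:
  assumes s: "0 < s" "s \<le> r" and G: "G \<in> sets (F s)"
  defines "f \<equiv> \<lambda>\<omega>. indicator G \<omega> * indicator {\<omega>. B s \<omega> < B (2 * s) \<omega>} \<omega> :: real"
  shows "integrable M (\<lambda>\<omega>. f \<omega> * (B r \<omega> - B s \<omega>))"
    and "0 \<le> (\<integral>\<omega>. f \<omega> * (B r \<omega> - B s \<omega>) \<partial>M)"
    and "2 * s \<le> r \<Longrightarrow> (\<integral>\<omega>. f \<omega> * (B r \<omega> - B s \<omega>) \<partial>M) = measure M G * sqrt (s / (2 * pi))"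
proof -
  have GM: "G \<in> sets M" using G sets_F by blast
  have [measurable]: "indicator G \<in> borel_measurable (F s)" using G by simp
  have iG: "indicator G \<in> borel_measurable (F t)" if "s \<le> t" for t
    using measurable_F_mono[of "indicator G" s t] that G by simp
  have intG: "integrable M (indicator G :: 'a \<Rightarrow> real)" using GM by (simp add: emeasure_eq_measure)
  have fF: "f \<in> borel_measurable (F (2 * s))"
  proof -
    have "B s \<in> borel_measurable (F (2 * s))" "B (2 * s) \<in> borel_measurable (F (2 * s))" "G \<in> sets (F (2 * s))"
      using s measurable_F_mono[OF adapted, of s "2 * s"] adapted[of "2 * s"] G sets_F_mono[of s "2 * s"] by auto
    then show ?thesis unfolding f_def by measurable
  qed
  have fM [measurable]: "f \<in> borel_measurable M" using measurable_F_M[OF fF] .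
  have f1: "\<bar>f \<omega>\<bar> \<le> 1" for \<omega> by (auto simp: f_def indicator_def)
  have int: "integrable M (\<lambda>\<omega>. f \<omega> * (B r \<omega> - B t \<omega>))" if "0 \<le> t" "t \<le> r" for t r
    using bounded_mult_integrable[OF fM f1, of "\<lambda>\<omega>. B r \<omega> - B t \<omega>"] increment_integrable(1)[of t r 1] that by (cases "t = r") auto
  show "integrable M (\<lambda>\<omega>. f \<omega> * (B r \<omega> - B s \<omega>))" using int[of s r] s by simp
  have intf: "integrable M f" using bounded_mult_integrable[OF fM f1, of "\<lambda>_. 1"] by simp
  have late: "(\<integral>\<omega>. f \<omega> * (B r \<omega> - B s \<omega>) \<partial>M) = measure M G * sqrt (s / (2 * pi))" if "2 * s \<le> r"
  proof -
    have "(\<integral>\<omega>. f \<omega> * (B r \<omega> - B s \<omega>) \<partial>M) = (\<integral>\<omega>. f \<omega> * (B (2 * s) \<omega> - B s \<omega>) + f \<omega> * (B r \<omega> - B (2 * s) \<omega>) \<partial>M)"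
      by (intro Bochner_Integration.integral_cong) (auto simp: algebra_simps)
    also have "\<dots> = (\<integral>\<omega>. f \<omega> * (B (2 * s) \<omega> - B s \<omega>) \<partial>M) + (\<integral>\<omega>. f \<omega> * (B r \<omega> - B (2 * s) \<omega>) \<partial>M)"
      using int[of s "2 * s"] int[of "2 * s" r] s that by (intro Bochner_Integration.integral_add) auto
    also have "(\<integral>\<omega>. f \<omega> * (B r \<omega> - B (2 * s) \<omega>) \<partial>M) = 0"
      using increment_martingale(2)[of "2 * s" r f] s that fF intf by simp
    also have "(\<integral>\<omega>. f \<omega> * (B (2 * s) \<omega> - B s \<omega>) \<partial>M) = (\<integral>\<omega>. indicator G \<omega> * max 0 (B (2 * s) \<omega> - B s \<omega>) \<partial>M)"
      by (intro Bochner_Integration.integral_cong) (auto simp: f_def indicator_def max_def)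
    also have "\<dots> = (\<integral>\<omega>. indicator G \<omega> \<partial>M) * (\<integral>\<omega>. max 0 (B (2 * s) \<omega> - B s \<omega>) \<partial>M)"
      using increment_indep_mult(2)[of s "2 * s" "indicator G" "\<lambda>x. max 0 x"] s intG iG[of s] increment_positive_part(1)[of s "2 * s"]
      by simp
    finally show ?thesis using increment_positive_part(2)[of s "2 * s"] s GM by simp
  qed
  then show "(\<integral>\<omega>. f \<omega> * (B r \<omega> - B s \<omega>) \<partial>M) = measure M G * sqrt (s / (2 * pi))" if "2 * s \<le> r" using that .
  show "0 \<le> (\<integral>\<omega>. f \<omega> * (B r \<omega> - B s \<omega>) \<partial>M)"
  proof (cases "2 * s \<le> r")
    case True
    then show ?thesis using late s by simp
  next
    case False
    define U where "U \<omega> = B r \<omega> - B s \<omega>" for \<omega>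
    define V where "V \<omega> = B (2 * s) \<omega> - B r \<omega>" for \<omega>
    define h where "h \<omega> = indicator G \<omega> * U \<omega>" for \<omega>
    have UF: "U \<in> borel_measurable (F r)" unfolding U_def[abs_def] using s by (intro increment_measurable_F) auto
    have UM: "U \<in> borel_measurable M" using measurable_F_M[OF UF] .
    have hF: "h \<in> borel_measurable (F r)" unfolding h_def[abs_def] by (intro borel_measurable_times iG s UF)
    have intU: "integrable M U" unfolding U_def[abs_def] using increment_integrable(1)[of s r 1] s by (cases "s = r") auto
    have intH: "integrable M h" unfolding h_def[abs_def]
      using bounded_mult_integrable[of "indicator G" 1 U] intU GM by auto
    have h0: "(\<integral>\<omega>. h \<omega> \<partial>M) = 0"
      using increment_martingale(2)[of s r "indicator G"] s iG[of s] intG unfolding h_def U_def by simp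
    let ?g = "\<lambda>x::real. indicator {0<..} x :: real"
    have gV: "integrable M (\<lambda>\<omega>. ?g (B (2 * s) \<omega> - B r \<omega>))"
    proof (rule integrable_const_bound[where B=1])
      show "(\<lambda>\<omega>. ?g (B (2 * s) \<omega> - B r \<omega>)) \<in> borel_measurable M"
        using measurable_compose[OF increment_measurable borel_measurable_indicator, of r "2 * s" "{0<..}"] s by simp
    qed (auto simp: indicator_def)
    have "(\<integral>\<omega>. h \<omega> * ?g (V \<omega>) \<partial>M) = (\<integral>\<omega>. h \<omega> \<partial>M) * (\<integral>\<omega>. ?g (V \<omega>) \<partial>M)"
      unfolding V_def using s False hF intH gV by (intro increment_indep_mult(2)) auto
    also have "\<dots> = 0" using h0 by simp
    finally have "0 = (\<integral>\<omega>. h \<omega> * ?g (V \<omega>) \<partial>M)" by simp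
    also have "\<dots> \<le> (\<integral>\<omega>. f \<omega> * U \<omega> \<partial>M)"
    proof (rule integral_mono)
      show "integrable M (\<lambda>\<omega>. h \<omega> * ?g (V \<omega>))"
        unfolding V_def using s False hF intH gV by (intro increment_indep_mult(1)) auto
      show "integrable M (\<lambda>\<omega>. f \<omega> * U \<omega>)" unfolding U_def using int[of s r] s by simp
      fix \<omega>
      show "h \<omega> * ?g (V \<omega>) \<le> f \<omega> * U \<omega>"
        by (auto simp: h_def f_def U_def V_def indicator_def)
    qed
    finally show ?thesis by (simp add: U_def)
  qed
qed

text \<open>
  The sets that can be approximated in this way form a sigma-algebra.
\<close>

lemma sets_approximation:
  assumes "A \<in> sigma_sets (space M) (\<Union>n. sets (F (real n)))" "0 < e"
  shows "\<exists>n. \<exists>G\<in>sets (F (real n)). measure M (A - G) + measure M (G - A) < e"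
  using assms
proof (induction arbitrary: e rule: sigma_sets.induct)
  case (Basic A)
  then obtain n where "A \<in> sets (F (real n))" by blast
  then show ?case using \<open>0 < e\<close> by (intro exI[of _ n] bexI[of _ A]) auto
next
  case Empty
  then show ?case by (intro exI[of _ 0] bexI[of _ "{}"]) auto
next
  case (Compl A)
  then obtain n G where G: "G \<in> sets (F (real n))" "measure M (A - G) + measure M (G - A) < e" by blast
  have "A \<subseteq> space M" using sigma_sets_into_sp[OF _ Compl.hyps] sets.sets_into_space sets_F by blast
  moreover have "G \<subseteq> space M" using G(1) sets_F sets.sets_into_space by blast
  ultimately have "space M - A - (space M - G) = G - A" "space M - G - (space M - A) = A - G" by auto
  moreover have "space M - G \<in> sets (F (real n))" using sets.compl_sets[OF G(1)] by (simp add: space_F)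
  ultimately show ?case using G(2) by (intro exI[of _ n] bexI[of _ "space M - G"]) auto
next
  case (Union A)
  have sub: "sigma_sets (space M) (\<Union>n. sets (F (real n))) \<subseteq> sets M"
    by (rule sets.sigma_sets_subset) (auto intro: sets_F)
  then have AM [measurable]: "A i \<in> sets M" for i using Union.hyps by blast
  let ?A = "\<Union>i. A i"
  have "(\<lambda>m. measure M (\<Union>i<m. A i)) \<longlonglongrightarrow> measure M (\<Union>m. \<Union>i<m. A i)"
  proof (rule finite_Lim_measure_incseq)
    show "incseq (\<lambda>m. \<Union>i<m. A i)" by (intro monoI UN_mono) auto
  qed auto
  moreover have "(\<Union>m. \<Union>i<m. A i) = ?A" by auto
  ultimately have "(\<lambda>m. measure M (\<Union>i<m. A i)) \<longlonglongrightarrow> measure M ?A" by simp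
  then have "\<forall>\<^sub>F m in sequentially. measure M ?A - e / 2 < measure M (\<Union>i<m. A i)"
    using \<open>0 < e\<close> by (intro order_tendstoD) auto
  then obtain N where N: "\<And>m. m \<ge> N \<Longrightarrow> measure M ?A - e / 2 < measure M (\<Union>i<m. A i)"
    by (auto simp: eventually_sequentially)
  define m where "m = Suc N"
  have m: "measure M ?A - e / 2 < measure M (\<Union>i<m. A i)" "m > 0" using N[of m] by (simp_all add: m_def)
  have "\<exists>n. \<exists>G\<in>sets (F (real n)). measure M (A i - G) + measure M (G - A i) < e / (2 * m)" for i
    using Union.IH[of "e / (2 * m)" i] \<open>0 < e\<close> m by simp
  then obtain n G where G: "\<And>i. G i \<in> sets (F (real (n i)))"
     "\<And>i. measure M (A i - G i) + measure M (G i - A i) < e / (2 * m)" by metis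
  define k where "k = Max (n ` {..<m})"
  have Gk: "G i \<in> sets (F (real k))" if "i < m" for i
  proof -
    have "n i \<le> k" unfolding k_def using that by (intro Max_ge) auto
    then show ?thesis using G(1)[of i] sets_F_mono[of "real (n i)" "real k"] by auto
  qed
  have GM [measurable]: "G i \<in> sets M" for i using G(1) sets_F by blast
  let ?G = "\<Union>i<m. G i"
  have GkM: "?G \<in> sets (F (real k))" using Gk by auto
  have "measure M (?A - ?G) \<le> measure M ((?A - (\<Union>i<m. A i)) \<union> (\<Union>i<m. A i - G i))"
    by (rule finite_measure_mono) auto
  also have "\<dots> \<le> measure M (?A - (\<Union>i<m. A i)) + measure M (\<Union>i<m. A i - G i)"
    by (rule measure_Un_le) auto
  also have "measure M (?A - (\<Union>i<m. A i)) < e / 2"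
    using m by (subst finite_measure_Diff) auto
  also have "measure M (\<Union>i<m. A i - G i) \<le> (\<Sum>i<m. measure M (A i - G i))"
    by (rule finite_measure_subadditive_finite) auto
  finally have 1: "measure M (?A - ?G) < e / 2 + (\<Sum>i<m. measure M (A i - G i))" by simp
  have "measure M (?G - ?A) \<le> measure M (\<Union>i<m. G i - A i)"
    by (rule finite_measure_mono) auto
  also have "\<dots> \<le> (\<Sum>i<m. measure M (G i - A i))"
    by (rule finite_measure_subadditive_finite) auto
  finally have 2: "measure M (?G - ?A) \<le> (\<Sum>i<m. measure M (G i - A i))" .
  have "(\<Sum>i<m. measure M (A i - G i)) + (\<Sum>i<m. measure M (G i - A i)) \<le> (\<Sum>i<m. e / (2 * m))"
    unfolding sum.distrib[symmetric] using G(2) by (intro sum_mono less_imp_le)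
  also have "\<dots> = e / 2" using m by simp
  finally have "measure M (?A - ?G) + measure M (?G - ?A) < e" using 1 2 by simp
  then show ?case using GkM by blast
qed

end

section \<open>The tail noise is not small on average\<close>

text \<open>
  The exponent makes the law of the scaled tail noise of a Brownian path independent of \<open>s\<close>.
\<close>

definition scaled_tail :: "real \<Rightarrow> (real \<Rightarrow> real) \<Rightarrow> real \<Rightarrow> real" where
  "scaled_tail \<alpha> c s = s powr (\<alpha> - 1/2) * tail_noise \<alpha> c s"

text \<open>
  The average is truncated at \<open>L\<close> so that dominated convergence applies to it.
\<close>

definition averaged_tail :: "(real \<Rightarrow> 'a \<Rightarrow> real) \<Rightarrow> real \<Rightarrow> real \<Rightarrow> nat \<Rightarrow> 'a \<Rightarrow> real" where
  "averaged_tail C \<alpha> L n \<omega>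
    = (LBINT s:{2 ^ n..2 ^ Suc n}. min L (max 0 (scaled_tail \<alpha> (\<lambda>r. C r \<omega>) s)) / 2 ^ n)"

context brownian_motion
begin

context
  fixes C :: "real \<Rightarrow> 'a \<Rightarrow> real" and \<alpha> :: real
  assumes C_meas: "(\<lambda>(r, \<omega>). C r \<omega>) \<in> borel_measurable (lborel \<Otimes>\<^sub>M M)"
    and C_B: "AE \<omega> in M. \<forall>r\<ge>0. C r \<omega> = B r \<omega>"
    and \<alpha>: "1/2 < \<alpha>"
begin

lemma modification_measurable_compose:
  assumes "f \<in> borel_measurable N" "g \<in> measurable N M"
  shows "(\<lambda>x. C (f x) (g x)) \<in> borel_measurable N"
proof -
  have "(\<lambda>x. (f x, g x)) \<in> measurable N (lborel \<Otimes>\<^sub>M M)" using assms by measurable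
  from measurable_compose[OF this C_meas] show ?thesis by simp
qed

lemma scaled_tail_measurable:
  "(\<lambda>p. scaled_tail \<alpha> (\<lambda>r. C r (snd p)) (fst p)) \<in> borel_measurable (lborel \<Otimes>\<^sub>M M)"
proof -
  have [measurable]: "(\<lambda>q. C (snd q) (snd (fst q))) \<in> borel_measurable ((lborel \<Otimes>\<^sub>M M) \<Otimes>\<^sub>M lborel)"
    "(\<lambda>q. C (fst (fst q)) (snd (fst q))) \<in> borel_measurable ((lborel \<Otimes>\<^sub>M M) \<Otimes>\<^sub>M lborel)"
    by (rule modification_measurable_compose; measurable)+
  have "(\<lambda>p. \<integral>r. (if fst p \<le> r then \<alpha> * r powr (- \<alpha> - 1) * (C r (snd p) - C (fst p) (snd p)) else 0) \<partial>lborel)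
     \<in> borel_measurable (lborel \<Otimes>\<^sub>M M)"
    by (rule lborel.borel_measurable_lebesgue_integral) (unfold case_prod_beta, measurable)
  also have "(\<lambda>p. \<integral>r. (if fst p \<le> r then \<alpha> * r powr (- \<alpha> - 1) * (C r (snd p) - C (fst p) (snd p)) else 0) \<partial>lborel)
    = (\<lambda>p. tail_noise \<alpha> (\<lambda>r. C r (snd p)) (fst p))"
    unfolding tail_noise_def set_lebesgue_integral_def
    by (intro ext Bochner_Integration.integral_cong) (auto simp: indicator_def)
  finally have [measurable]: "(\<lambda>p. tail_noise \<alpha> (\<lambda>r. C r (snd p)) (fst p)) \<in> borel_measurable (lborel \<Otimes>\<^sub>M M)" .
  show ?thesis unfolding scaled_tail_def by measurable
qed

abbreviation "Z s \<omega> \<equiv> scaled_tail \<alpha> (\<lambda>r. C r \<omega>) s"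

lemma scaled_tail_measurable_\<omega> [measurable]: "Z s \<in> borel_measurable M"
proof -
  have "(\<lambda>\<omega>. (s, \<omega>)) \<in> measurable M (lborel \<Otimes>\<^sub>M M)" by measurable
  from measurable_compose[OF this scaled_tail_measurable] show ?thesis by (simp only: fst_conv snd_conv)
qed

lemma increment_modification:
  assumes "0 \<le> s" "s \<le> r"
  shows "AE \<omega> in M. C r \<omega> - C s \<omega> = B r \<omega> - B s \<omega>"
  using C_B by eventually_elim (metis assms order_trans)

lemma modification_measurable [measurable]: "C r \<in> borel_measurable M"
  by (rule modification_measurable_compose) measurable

text \<open>
  By Fubini the expectation is an average over \<open>r\<close> of the correlations of \<open>f\<close> with the increments
  from \<open>s\<close> to \<open>r\<close>. Those are never negative, and from \<open>2 s\<close> on they are a fixed multiple of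
  \<open>sqrt s\<close>; the powers of \<open>s\<close> cancel.
\<close>

lemma scaled_tail_lower_bound:
  assumes s: "0 < s" and G: "G \<in> sets (F s)"
  defines "f \<equiv> \<lambda>\<omega>. indicator G \<omega> * indicator {\<omega>. B s \<omega> < B (2 * s) \<omega>} \<omega> :: real"
  shows "integrable M (\<lambda>\<omega>. f \<omega> * Z s \<omega>)"
    and "2 powr (- \<alpha>) / sqrt (2 * pi) * measure M G \<le> (\<integral>\<omega>. f \<omega> * Z s \<omega> \<partial>M)"
proof -
  interpret lM: pair_sigma_finite lborel M ..
  have f: "s \<le> r \<Longrightarrow> integrable M (\<lambda>\<omega>. f \<omega> * (B r \<omega> - B s \<omega>))"
    "s \<le> r \<Longrightarrow> 0 \<le> (\<integral>\<omega>. f \<omega> * (B r \<omega> - B s \<omega>) \<partial>M)"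
    "s \<le> r \<Longrightarrow> 2 * s \<le> r \<Longrightarrow> (\<integral>\<omega>. f \<omega> * (B r \<omega> - B s \<omega>) \<partial>M) = measure M G * sqrt (s / (2 * pi))" for r
    unfolding f_def by (rule positive_increment_correlation[OF s _ G]; assumption)+
  have fM [measurable]: "f \<in> borel_measurable M"
  proof -
    have [measurable]: "G \<in> sets M" "B s \<in> borel_measurable M" "B (2 * s) \<in> borel_measurable M"
      using G sets_F s by auto
    show ?thesis unfolding f_def by measurable
  qed
  have f1: "\<bar>f \<omega>\<bar> \<le> 1" for \<omega> by (auto simp: f_def indicator_def)
  define w where "w r = indicator {s..} r * (\<alpha> * r powr (- \<alpha> - 1))" for r
  have w0: "w r \<ge> 0" for r using \<alpha> by (simp add: w_def)
  have [measurable]: "w \<in> borel_measurable borel" unfolding w_def by measurable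
  have [measurable]: "(\<lambda>p. C (fst p) (snd p)) \<in> borel_measurable (lborel \<Otimes>\<^sub>M M)"
    "(\<lambda>p. C s (snd p)) \<in> borel_measurable (lborel \<Otimes>\<^sub>M M)"
    by (rule modification_measurable_compose; measurable)+
  define h where "h p = w (fst p) * (f (snd p) * (C (fst p) (snd p) - C s (snd p)))" for p
  have hM [measurable]: "h \<in> borel_measurable (lborel \<Otimes>\<^sub>M M)" unfolding h_def by measurable
  have hI: "integrable M (\<lambda>\<omega>. f \<omega> * (C r \<omega> - C s \<omega>))"
      and hE: "(\<integral>\<omega>. f \<omega> * (C r \<omega> - C s \<omega>) \<partial>M) = (\<integral>\<omega>. f \<omega> * (B r \<omega> - B s \<omega>) \<partial>M)"
      and hA: "(\<integral>\<omega>. \<bar>f \<omega> * (C r \<omega> - C s \<omega>)\<bar> \<partial>M) \<le> sqrt r" if "s \<le> r" for r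
  proof -
    have [measurable]: "(\<lambda>\<omega>. B r \<omega> - B s \<omega>) \<in> borel_measurable M" using s that by (intro increment_measurable) auto
    have ae: "AE \<omega> in M. f \<omega> * (C r \<omega> - C s \<omega>) = f \<omega> * (B r \<omega> - B s \<omega>)"
      using increment_modification[of s r] s that by auto
    show "integrable M (\<lambda>\<omega>. f \<omega> * (C r \<omega> - C s \<omega>))"
      using f(1)[OF that] by (rule integrable_cong_AE_imp) (use ae in auto)
    show "(\<integral>\<omega>. f \<omega> * (C r \<omega> - C s \<omega>) \<partial>M) = (\<integral>\<omega>. f \<omega> * (B r \<omega> - B s \<omega>) \<partial>M)"
      by (rule integral_cong_AE) (use ae in auto)
    show "(\<integral>\<omega>. \<bar>f \<omega> * (C r \<omega> - C s \<omega>)\<bar> \<partial>M) \<le> sqrt r"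
    proof (cases "s = r")
      case False
      then have sr: "s < r" using that by simp
      have "(\<integral>\<omega>. \<bar>f \<omega> * (C r \<omega> - C s \<omega>)\<bar> \<partial>M) = (\<integral>\<omega>. \<bar>f \<omega> * (B r \<omega> - B s \<omega>)\<bar> \<partial>M)"
        by (rule integral_cong_AE) (use ae in auto)
      also have "\<dots> \<le> (\<integral>\<omega>. \<bar>B r \<omega> - B s \<omega>\<bar> \<partial>M)"
      proof (rule integral_mono)
        show "integrable M (\<lambda>\<omega>. \<bar>f \<omega> * (B r \<omega> - B s \<omega>)\<bar>)" using f(1)[OF that] by (rule integrable_abs)
        show "integrable M (\<lambda>\<omega>. \<bar>B r \<omega> - B s \<omega>\<bar>)" using increment_integrable(2)[of s r] s sr by simp
        show "\<bar>f \<omega> * (B r \<omega> - B s \<omega>)\<bar> \<le> \<bar>B r \<omega> - B s \<omega>\<bar>" for \<omega>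
          using mult_right_mono[OF f1[of \<omega>], of "\<bar>B r \<omega> - B s \<omega>\<bar>"] by (simp add: abs_mult)
      qed
      also have "\<dots> = sqrt (2 * (r - s) / pi)" using increment_abs_moment[of s r] s sr by simp
      also have "\<dots> \<le> sqrt r"
      proof -
        have "3 * r \<le> pi * r" using pi_gt3 s sr by (intro mult_right_mono) auto
        moreover have "2 * (r - s) \<le> 3 * r" using s sr by simp
        ultimately have "2 * (r - s) \<le> pi * r" by (rule order_trans[rotated])
        then show ?thesis by (simp add: divide_le_eq mult.commute)
      qed
      finally show ?thesis .
    qed (use s in simp)
  qed
  have hint: "integrable (lborel \<Otimes>\<^sub>M M) h"
  proof (rule lM.Fubini_integrable[OF hM])
    show "AE r in lborel. integrable M (\<lambda>\<omega>. h (r, \<omega>))"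
      using hI by (auto simp: h_def w_def indicator_def)
    show "integrable lborel (\<lambda>r. \<integral>\<omega>. norm (h (r, \<omega>)) \<partial>M)"
    proof (rule Bochner_Integration.integrable_bound)
      show "integrable lborel (\<lambda>r. indicator {s..} r *\<^sub>R (\<alpha> * r powr (- (\<alpha> - 1/2) - 1)))"
      proof -
        have "set_integrable lborel {s..} (\<lambda>r. \<alpha> * r powr (- (\<alpha> - 1/2) - 1))"
          using powr_tail_integral(1)[of s "\<alpha> - 1/2"] s \<alpha> by (intro set_integrable_mult_right) auto
        then show ?thesis unfolding set_integrable_def .
      qed
      show "(\<lambda>r. \<integral>\<omega>. norm (h (r, \<omega>)) \<partial>M) \<in> borel_measurable lborel"
        by (rule borel_measurable_lebesgue_integral) (unfold case_prod_beta, measurable)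
      show "AE r in lborel. norm (\<integral>\<omega>. norm (h (r, \<omega>)) \<partial>M) \<le> norm (indicator {s..} r *\<^sub>R (\<alpha> * r powr (- (\<alpha> - 1/2) - 1)))"
      proof (rule AE_I2)
        fix r :: real
        have "(\<integral>\<omega>. norm (h (r, \<omega>)) \<partial>M) = w r * (\<integral>\<omega>. \<bar>f \<omega> * (C r \<omega> - C s \<omega>)\<bar> \<partial>M)"
          using w0[of r] by (simp add: h_def abs_mult mult.assoc)
        also have "\<dots> \<le> indicator {s..} r * (\<alpha> * r powr (- (\<alpha> - 1/2) - 1))"
        proof (cases "s \<le> r")
          case True
          then have "w r * (\<integral>\<omega>. \<bar>f \<omega> * (C r \<omega> - C s \<omega>)\<bar> \<partial>M) \<le> w r * sqrt r"
            using hA w0[of r] by (intro mult_left_mono) auto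
          also have "\<dots> = \<alpha> * (r powr (- \<alpha> - 1) * r powr (1/2))"
            using True s by (simp add: w_def powr_half_sqrt)
          also have "\<dots> = \<alpha> * r powr (- (\<alpha> - 1/2) - 1)" unfolding powr_add[symmetric] by (simp add: algebra_simps)
          finally show ?thesis using True by simp
        qed (simp add: w_def)
        finally have "(\<integral>\<omega>. norm (h (r, \<omega>)) \<partial>M) \<le> indicator {s..} r * (\<alpha> * r powr (- (\<alpha> - 1/2) - 1))" .
        moreover have "0 \<le> (\<integral>\<omega>. norm (h (r, \<omega>)) \<partial>M)" by simp
        ultimately show "norm (\<integral>\<omega>. norm (h (r, \<omega>)) \<partial>M) \<le> norm (indicator {s..} r *\<^sub>R (\<alpha> * r powr (- (\<alpha> - 1/2) - 1)))"
          by simp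
      qed
    qed
  qed
  have inner: "(\<integral>r. h (r, \<omega>) \<partial>lborel) = f \<omega> * tail_noise \<alpha> (\<lambda>r. C r \<omega>) s" for \<omega>
  proof -
    have "(\<integral>r. h (r, \<omega>) \<partial>lborel) = (\<integral>r. f \<omega> * (indicator {s..} r *\<^sub>R (\<alpha> * r powr (- \<alpha> - 1) * (C r \<omega> - C s \<omega>))) \<partial>lborel)"
      by (intro Bochner_Integration.integral_cong) (auto simp: h_def w_def)
    then show ?thesis unfolding tail_noise_def set_lebesgue_integral_def by simp
  qed
  have hint': "integrable (lborel \<Otimes>\<^sub>M M) (case_prod (\<lambda>r \<omega>. h (r, \<omega>)))" using hint by simp
  have iT: "integrable M (\<lambda>\<omega>. f \<omega> * tail_noise \<alpha> (\<lambda>r. C r \<omega>) s)"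
    using lM.integrable_snd[OF hint'] unfolding inner .
  then have "integrable M (\<lambda>\<omega>. s powr (\<alpha> - 1/2) * (f \<omega> * tail_noise \<alpha> (\<lambda>r. C r \<omega>) s))" by simp
  then show "integrable M (\<lambda>\<omega>. f \<omega> * Z s \<omega>)" by (simp add: scaled_tail_def mult.left_commute)
  define q where "q = sqrt (s / (2 * pi))"
  have "\<alpha> * measure M G * q * ((2 * s) powr (- \<alpha>) / \<alpha>) = (LBINT r:{2 * s..}. \<alpha> * measure M G * q * r powr (- \<alpha> - 1))"
    using powr_tail_integral(2)[of "2 * s" \<alpha>] s \<alpha> by simp
  also have "\<dots> = (\<integral>r. indicator {2 * s..} r *\<^sub>R (\<alpha> * measure M G * q * r powr (- \<alpha> - 1)) \<partial>lborel)"
    unfolding set_lebesgue_integral_def ..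
  also have "\<dots> \<le> (\<integral>r. (\<integral>\<omega>. h (r, \<omega>) \<partial>M) \<partial>lborel)"
  proof (rule integral_mono)
    show "integrable lborel (\<lambda>r. indicator {2 * s..} r *\<^sub>R (\<alpha> * measure M G * q * r powr (- \<alpha> - 1)))"
    proof -
      have "set_integrable lborel {2 * s..} (\<lambda>r. \<alpha> * measure M G * q * r powr (- \<alpha> - 1))"
        using powr_tail_integral(1)[of "2 * s" \<alpha>] s \<alpha> by (intro set_integrable_mult_right) auto
      then show ?thesis unfolding set_integrable_def .
    qed
    show "integrable lborel (\<lambda>r. \<integral>\<omega>. h (r, \<omega>) \<partial>M)"
      using lM.integrable_fst[OF hint'] .
    fix r :: real
    have e: "(\<integral>\<omega>. h (r, \<omega>) \<partial>M) = w r * (\<integral>\<omega>. f \<omega> * (C r \<omega> - C s \<omega>) \<partial>M)" by (simp add: h_def)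
    show "indicator {2 * s..} r *\<^sub>R (\<alpha> * measure M G * q * r powr (- \<alpha> - 1)) \<le> (\<integral>\<omega>. h (r, \<omega>) \<partial>M)"
    proof (cases "2 * s \<le> r")
      case True
      then have "s \<le> r" using s by simp
      then show ?thesis unfolding e hE[OF \<open>s \<le> r\<close>] f(3)[OF \<open>s \<le> r\<close> True] q_def w_def using True by simp
    next
      case False
      have "0 \<le> w r * (\<integral>\<omega>. f \<omega> * (C r \<omega> - C s \<omega>) \<partial>M)"
      proof (cases "s \<le> r")
        case True
        show ?thesis unfolding hE[OF True] using f(2)[OF True] w0 by (intro mult_nonneg_nonneg)
      qed (simp add: w_def)
      then show ?thesis using False e by simp
    qed
  qed
  also have "\<dots> = (\<integral>\<omega>. (\<integral>r. h (r, \<omega>) \<partial>lborel) \<partial>M)" using lM.Fubini_integral[OF hint'] by simp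
  also have "\<dots> = (\<integral>\<omega>. f \<omega> * tail_noise \<alpha> (\<lambda>r. C r \<omega>) s \<partial>M)" unfolding inner ..
  finally have "s powr (\<alpha> - 1/2) * (\<alpha> * measure M G * q * ((2 * s) powr (- \<alpha>) / \<alpha>))
      \<le> s powr (\<alpha> - 1/2) * (\<integral>\<omega>. f \<omega> * tail_noise \<alpha> (\<lambda>r. C r \<omega>) s \<partial>M)"
    by (rule mult_left_mono) simp
  also have "s powr (\<alpha> - 1/2) * (\<integral>\<omega>. f \<omega> * tail_noise \<alpha> (\<lambda>r. C r \<omega>) s \<partial>M) = (\<integral>\<omega>. f \<omega> * Z s \<omega> \<partial>M)"
    by (subst integral_mult_right_zero[symmetric]) (simp add: scaled_tail_def mult.left_commute)
  also have "s powr (\<alpha> - 1/2) * (\<alpha> * measure M G * q * ((2 * s) powr (- \<alpha>) / \<alpha>))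
     = 2 powr (- \<alpha>) / sqrt (2 * pi) * measure M G"
  proof -
    have "s powr (\<alpha> - 1/2) * (sqrt s * s powr (- \<alpha>)) = s powr ((\<alpha> - 1/2) + (1/2 + (- \<alpha>)))"
      unfolding powr_add using s by (simp add: powr_half_sqrt)
    also have "\<dots> = 1" using s by simp
    finally have "s powr (\<alpha> - 1/2) * (sqrt s * s powr (- \<alpha>)) = 1" .
    moreover have "s powr (\<alpha> - 1/2) * (\<alpha> * measure M G * q * ((2 * s) powr (- \<alpha>) / \<alpha>))
       = (s powr (\<alpha> - 1/2) * (sqrt s * s powr (- \<alpha>))) * (2 powr (- \<alpha>) / sqrt (2 * pi) * measure M G)"
      using s \<alpha> by (simp add: q_def real_sqrt_divide powr_mult)
    ultimately show ?thesis by simp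
  qed
  finally show "2 powr (- \<alpha>) / sqrt (2 * pi) * measure M G \<le> (\<integral>\<omega>. f \<omega> * Z s \<omega> \<partial>M)" .
qed

text \<open>
  The weight \<open>v\<close> is a probability density on \<open>[s, \<infinity>)\<close>, and \<open>Z s \<omega>\<close> is bounded by the average with
  respect to \<open>v\<close> of \<open>(\<alpha> / \<beta>) y\<close> with \<open>y = \<bar>C r \<omega> - C s \<omega>\<bar> / sqrt r\<close>. Young's inequality
  \<open>a y \<le> L + a\<^sup>2 y\<^sup>2 / L\<close> under the average separates the constant \<open>L\<close> from a remainder whose
  expectation is small for large \<open>L\<close>.
\<close>

lemma scaled_tail_pointwise:
  fixes L :: real
  assumes s: "0 < s" and L: "0 < L"
  defines "\<beta> \<equiv> \<alpha> - 1/2"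
  defines "v \<equiv> \<lambda>r. indicator {s..} r * (\<beta> * s powr \<beta> * r powr (- \<beta> - 1))"
  shows "ennreal \<bar>Z s \<omega>\<bar>
    \<le> ennreal L + ennreal ((\<alpha> / \<beta>)\<^sup>2 / L) * (\<integral>\<^sup>+r. ennreal (v r * ((C r \<omega> - C s \<omega>)\<^sup>2 / r)) \<partial>lborel)"
    and "(\<integral>\<^sup>+\<omega>. \<integral>\<^sup>+r. ennreal (v r * ((C r \<omega> - C s \<omega>)\<^sup>2 / r)) \<partial>lborel \<partial>M) \<le> 1"
proof -
  interpret lM: pair_sigma_finite lborel M ..
  have \<beta>: "\<beta> > 0" using \<alpha> by (simp add: \<beta>_def)
  have v0: "0 \<le> v r" for r using \<beta> by (simp add: v_def)
  have [measurable]: "v \<in> borel_measurable borel" unfolding v_def by measurable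
  have v1: "(\<integral>\<^sup>+r. ennreal (v r) \<partial>lborel) = 1"
  proof -
    have "(\<integral>\<^sup>+r. ennreal (v r) \<partial>lborel)
       = (\<integral>\<^sup>+r. ennreal (\<beta> * s powr \<beta>) * (ennreal (r powr (- \<beta> - 1)) * indicator {s..} r) \<partial>lborel)"
      using \<beta> by (intro nn_integral_cong) (auto simp: v_def indicator_def ennreal_mult')
    also have "\<dots> = ennreal (\<beta> * s powr \<beta>) * ennreal (s powr (- \<beta>) / \<beta>)"
      by (subst nn_integral_cmult) (auto simp: powr_tail_nn_integral[OF s \<beta>])
    also have "\<dots> = ennreal ((\<beta> * s powr \<beta>) * (s powr (- \<beta>) / \<beta>))"
      using \<beta> by (subst ennreal_mult') auto
    also have "(\<beta> * s powr \<beta>) * (s powr (- \<beta>) / \<beta>) = 1" using \<beta> s by (simp add: powr_minus)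
    finally show ?thesis by simp
  qed
  have pair [measurable]: "(\<lambda>p. C (fst p) (snd p)) \<in> borel_measurable (lborel \<Otimes>\<^sub>M M)"
    "(\<lambda>p. C s (snd p)) \<in> borel_measurable (lborel \<Otimes>\<^sub>M M)"
    by (rule modification_measurable_compose; measurable)+
  have hM: "case_prod (\<lambda>r \<omega>. ennreal (v r * ((C r \<omega> - C s \<omega>)\<^sup>2 / r))) \<in> borel_measurable (lborel \<Otimes>\<^sub>M M)"
    unfolding case_prod_beta by measurable
  have "(\<integral>\<^sup>+\<omega>. \<integral>\<^sup>+r. ennreal (v r * ((C r \<omega> - C s \<omega>)\<^sup>2 / r)) \<partial>lborel \<partial>M)
     = (\<integral>\<^sup>+r. \<integral>\<^sup>+\<omega>. ennreal (v r * ((C r \<omega> - C s \<omega>)\<^sup>2 / r)) \<partial>M \<partial>lborel)"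
    by (rule lM.Fubini'[OF hM])
  also have "\<dots> \<le> (\<integral>\<^sup>+r. ennreal (v r) \<partial>lborel)"
  proof (rule nn_integral_mono)
    fix r :: real
    show "(\<integral>\<^sup>+\<omega>. ennreal (v r * ((C r \<omega> - C s \<omega>)\<^sup>2 / r)) \<partial>M) \<le> ennreal (v r)"
    proof (cases "s \<le> r")
      case True
      have "(\<integral>\<^sup>+\<omega>. ennreal (v r * ((C r \<omega> - C s \<omega>)\<^sup>2 / r)) \<partial>M) = (\<integral>\<^sup>+\<omega>. ennreal (v r / r * (B r \<omega> - B s \<omega>)\<^sup>2) \<partial>M)"
        using increment_modification[of s r] True s by (intro nn_integral_cong_AE) (auto elim: eventually_mono)
      also have "\<dots> = ennreal (\<integral>\<omega>. v r / r * (B r \<omega> - B s \<omega>)\<^sup>2 \<partial>M)"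
        using increment_square_integrable[of s r] s True v0[of r] by (intro nn_integral_eq_integral) auto
      also have "(\<integral>\<omega>. v r / r * (B r \<omega> - B s \<omega>)\<^sup>2 \<partial>M) = v r * ((r - s) / r)"
        using increment_second_moment[of s r] s True by (cases "s = r") auto
      also have "\<dots> \<le> v r * 1" using v0[of r] s True by (intro mult_left_mono) auto
      finally show ?thesis by (simp add: ennreal_leI)
    qed (simp add: v_def)
  qed
  finally show "(\<integral>\<^sup>+\<omega>. \<integral>\<^sup>+r. ennreal (v r * ((C r \<omega> - C s \<omega>)\<^sup>2 / r)) \<partial>lborel \<partial>M) \<le> 1"
    unfolding v1 .
  define a where "a = \<alpha> / \<beta>"
  define \<kappa> where "\<kappa> = a\<^sup>2 / L"
  have \<kappa>: "\<kappa> \<ge> 0" using L by (simp add: \<kappa>_def)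
  define g where "g r = indicator {s..} r *\<^sub>R (\<alpha> * r powr (- \<alpha> - 1) * (C r \<omega> - C s \<omega>))" for r
  \<comment> \<open>Young's inequality under the integral, with \<open>a y\<close> the scaled integrand relative to \<open>v\<close>\<close>
  have pw: "s powr \<beta> * \<bar>g r\<bar> \<le> L * v r + \<kappa> * (v r * ((C r \<omega> - C s \<omega>)\<^sup>2 / r))" for r
  proof (cases "s \<le> r")
    case True
    define y where "y = r powr (- (1/2)) * \<bar>C r \<omega> - C s \<omega>\<bar>"
    have y2: "y\<^sup>2 = (C r \<omega> - C s \<omega>)\<^sup>2 / r"
    proof -
      have "(r powr (- (1/2)))\<^sup>2 = r powr (- 1)"
        unfolding power2_eq_square powr_add[symmetric] by simp
      also have "\<dots> = 1 / r" using True s by (simp add: powr_minus_divide)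
      finally show ?thesis unfolding y_def power_mult_distrib power2_abs by simp
    qed
    have "0 \<le> (a * y - L)\<^sup>2" by simp
    then have "2 * (a * y) * L \<le> (L + \<kappa> * y\<^sup>2) * L"
      using L by (simp add: \<kappa>_def power2_eq_square algebra_simps)
    then have "2 * (a * y) \<le> L + \<kappa> * y\<^sup>2" using L by simp
    moreover have "0 \<le> a * y" using \<alpha> \<beta> by (simp add: a_def y_def)
    ultimately have ay: "a * y \<le> L + \<kappa> * y\<^sup>2" by linarith
    have "s powr \<beta> * \<bar>g r\<bar> = v r * (a * y)"
    proof -
      have "r powr (- \<alpha> - 1) = r powr (- \<beta> - 1) * r powr (- (1/2))"
        unfolding powr_add[symmetric] by (rule arg_cong[of _ _ "\<lambda>q. r powr q"]) (simp add: \<beta>_def)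
      then show ?thesis using True \<alpha> \<beta> by (simp add: g_def v_def a_def y_def abs_mult)
    qed
    also have "\<dots> \<le> v r * (L + \<kappa> * y\<^sup>2)" using ay v0 by (rule mult_left_mono)
    finally show ?thesis unfolding y2 by (simp add: algebra_simps)
  qed (simp add: g_def v_def)
  let ?W = "\<integral>\<^sup>+r. ennreal (v r * ((C r \<omega> - C s \<omega>)\<^sup>2 / r)) \<partial>lborel"
  show "ennreal \<bar>Z s \<omega>\<bar> \<le> ennreal L + ennreal ((\<alpha> / \<beta>)\<^sup>2 / L) * ?W"
  proof (cases "integrable lborel g")
    case True
    have gM [measurable]: "g \<in> borel_measurable borel" using True by auto
    have CM [measurable]: "(\<lambda>r. v r * ((C r \<omega> - C s \<omega>)\<^sup>2 / r)) \<in> borel_measurable borel"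
    proof -
      have "(\<lambda>r. v r * ((g r / (\<alpha> * r powr (- \<alpha> - 1)))\<^sup>2 / r)) \<in> borel_measurable borel" by measurable
      also have "(\<lambda>r. v r * ((g r / (\<alpha> * r powr (- \<alpha> - 1)))\<^sup>2 / r)) = (\<lambda>r. v r * ((C r \<omega> - C s \<omega>)\<^sup>2 / r))"
        using s \<alpha> by (auto simp: fun_eq_iff v_def g_def indicator_def)
      finally show ?thesis .
    qed
    have V: "(\<lambda>r. ennreal (v r)) \<in> borel_measurable lborel" by measurable
    have E: "(\<lambda>r. ennreal (v r * ((C r \<omega> - C s \<omega>)\<^sup>2 / r))) \<in> borel_measurable lborel"
      by (rule measurable_compose[OF _ measurable_ennreal]) (use CM in \<open>simp only: measurable_lborel1 measurable_lborel2\<close>)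
    have "ennreal \<bar>Z s \<omega>\<bar> = ennreal (s powr \<beta>) * ennreal (norm (\<integral>r. g r \<partial>lborel))"
      unfolding scaled_tail_def tail_noise_def set_lebesgue_integral_def g_def \<beta>_def
      by (simp add: abs_mult ennreal_mult)
    also have "\<dots> \<le> ennreal (s powr \<beta>) * (\<integral>\<^sup>+r. ennreal (norm (g r)) \<partial>lborel)"
      by (intro mult_left_mono integral_norm_bound_ennreal[OF True]) auto
    also have "\<dots> = (\<integral>\<^sup>+r. ennreal (s powr \<beta> * \<bar>g r\<bar>) \<partial>lborel)"
      by (subst nn_integral_cmult[symmetric]) (auto simp: ennreal_mult)
    also have "\<dots> \<le> (\<integral>\<^sup>+r. ennreal L * ennreal (v r) + ennreal \<kappa> * ennreal (v r * ((C r \<omega> - C s \<omega>)\<^sup>2 / r)) \<partial>lborel)"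
    proof (rule nn_integral_mono)
      fix r :: real
      have nn: "0 \<le> v r * ((C r \<omega> - C s \<omega>)\<^sup>2 / r)" using s v0[of r] by (cases "s \<le> r") (auto simp: v_def)
      have "ennreal (s powr \<beta> * \<bar>g r\<bar>) \<le> ennreal (L * v r + \<kappa> * (v r * ((C r \<omega> - C s \<omega>)\<^sup>2 / r)))"
        using pw by (rule ennreal_leI)
      also have "\<dots> = ennreal L * ennreal (v r) + ennreal \<kappa> * ennreal (v r * ((C r \<omega> - C s \<omega>)\<^sup>2 / r))"
        using nn v0[of r] \<kappa> L by (simp only: ennreal_mult ennreal_plus mult_nonneg_nonneg less_imp_le)
      finally show "ennreal (s powr \<beta> * \<bar>g r\<bar>) \<le> ennreal L * ennreal (v r) + ennreal \<kappa> * ennreal (v r * ((C r \<omega> - C s \<omega>)\<^sup>2 / r))" .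
    qed
    also have "\<dots> = ennreal L * (\<integral>\<^sup>+r. ennreal (v r) \<partial>lborel) + ennreal \<kappa> * ?W"
    proof -
      define e where "e r = ennreal (v r * ((C r \<omega> - C s \<omega>)\<^sup>2 / r))" for r
      have [measurable]: "e \<in> borel_measurable lborel" using E by (simp only: e_def[abs_def])
      have "(\<integral>\<^sup>+r. ennreal L * ennreal (v r) + ennreal \<kappa> * e r \<partial>lborel)
          = ennreal L * (\<integral>\<^sup>+r. ennreal (v r) \<partial>lborel) + ennreal \<kappa> * (\<integral>\<^sup>+r. e r \<partial>lborel)"
        by (subst nn_integral_add) (auto simp: nn_integral_cmult)
      then show ?thesis unfolding e_def .
    qed
    finally show ?thesis unfolding v1 by (simp add: \<kappa>_def a_def)
  next
    case False
    \<comment> \<open>a divergent integral has the default value \<open>0\<close>\<close>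
    have "Z s \<omega> = s powr \<beta> * (\<integral>r. g r \<partial>lborel)"
      unfolding scaled_tail_def tail_noise_def set_lebesgue_integral_def g_def \<beta>_def ..
    then show ?thesis using not_integrable_integral_eq[OF False] by simp
  qed
qed

text \<open>
  What the truncation at \<open>L\<close> cuts off costs at most a constant divided by \<open>L\<close>, uniformly in \<open>s\<close> and
  in the event \<open>G\<close>.
\<close>

lemma scaled_tail_truncated:
  assumes s: "0 < s" and G: "G \<in> sets (F s)" and L: "0 < L"
  shows "2 powr (- \<alpha>) / sqrt (2 * pi) * measure M G - (\<alpha> / (\<alpha> - 1/2))\<^sup>2 / L
    \<le> (\<integral>\<omega>. indicator G \<omega> * min L (max 0 (Z s \<omega>)) \<partial>M)"
proof -
  define f where "f \<omega> = (indicator G \<omega> * indicator {\<omega>. B s \<omega> < B (2 * s) \<omega>} \<omega> :: real)" for \<omega>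
  note low = scaled_tail_lower_bound[OF s G, folded f_def]
  define \<kappa> where "\<kappa> = (\<alpha> / (\<alpha> - 1/2))\<^sup>2 / L"
  have \<kappa>: "0 \<le> \<kappa>" using L by (simp add: \<kappa>_def)
  define W where "W \<omega> = (\<integral>\<^sup>+r. ennreal (indicator {s..} r * ((\<alpha> - 1/2) * s powr (\<alpha> - 1/2) * r powr (- (\<alpha> - 1/2) - 1))
      * ((C r \<omega> - C s \<omega>)\<^sup>2 / r)) \<partial>lborel)" for \<omega>
  note up = scaled_tail_pointwise[OF s L, folded W_def \<kappa>_def]
  have GM [measurable]: "G \<in> sets M" using G sets_F by blast
  have ZM [measurable]: "(\<lambda>\<omega>. Z s \<omega>) \<in> borel_measurable M" by (rule scaled_tail_measurable_\<omega>)
  have WM [measurable]: "W \<in> borel_measurable M"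
  proof -
    have [measurable]: "(\<lambda>p. C (snd p) (fst p)) \<in> borel_measurable (M \<Otimes>\<^sub>M lborel)"
      "(\<lambda>p. C s (fst p)) \<in> borel_measurable (M \<Otimes>\<^sub>M lborel)"
      by (rule modification_measurable_compose; measurable)+
    show ?thesis unfolding W_def
      by (rule lborel.borel_measurable_nn_integral) (unfold case_prod_beta, measurable)
  qed
  let ?T = "\<lambda>\<omega>. indicator G \<omega> * min L (max 0 (Z s \<omega>))"
  have T0: "0 \<le> ?T \<omega>" for \<omega> using L by simp
  have Ti: "integrable M ?T"
  proof (rule integrable_const_bound[where B=L])
    show "AE \<omega> in M. norm (?T \<omega>) \<le> L" using L by (intro AE_I2) (auto simp: indicator_def)
  qed measurable
  have pw: "ennreal (max 0 (f \<omega> * Z s \<omega>)) \<le> ennreal (?T \<omega>) + ennreal \<kappa> * W \<omega>" for \<omega>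
  proof -
    have "max 0 (f \<omega> * z) \<le> indicator G \<omega> * max 0 z" for z :: real
      by (auto simp: f_def indicator_def)
    from this[of "Z s \<omega>"] have 1: "ennreal (max 0 (f \<omega> * Z s \<omega>)) \<le> ennreal (indicator G \<omega> * max 0 (Z s \<omega>))" by (rule ennreal_leI)
    show ?thesis
    proof (cases "\<omega> \<in> G \<and> L < Z s \<omega>")
      case True
      then have e: "indicator G \<omega> * max 0 (Z s \<omega>) = \<bar>Z s \<omega>\<bar>" "?T \<omega> = L" using L by auto
      show ?thesis unfolding e(2) using 1 unfolding e(1) by (rule order_trans) (rule up(1))
    next
      case False
      then have e: "indicator G \<omega> * max 0 (Z s \<omega>) = ?T \<omega>" using L by (auto simp: indicator_def)
      have "ennreal (max 0 (f \<omega> * Z s \<omega>)) \<le> ennreal (?T \<omega>)" using 1 unfolding e .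
      then show ?thesis by (simp add: add_increasing2)
    qed
  qed
  have maxi: "integrable M (\<lambda>\<omega>. max 0 (f \<omega> * Z s \<omega>))" using low(1) by simp
  have "ennreal (\<integral>\<omega>. max 0 (f \<omega> * Z s \<omega>) \<partial>M) = (\<integral>\<^sup>+\<omega>. ennreal (max 0 (f \<omega> * Z s \<omega>)) \<partial>M)"
    using maxi by (intro nn_integral_eq_integral[symmetric]) auto
  also have "\<dots> \<le> (\<integral>\<^sup>+\<omega>. ennreal (?T \<omega>) + ennreal \<kappa> * W \<omega> \<partial>M)"
    using pw by (intro nn_integral_mono)
  also have "\<dots> = (\<integral>\<^sup>+\<omega>. ennreal (?T \<omega>) \<partial>M) + ennreal \<kappa> * (\<integral>\<^sup>+\<omega>. W \<omega> \<partial>M)"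
    by (subst nn_integral_add) (auto simp: nn_integral_cmult)
  also have "\<dots> \<le> ennreal (\<integral>\<omega>. ?T \<omega> \<partial>M) + ennreal \<kappa> * 1"
    using up(2) nn_integral_eq_integral[OF Ti] T0 by (intro add_mono mult_left_mono) auto
  also have "\<dots> = ennreal ((\<integral>\<omega>. ?T \<omega> \<partial>M) + \<kappa>)"
    using \<kappa> T0 by (simp add: integral_nonneg_AE)
  finally have "(\<integral>\<omega>. max 0 (f \<omega> * Z s \<omega>) \<partial>M) \<le> (\<integral>\<omega>. ?T \<omega> \<partial>M) + \<kappa>"
    using \<kappa> T0 by (subst (asm) ennreal_le_iff) (auto intro!: add_nonneg_nonneg integral_nonneg_AE)
  moreover have "(\<integral>\<omega>. f \<omega> * Z s \<omega> \<partial>M) \<le> (\<integral>\<omega>. max 0 (f \<omega> * Z s \<omega>) \<partial>M)"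
    using low(1) maxi by (intro integral_mono) auto
  ultimately show ?thesis using low(2) unfolding \<kappa>_def by linarith
qed

lemma averaged_tail_bounds:
  assumes L: "0 < L"
  shows "averaged_tail C \<alpha> L n \<in> borel_measurable M" "0 \<le> averaged_tail C \<alpha> L n \<omega>" "averaged_tail C \<alpha> L n \<omega> \<le> L"
proof -
  have [measurable]: "(\<lambda>p. Z (snd p) (fst p)) \<in> borel_measurable (M \<Otimes>\<^sub>M lborel)"
    using measurable_compose[OF measurable_pair_swap' scaled_tail_measurable] by (simp only: case_prod_beta fst_conv snd_conv)
  show "averaged_tail C \<alpha> L n \<in> borel_measurable M"
    unfolding averaged_tail_def[abs_def] set_lebesgue_integral_def
    by (rule lborel.borel_measurable_lebesgue_integral) (unfold case_prod_beta, measurable)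
  show "0 \<le> averaged_tail C \<alpha> L n \<omega>"
    unfolding averaged_tail_def set_lebesgue_integral_def using L by (intro Bochner_Integration.integral_nonneg) auto
  show "averaged_tail C \<alpha> L n \<omega> \<le> L"
  proof (cases "set_integrable lborel {2 ^ n..2 ^ Suc n} (\<lambda>s. min L (max 0 (Z s \<omega>)) / 2 ^ n)")
    case True
    then have "averaged_tail C \<alpha> L n \<omega> \<le> (LBINT s:{2 ^ n..2 ^ Suc n :: real}. L / 2 ^ n)"
      unfolding averaged_tail_def by (intro set_integral_mono) (auto simp: divide_right_mono set_integrable_def)
    also have "\<dots> = L" by (simp add: set_lebesgue_integral_def)
    finally show ?thesis .
  next
    case False
    \<comment> \<open>a divergent integral has the default value \<open>0\<close>\<close>
    then have "averaged_tail C \<alpha> L n \<omega> = 0" unfolding averaged_tail_def set_integrable_def set_lebesgue_integral_def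
      by (rule not_integrable_integral_eq)
    then show ?thesis using L by simp
  qed
qed

lemma averaged_tail_lower_bound:
  assumes G: "G \<in> sets (F t)" and t: "t \<le> 2 ^ n" and L: "0 < L"
  shows "2 powr (- \<alpha>) / sqrt (2 * pi) * measure M G - (\<alpha> / (\<alpha> - 1/2))\<^sup>2 / L
    \<le> (\<integral>\<omega>. indicator G \<omega> * averaged_tail C \<alpha> L n \<omega> \<partial>M)"
proof -
  interpret lM: pair_sigma_finite lborel M ..
  define D where "D = 2 powr (- \<alpha>) / sqrt (2 * pi) * measure M G - (\<alpha> / (\<alpha> - 1/2))\<^sup>2 / L"
  have GM [measurable]: "G \<in> sets M" using G sets_F by blast
  define h where "h s \<omega> = indicator {2 ^ n..2 ^ Suc n} s * (indicator G \<omega> * min L (max 0 (Z s \<omega>)) / 2 ^ n)" for s :: real and \<omega>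
  have [measurable]: "(\<lambda>p. Z (fst p) (snd p)) \<in> borel_measurable (lborel \<Otimes>\<^sub>M M)" by (rule scaled_tail_measurable)
  have hM: "case_prod h \<in> borel_measurable (lborel \<Otimes>\<^sub>M M)"
    unfolding h_def case_prod_beta by measurable
  have hb: "\<bar>h s \<omega>\<bar> \<le> indicator {2 ^ n..2 ^ Suc n} s * L" for s \<omega>
  proof -
    have "min L (max 0 (Z s \<omega>)) / 2 ^ n \<le> L / 1" using L by (intro frac_le) auto
    then show ?thesis using L by (auto simp: h_def indicator_def)
  qed
  have hint: "integrable (lborel \<Otimes>\<^sub>M M) (case_prod h)"
  proof (rule integrableI_bounded[OF hM])
    have "(\<integral>\<^sup>+p. ennreal (norm (case_prod h p)) \<partial>(lborel \<Otimes>\<^sub>M M)) \<le> (\<integral>\<^sup>+p. ennreal L * indicator {2 ^ n..2 ^ Suc n :: real} (fst p) \<partial>(lborel \<Otimes>\<^sub>M M))"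
    proof (rule nn_integral_mono)
      fix p :: "real \<times> 'a"
      have "ennreal (norm (case_prod h p)) \<le> ennreal (indicator {2 ^ n..2 ^ Suc n} (fst p) * L)"
        unfolding case_prod_beta real_norm_def by (rule ennreal_leI[OF hb])
      also have "\<dots> = ennreal L * indicator {2 ^ n..2 ^ Suc n} (fst p)" by (simp add: indicator_def)
      finally show "ennreal (norm (case_prod h p)) \<le> ennreal L * indicator {2 ^ n..2 ^ Suc n} (fst p)" .
    qed
    also have "\<dots> = ennreal L * (\<integral>\<^sup>+s. indicator {2 ^ n..2 ^ Suc n :: real} s \<partial>lborel)"
      by (subst nn_integral_fst[symmetric]) (auto simp: emeasure_space_1 nn_integral_cmult)
    also have "\<dots> < \<infinity>" by (simp add: ennreal_mult_less_top)
    finally show "(\<integral>\<^sup>+p. ennreal (norm (case_prod h p)) \<partial>(lborel \<Otimes>\<^sub>M M)) < \<infinity>" .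
  qed
  have inner: "(\<integral>s. h s \<omega> \<partial>lborel) = indicator G \<omega> * averaged_tail C \<alpha> L n \<omega>" for \<omega>
  proof -
    have "(\<integral>s. h s \<omega> \<partial>lborel) = (\<integral>s. indicator G \<omega> * (indicator {2 ^ n..2 ^ Suc n} s *\<^sub>R (min L (max 0 (Z s \<omega>)) / 2 ^ n)) \<partial>lborel)"
      by (intro Bochner_Integration.integral_cong) (auto simp: h_def)
    then show ?thesis unfolding averaged_tail_def set_lebesgue_integral_def by (simp only: integral_mult_right_zero)
  qed
  have "D = (\<integral>s. indicator {2 ^ n..2 ^ Suc n} s * (D / 2 ^ n) \<partial>(lborel :: real measure))" by simp
  also have "\<dots> \<le> (\<integral>s. (\<integral>\<omega>. h s \<omega> \<partial>M) \<partial>lborel)"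
  proof (rule integral_mono)
    show "integrable lborel (\<lambda>s. indicator {2 ^ n..2 ^ Suc n :: real} s * (D / 2 ^ n))" by simp
    show "integrable lborel (\<lambda>s. \<integral>\<omega>. h s \<omega> \<partial>M)" by (rule lM.integrable_fst[OF hint])
    fix s :: real
    have eq: "(\<integral>\<omega>. h s \<omega> \<partial>M) = indicator {2 ^ n..2 ^ Suc n} s * ((\<integral>\<omega>. indicator G \<omega> * min L (max 0 (Z s \<omega>)) \<partial>M) / 2 ^ n)"
      unfolding h_def by (simp only: integral_mult_right_zero integral_divide_zero)
    show "indicator {2 ^ n..2 ^ Suc n} s * (D / 2 ^ n) \<le> (\<integral>\<omega>. h s \<omega> \<partial>M)"
    proof (cases "s \<in> {2 ^ n..2 ^ Suc n}")
      case True
      have "0 < s" using True by (intro less_le_trans[of 0 "2 ^ n" s]) auto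
      moreover have "G \<in> sets (F s)" using G sets_F_mono[of t s] True t by auto
      ultimately have "D \<le> (\<integral>\<omega>. indicator G \<omega> * min L (max 0 (Z s \<omega>)) \<partial>M)"
        unfolding D_def by (rule scaled_tail_truncated[OF _ _ L])
      then show ?thesis unfolding eq using True by (intro mult_left_mono divide_right_mono) auto
    next
      case False
      then show ?thesis unfolding eq by simp
    qed
  qed
  also have "\<dots> = (\<integral>\<omega>. (\<integral>s. h s \<omega> \<partial>lborel) \<partial>M)" using lM.Fubini_integral[OF hint] by simp
  finally show ?thesis unfolding inner D_def .
qed

text \<open>
  Approximate \<open>A\<close> by an event \<open>G\<close> known at some time \<open>m\<close>. From that time on the averaged tail has
  expectation at least \<open>c P(G) - \<kappa> / L\<close> on \<open>G\<close>, while on \<open>A\<close> its expectation tends to \<open>0\<close> and on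
  \<open>G - A\<close> it is at most \<open>L P(G - A)\<close>. Refining the approximation gives \<open>c P(A) \<le> \<kappa> / L\<close> for every \<open>L\<close>.
\<close>

lemma null_if_averaged_tail_vanishes:
  assumes A: "A \<in> sigma_sets (space M) (\<Union>n. sets (F (real n)))"
    and lim: "\<And>L. 0 < L \<Longrightarrow> AE \<omega> in M. \<omega> \<in> A \<longrightarrow> (\<lambda>n. averaged_tail C \<alpha> L n \<omega>) \<longlonglongrightarrow> 0"
  shows "measure M A = 0"
proof -
  define c where "c = 2 powr (- \<alpha>) / sqrt (2 * pi)"
  define \<kappa> where "\<kappa> = (\<alpha> / (\<alpha> - 1/2))\<^sup>2"
  have c: "c > 0" by (simp add: c_def)
  have AM [measurable]: "A \<in> sets M" using A sets.sigma_sets_subset[of "\<Union>n. sets (F (real n))" M] sets_F by blast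
  have trunc: "c * measure M A \<le> \<kappa> / L" if L: "0 < L" for L
  proof (rule field_le_epsilon)
    fix e :: real assume e: "0 < e"
    note [measurable] = averaged_tail_bounds(1)[OF L]
    \<comment> \<open>\<open>c + L\<close> dominates the weights \<open>c\<close> of \<open>P(A - G)\<close> and \<open>L\<close> of \<open>P(G - A)\<close> below\<close>
    have "0 < e / (c + L)" using e c L by simp
    then obtain m G where G: "G \<in> sets (F (real m))" "measure M (A - G) + measure M (G - A) < e / (c + L)"
      using sets_approximation[OF A] by blast
    have GM [measurable]: "G \<in> sets M" using G(1) sets_F by blast
    have int: "integrable M (\<lambda>\<omega>. indicator S \<omega> * averaged_tail C \<alpha> L n \<omega>)" if [measurable]: "S \<in> sets M" for S n
    proof (rule integrable_const_bound[where B=L])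
      show "AE \<omega> in M. norm (indicator S \<omega> * averaged_tail C \<alpha> L n \<omega>) \<le> L"
        using averaged_tail_bounds(2,3)[OF L, of n] L by (intro AE_I2) (auto simp: indicator_def)
    qed measurable
    have lim0: "(\<lambda>n. \<integral>\<omega>. indicator A \<omega> * averaged_tail C \<alpha> L n \<omega> \<partial>M) \<longlonglongrightarrow> (\<integral>\<omega>. 0 \<partial>M)"
    proof (rule integral_dominated_convergence[where w="\<lambda>_. L"])
      show "AE \<omega> in M. (\<lambda>n. indicator A \<omega> * averaged_tail C \<alpha> L n \<omega>) \<longlonglongrightarrow> 0"
        using lim[OF L] by eventually_elim (auto simp: indicator_def)
      show "AE \<omega> in M. norm (indicator A \<omega> * averaged_tail C \<alpha> L n \<omega>) \<le> L" for n
        using averaged_tail_bounds(2,3)[OF L, of n] L by (intro AE_I2) (auto simp: indicator_def)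
    qed auto
    have "c * measure M G - \<kappa> / L \<le> (\<integral>\<omega>. indicator A \<omega> * averaged_tail C \<alpha> L n \<omega> \<partial>M) + L * measure M (G - A)" if n: "m \<le> n" for n
    proof -
      have "m \<le> 2 ^ n" using n less_exp[of n] by linarith
      then have "real m \<le> real (2 ^ n)" by (rule of_nat_mono)
      then have "real m \<le> 2 ^ n" by simp
      from averaged_tail_lower_bound[OF G(1) this L]
      have "c * measure M G - \<kappa> / L \<le> (\<integral>\<omega>. indicator G \<omega> * averaged_tail C \<alpha> L n \<omega> \<partial>M)" unfolding c_def \<kappa>_def .
      also have "\<dots> \<le> (\<integral>\<omega>. indicator A \<omega> * averaged_tail C \<alpha> L n \<omega> + L * indicator (G - A) \<omega> \<partial>M)"
      proof (rule integral_mono[OF int])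
        show "integrable M (\<lambda>\<omega>. indicator A \<omega> * averaged_tail C \<alpha> L n \<omega> + L * indicator (G - A) \<omega>)"
          using int[OF AM] by (intro Bochner_Integration.integrable_add integrable_mult_right) (auto simp: emeasure_eq_measure)
        show "indicator G \<omega> * averaged_tail C \<alpha> L n \<omega> \<le> indicator A \<omega> * averaged_tail C \<alpha> L n \<omega> + L * indicator (G - A) \<omega>" for \<omega>
          using averaged_tail_bounds(2,3)[OF L, of n \<omega>] by (auto simp: indicator_def)
      qed measurable
      also have "\<dots> = (\<integral>\<omega>. indicator A \<omega> * averaged_tail C \<alpha> L n \<omega> \<partial>M) + L * measure M (G - A)"
        using int[OF AM] by (subst Bochner_Integration.integral_add) (auto simp: emeasure_eq_measure)
      finally show ?thesis .
    qed
    then have "c * measure M G - \<kappa> / L \<le> (\<integral>\<omega>. 0 \<partial>M) + L * measure M (G - A)"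
      by (intro LIMSEQ_le_const[OF tendsto_add[OF lim0 tendsto_const]]) auto
    then have 1: "c * measure M G \<le> \<kappa> / L + L * measure M (G - A)" by simp
    have "measure M A \<le> measure M (G \<union> (A - G))" by (rule finite_measure_mono) auto
    also have "\<dots> \<le> measure M G + measure M (A - G)" by (rule measure_Un_le) auto
    finally have "c * measure M A \<le> c * measure M G + c * measure M (A - G)" using c by (simp flip: distrib_left)
    then have "c * measure M A \<le> \<kappa> / L + (c * measure M (A - G) + L * measure M (G - A))" using 1 by simp
    also have "c * measure M (A - G) + L * measure M (G - A)
        \<le> (c + L) * measure M (A - G) + (c + L) * measure M (G - A)"
      using c L by (intro add_mono mult_right_mono) auto
    also have "\<dots> = (c + L) * (measure M (A - G) + measure M (G - A))" by (simp only: distrib_left)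
    also have "\<dots> \<le> (c + L) * (e / (c + L))" using G(2) c L by (intro mult_left_mono) auto
    also have "\<dots> = e" using c L by simp
    finally show "c * measure M A \<le> \<kappa> / L + e" by simp
  qed
  have "c * measure M A \<le> 0"
  proof (rule field_le_epsilon)
    fix e :: real assume e: "0 < e"
    have \<kappa>: "\<kappa> \<ge> 0" by (simp add: \<kappa>_def)
    have "\<kappa> / ((\<kappa> + 1) / e) \<le> e" using e \<kappa> by (simp add: field_simps)
    then show "c * measure M A \<le> 0 + e" using trunc[of "(\<kappa> + 1) / e"] e \<kappa> by simp
  qed
  then show ?thesis using c measure_nonneg[of M A] by (simp add: mult_le_0_iff)
qed

end

end

section \<open>Solutions of the stochastic differential equation\<close>

context brownian_motion
begin

text \<open>
  Convergence to \<open>0\<close> is decided by the upper and the lower limit. The index is shifted because the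
  solution of the equation is adapted only from time \<open>1\<close> on.
\<close>

lemma limit_zero_event_measurable:
  fixes Y :: "nat \<Rightarrow> 'a \<Rightarrow> ereal"
  assumes "\<And>n. Y n \<in> borel_measurable (F (real (Suc n)))"
  shows "{\<omega> \<in> space M. (\<lambda>n. Y n \<omega>) \<longlonglongrightarrow> 0} \<in> sigma_sets (space M) (\<Union>n. sets (F (real n)))"
proof -
  define N where "N = sigma (space M) (\<Union>n. sets (F (real n)))"
  have sub: "(\<Union>n. sets (F (real n))) \<subseteq> Pow (space M)" using sets.space_closed space_F by blast
  have N: "space N = space M" "sets N = sigma_sets (space M) (\<Union>n. sets (F (real n)))"
    unfolding N_def using sub by (auto simp: space_measure_of_conv)
  have [measurable]: "Y n \<in> borel_measurable N" for n
  proof (rule measurable_from_subalg[OF _ assms])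
    show "subalgebra N (F (real (Suc n)))"
      unfolding subalgebra_def N space_F by blast
  qed
  have "{\<omega> \<in> space N. liminf (\<lambda>n. Y n \<omega>) = 0 \<and> limsup (\<lambda>n. Y n \<omega>) = 0} \<in> sets N" by measurable
  moreover have "(\<lambda>n. Y n \<omega>) \<longlonglongrightarrow> 0 \<longleftrightarrow> liminf (\<lambda>n. Y n \<omega>) = 0 \<and> limsup (\<lambda>n. Y n \<omega>) = 0" for \<omega>
    using tendsto_iff_Liminf_eq_Limsup[of sequentially "\<lambda>n. Y n \<omega>" 0] by auto
  ultimately show ?thesis using N by simp
qed

end

lemma continuous_eq_on_rationals:
  fixes f g :: "real \<Rightarrow> real"
  assumes "continuous_on {a..} f" "continuous_on {a..} g" "\<And>q. q \<in> \<rat> \<Longrightarrow> a \<le> q \<Longrightarrow> f q = g q" "a \<le> t"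
  shows "f t = g t"
proof (rule ccontr)
  assume "f t \<noteq> g t"
  then have "0 < \<bar>f t - g t\<bar>" by simp
  moreover have "continuous_on {a..} (\<lambda>t. f t - g t)" using assms by (intro continuous_intros)
  ultimately obtain d where d: "0 < d" "\<And>q. q \<in> {a..} \<Longrightarrow> dist q t < d \<Longrightarrow> dist (f q - g q) (f t - g t) < \<bar>f t - g t\<bar>"
    using assms(4) unfolding continuous_on_iff by (metis atLeast_iff)
  obtain q where "q \<in> \<rat>" "t < q" "q < t + d" using Rats_dense_in_real[of t "t + d"] d(1) by auto
  then show False using d(2)[of q] assms(3)[of q] assms(4) by (simp add: dist_real_def)
qed

text \<open>
  The equation holds almost surely at each fixed time before the explosion, hence at all rational
  such times together, and by continuity at all of them. On a path that does not explode it is then the perturbed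
  differential equation with \<open>N\<close> the tail noise. The slack \<open>e\<close> absorbs the difference between the
  growth bound with exponent \<open>1/2 + e\<close> and the order \<open>1/2\<close> of the increments.
\<close>

lemma (in brownian_motion) solution_dichotomy:
  fixes X :: "real \<Rightarrow> 'a \<Rightarrow> ereal" and C :: "real \<Rightarrow> 'a \<Rightarrow> real"
  assumes k: "1 < k" and \<alpha>: "1/2 < \<alpha>" "k * (\<alpha> - 1/2) < 1 + (\<alpha> - 1/2)"
    and sol: "solves_sde M F B (\<lambda>t x. \<bar>x\<bar> powr k) (\<lambda>t. t powr (- \<alpha>)) 1 X"
    and C: "\<And>\<omega>. continuous_on UNIV (\<lambda>r. C r \<omega>)" "AE \<omega> in M. \<forall>r\<ge>0. C r \<omega> = B r \<omega>"
  shows "AE \<omega> in M. ((\<lambda>t. X t \<omega>) \<longlongrightarrow> \<infinity>) at_top \<or>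
    (((\<lambda>t. X t \<omega>) \<longlongrightarrow> 0) at_top \<and> (\<forall>L>0. (\<lambda>n. averaged_tail C \<alpha> L n \<omega>) \<longlonglongrightarrow> 0))"
proof -
  define \<beta> where "\<beta> = \<alpha> - 1/2"
  have \<beta>: "0 < \<beta>" "k * \<beta> < 1 + \<beta>" using \<alpha> by (simp_all add: \<beta>_def)
  define e where "e = min \<beta> (1 + \<beta> - k * \<beta>) / 2"
  have e: "0 < e" "e < \<beta>" "k * \<beta> < 1 + (\<beta> - e)" using \<beta> by (auto simp: e_def min_def field_simps)
  define \<theta> where "\<theta> = 1/2 + e"
  have \<theta>: "1/2 < \<theta>" "0 < \<theta>" "\<theta> < \<alpha>" "\<alpha> - \<theta> = \<beta> - e" using e by (auto simp: \<theta>_def \<beta>_def)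
  define N where "N \<omega> = tail_noise \<alpha> (\<lambda>r. C r \<omega>)" for \<omega>
  define \<zeta> where "\<zeta> = explosion_time 1 X"
  note growth = brownian_path_growth[OF \<theta>(1)]
  have step: "AE \<omega> in M. ereal t < \<zeta> \<omega> \<longrightarrow>
     real_of_ereal (X t \<omega>) = real_of_ereal (X 1 \<omega>) + (LBINT s:{1..t}. \<bar>real_of_ereal (X s \<omega>)\<bar> powr k) + (N \<omega> 1 - N \<omega> t)"
    if t: "1 \<le> t" for t
  proof -
    obtain I where I: "has_ito_integral M F B (\<lambda>s \<omega>. s powr (- \<alpha>)) 1 t I"
      and eq: "AE \<omega> in M. ereal t < \<zeta> \<omega> \<longrightarrow> real_of_ereal (X t \<omega>) = real_of_ereal (X 1 \<omega>)
             + (LBINT s:{1..t}. \<bar>real_of_ereal (X s \<omega>)\<bar> powr k) + I \<omega>"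
      using sol t unfolding solves_sde_def \<zeta>_def by blast
    have "AE \<omega> in M. I \<omega> = t powr (- \<alpha>) * B t \<omega> - 1 powr (- \<alpha>) * B 1 \<omega> - integral {1..t} (\<lambda>s. (- \<alpha> * s powr (- \<alpha> - 1)) * B s \<omega>)"
    proof (rule ito_integral_by_parts[OF _ t _ _ I])
      show "continuous_on {1..t} (\<lambda>s. - \<alpha> * s powr (- \<alpha> - 1))" by (intro continuous_intros) auto
      show "((\<lambda>t. t powr - \<alpha>) has_real_derivative - \<alpha> * s powr (- \<alpha> - 1)) (at s within {1..t})" if "s \<in> {1..t}" for s
        using that by (auto intro!: derivative_eq_intros)
    qed simp
    with eq growth C(2) show ?thesis
    proof eventually_elim
      case (elim \<omega>)
      obtain K where K: "\<And>t. 1 \<le> t \<Longrightarrow> \<bar>B t \<omega>\<bar> \<le> K * t powr \<theta>" using elim(2) by blast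
      have BC: "B r \<omega> = C r \<omega>" if "0 \<le> r" for r using elim(3) that by simp
      have "N \<omega> 1 - N \<omega> t = t powr (- \<alpha>) * C t \<omega> - C 1 \<omega> + \<alpha> * integral {1..t} (\<lambda>r. r powr (- \<alpha> - 1) * C r \<omega>)"
        unfolding N_def
      proof (rule tail_noise_diff[OF C(1) \<theta>(2,3) _ t])
        fix r :: real assume "1 \<le> r"
        then show "\<bar>C r \<omega>\<bar> \<le> K * r powr \<theta>" using K[of r] BC[of r] by simp
      qed
      also have "\<alpha> * integral {1..t} (\<lambda>r. r powr (- \<alpha> - 1) * C r \<omega>) = - integral {1..t} (\<lambda>s. (- \<alpha> * s powr (- \<alpha> - 1)) * B s \<omega>)"
      proof -
        have "integral {1..t} (\<lambda>s. (- \<alpha> * s powr (- \<alpha> - 1)) * B s \<omega>) = integral {1..t} (\<lambda>s. - \<alpha> * (s powr (- \<alpha> - 1) * C s \<omega>))"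
          by (rule Henstock_Kurzweil_Integration.integral_cong) (auto simp: BC)
        then show ?thesis by (simp only: integral_mult_right)
      qed
      finally have "I \<omega> = N \<omega> 1 - N \<omega> t" using elim(4) BC[of t] BC[of 1] t by simp
      then show ?case using elim(1) by simp
    qed
  qed
  have "AE \<omega> in M. \<forall>t\<in>\<rat> \<inter> {1..}. ereal t < \<zeta> \<omega> \<longrightarrow>
     real_of_ereal (X t \<omega>) = real_of_ereal (X 1 \<omega>) + (LBINT s:{1..t}. \<bar>real_of_ereal (X s \<omega>)\<bar> powr k) + (N \<omega> 1 - N \<omega> t)"
  proof (subst AE_ball_countable)
    show "countable (\<rat> \<inter> {1::real..})" by (simp add: countable_rat countable_Int1)
  qed (use step in blast)
  moreover have "AE \<omega> in M. continuous_on {1..} (\<lambda>t. X t \<omega>)"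
    and "AE \<omega> in M. \<forall>t\<ge>1. \<zeta> \<omega> \<le> ereal t \<longrightarrow> X t \<omega> = \<infinity>"
    using sol unfolding solves_sde_def \<zeta>_def by blast+
  ultimately show ?thesis using growth C(2)
  proof eventually_elim
    case (elim \<omega>)
    show ?case
    proof (cases "\<exists>T. \<zeta> \<omega> \<le> ereal T")
      case True
      then obtain T where T: "\<zeta> \<omega> \<le> ereal T" by blast
      have "\<forall>\<^sub>F t in at_top. X t \<omega> = \<infinity>"
        using eventually_ge_at_top[of "max 1 T"]
      proof eventually_elim
        fix t assume "max 1 T \<le> t"
        then show "X t \<omega> = \<infinity>" using elim(3) order_trans[OF T, of "ereal t"] by simp
      qed
      then have "((\<lambda>t. X t \<omega>) \<longlongrightarrow> \<infinity>) at_top" by (rule tendsto_eventually)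
      then show ?thesis ..
    next
      case False
      then have lt: "ereal t < \<zeta> \<omega>" for t by (meson not_le)
      have fin: "\<bar>X t \<omega>\<bar> \<noteq> \<infinity>" if "1 \<le> t" for t
      proof
        assume "\<bar>X t \<omega>\<bar> = \<infinity>"
        then have "\<zeta> \<omega> \<le> ereal t" unfolding \<zeta>_def explosion_time_def using that by (intro INF_lower) simp
        then show False using lt[of t] by simp
      qed
      define x where "x t = real_of_ereal (X t \<omega>)" for t
      have Xx: "X t \<omega> = ereal (x t)" if "1 \<le> t" for t using fin[OF that] by (simp add: x_def ereal_real')
      have evXx: "\<forall>\<^sub>F t in at_top. X t \<omega> = ereal (x t)"
        using eventually_ge_at_top[of 1] by eventually_elim (rule Xx)
      have contx: "continuous_on {1..} x"
        using elim(2) continuous_on_iff_real[of "{1..}" "\<lambda>t. X t \<omega>"] fin unfolding x_def comp_def by auto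
      obtain K where K: "\<And>t. 1 \<le> t \<Longrightarrow> \<bar>B t \<omega>\<bar> \<le> K * t powr \<theta>" using elim(4) by blast
      have KC: "\<bar>C t \<omega>\<bar> \<le> K * t powr \<theta>" if "1 \<le> t" for t using K[OF that] elim(5) that by simp
      have contN: "continuous_on {1..} (N \<omega>)" unfolding N_def by (rule tail_noise_continuous[OF C(1) \<theta>(2,3) KC])
      have boundN: "\<bar>N \<omega> t\<bar> \<le> (\<alpha> * K / (\<alpha> - \<theta>) + K) * t powr (- (\<beta> - e))" if "1 \<le> t" for t
        using tail_noise_bound[OF C(1) \<theta>(2,3) KC that] unfolding N_def \<theta>(4) .
      have contg: "continuous_on {1..} (\<lambda>s. \<bar>x s\<bar> powr k)"
        using k by (intro continuous_on_powr' continuous_intros contx) auto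
      have lb: "(LBINT s:{1..t}. \<bar>x s\<bar> powr k) = integral {1..t} (\<lambda>s. \<bar>x s\<bar> powr k)" for t
        by (intro set_borel_integral_eq_integral(2) borel_integrable_atLeastAtMost' continuous_on_subset[OF contg]) auto
      have contI: "continuous_on {1..} (\<lambda>t. integral {1..t} (\<lambda>s. \<bar>x s\<bar> powr k))"
        by (rule continuous_on_indefinite_integral_atLeast[OF contg])
      have eqx: "x t = x 1 + integral {1..t} (\<lambda>s. \<bar>x s\<bar> powr k) + (N \<omega> 1 - N \<omega> t)" if "1 \<le> t" for t
      proof (rule continuous_eq_on_rationals[OF contx _ _ that])
        show "continuous_on {1..} (\<lambda>t. x 1 + integral {1..t} (\<lambda>s. \<bar>x s\<bar> powr k) + (N \<omega> 1 - N \<omega> t))"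
          by (intro continuous_intros contI contN)
        show "x q = x 1 + integral {1..q} (\<lambda>s. \<bar>x s\<bar> powr k) + (N \<omega> 1 - N \<omega> q)"
          if "q \<in> \<rat>" "1 \<le> q" for q
        proof -
          have "q \<in> \<rat> \<inter> {1..}" using that by simp
          from elim(1)[rule_format, OF this lt] show ?thesis unfolding x_def[symmetric] lb .
        qed
      qed
      have "0 < \<beta> - e" "(k - 1) * (\<beta> - e) < 1"
      proof -
        have "(k - 1) * (\<beta> - e) \<le> (k - 1) * \<beta>" using k e by (intro mult_left_mono) auto
        then show "(k - 1) * (\<beta> - e) < 1" using \<beta> by (simp add: left_diff_distrib)
      qed (use e in simp)
      note dichotomy = ode_dichotomy[OF k this contx]
      have "filterlim x at_top at_top \<or> ((x \<longlongrightarrow> 0) at_top \<and>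
          (\<exists>D. \<forall>n. integral {2 ^ n..2 ^ Suc n} (\<lambda>s. max 0 (N \<omega> s) powr k) \<le> D * (2 ^ n) powr (- (\<beta> - e))))"
        by (rule dichotomy) (rule eqx boundN; assumption)+
      then show ?thesis
      proof (elim disjE conjE exE)
        assume "filterlim x at_top at_top"
        then have "((\<lambda>t. ereal (x t)) \<longlongrightarrow> \<infinity>) at_top" by (simp add: tendsto_PInfty_eq_at_top)
        then have "((\<lambda>t. X t \<omega>) \<longlongrightarrow> \<infinity>) at_top" using tendsto_cong[OF evXx] by simp
        then show ?thesis ..
      next
        fix D assume x0: "(x \<longlongrightarrow> 0) at_top" and D: "\<forall>n. integral {2 ^ n..2 ^ Suc n} (\<lambda>s. max 0 (N \<omega> s) powr k) \<le> D * (2 ^ n) powr - (\<beta> - e)"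
        have "((\<lambda>t. ereal (x t)) \<longlongrightarrow> ereal 0) at_top" using x0 by simp
        then have "((\<lambda>t. X t \<omega>) \<longlongrightarrow> 0) at_top" using tendsto_cong[OF evXx] by (simp add: zero_ereal_def)
        moreover have "(\<lambda>n. averaged_tail C \<alpha> L n \<omega>) \<longlonglongrightarrow> 0" if L: "0 < L" for L
        proof (rule tendsto_sandwich[OF _ _ tendsto_const])
          show "(\<lambda>n. integral {2 ^ n..2 ^ Suc n} (\<lambda>s. max 0 (s powr \<beta> * N \<omega> s)) / 2 ^ n) \<longlonglongrightarrow> 0"
            by (rule weighted_average_tendsto_0[OF k \<beta>(1) e(3) contN D[rule_format]])
          show "\<forall>\<^sub>F n in sequentially. 0 \<le> averaged_tail C \<alpha> L n \<omega>"
            unfolding averaged_tail_def set_lebesgue_integral_def using L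
            by (intro always_eventually allI Bochner_Integration.integral_nonneg) auto
          show "\<forall>\<^sub>F n in sequentially. averaged_tail C \<alpha> L n \<omega> \<le> integral {2 ^ n..2 ^ Suc n} (\<lambda>s. max 0 (s powr \<beta> * N \<omega> s)) / 2 ^ n"
          proof (rule always_eventually, rule allI)
            fix n :: nat
            have one: "(1::real) \<le> 2 ^ n" by simp
            have "continuous_on {2 ^ n..2 ^ Suc n} (\<lambda>s. s powr \<beta> * N \<omega> s)"
              using one not_le[of "2 ^ n" "0::real"] by (intro continuous_intros continuous_on_subset[OF contN]) auto
            then have c1: "set_integrable lborel {2 ^ n..2 ^ Suc n} (\<lambda>s. max 0 (s powr \<beta> * N \<omega> s) / 2 ^ n)"
              and c2: "set_integrable lborel {2 ^ n..2 ^ Suc n} (\<lambda>s. min L (max 0 (s powr \<beta> * N \<omega> s)) / 2 ^ n)"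
              by (auto intro!: borel_integrable_atLeastAtMost' continuous_intros)
            have "averaged_tail C \<alpha> L n \<omega> = (LBINT s:{2 ^ n..2 ^ Suc n}. min L (max 0 (s powr \<beta> * N \<omega> s)) / 2 ^ n)"
              unfolding averaged_tail_def scaled_tail_def N_def \<beta>_def ..
            also have "\<dots> \<le> (LBINT s:{2 ^ n..2 ^ Suc n}. max 0 (s powr \<beta> * N \<omega> s) / 2 ^ n)"
              by (intro set_integral_mono c1 c2 divide_right_mono) auto
            also have "\<dots> = integral {2 ^ n..2 ^ Suc n} (\<lambda>s. max 0 (s powr \<beta> * N \<omega> s) / 2 ^ n)"
              by (rule set_borel_integral_eq_integral(2)[OF c1])
            also have "\<dots> = integral {2 ^ n..2 ^ Suc n} (\<lambda>s. max 0 (s powr \<beta> * N \<omega> s)) / 2 ^ n"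
              by (rule integral_divide)
            finally show "averaged_tail C \<alpha> L n \<omega> \<le> integral {2 ^ n..2 ^ Suc n} (\<lambda>s. max 0 (s powr \<beta> * N \<omega> s)) / 2 ^ n" .
          qed
        qed
        ultimately show ?thesis by blast
      qed
    qed
  qed
qed

theorem theorem4p1:
  fixes M :: "'a measure" and F :: "real \<Rightarrow> 'a measure" and B :: "real \<Rightarrow> 'a \<Rightarrow> real"
    and X :: "real \<Rightarrow> 'a \<Rightarrow> ereal" and k \<gamma> :: real
  assumes "brownian_motion M F B"
    and "k > 1" and "1/2 < \<gamma>" and "\<gamma> < 1" and "1/2 + 1/(2*k) > \<gamma>"
    and "solves_sde M F B (\<lambda>t x. \<bar>x\<bar> powr k) (\<lambda>t. t powr (- (\<gamma> / (2 * (1 - \<gamma>))))) 1 X"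
  shows "AE \<omega> in M. ((\<lambda>t. X t \<omega>) \<longlongrightarrow> \<infinity>) at_top"
proof -
  interpret brownian_motion M F B by fact
  define \<alpha> where "\<alpha> = \<gamma> / (2 * (1 - \<gamma>))"
  have \<alpha>: "1/2 < \<alpha>" using assms(3,4) by (simp add: \<alpha>_def field_simps)
  have "k * (2 * \<gamma> - 1) < 1" using assms(2,5) by (simp add: field_simps)
  then have "k * (2 * \<gamma> - 1) / (2 * (1 - \<gamma>)) < 1 / (2 * (1 - \<gamma>))" using assms(4) by (intro divide_strict_right_mono) auto
  moreover have "\<alpha> - 1/2 = (2 * \<gamma> - 1) / (2 * (1 - \<gamma>))" using assms(4) by (simp add: \<alpha>_def field_simps)
  moreover have "1 + (2 * \<gamma> - 1) / (2 * (1 - \<gamma>)) = 1 / (2 * (1 - \<gamma>))" using assms(4) by (simp add: field_simps)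
  ultimately have k\<alpha>: "k * (\<alpha> - 1/2) < 1 + (\<alpha> - 1/2)" by simp
  obtain C :: "real \<Rightarrow> 'a \<Rightarrow> real" where C: "\<And>\<omega>. continuous_on UNIV (\<lambda>r. C r \<omega>)"
    "(\<lambda>(r, \<omega>). C r \<omega>) \<in> borel_measurable (lborel \<Otimes>\<^sub>M M)" "AE \<omega> in M. \<forall>r\<ge>0. C r \<omega> = B r \<omega>"
    using continuous_modification by blast
  note dich = solution_dichotomy[OF assms(2) \<alpha> k\<alpha> assms(6)[folded \<alpha>_def] C(1,3)]
  \<comment> \<open>limits along integer times suffice, and they make the event one that the filtration determines\<close>
  define A where "A = {\<omega> \<in> space M. (\<lambda>n. X (real (Suc n)) \<omega>) \<longlonglongrightarrow> 0}"
  have seq: "filterlim (\<lambda>n. real (Suc n)) at_top sequentially"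
    by (rule filterlim_compose[OF filterlim_real_sequentially filterlim_Suc])
  have A: "A \<in> sigma_sets (space M) (\<Union>n. sets (F (real n)))"
    unfolding A_def
  proof (rule limit_zero_event_measurable)
    show "X (real (Suc n)) \<in> borel_measurable (F (real (Suc n)))" for n
      using assms(6) unfolding solves_sde_def by simp
  qed
  have "measure M A = 0"
  proof (rule null_if_averaged_tail_vanishes[OF C(2,3) \<alpha> A])
    fix L :: real assume L: "0 < L"
    show "AE \<omega> in M. \<omega> \<in> A \<longrightarrow> (\<lambda>n. averaged_tail C \<alpha> L n \<omega>) \<longlonglongrightarrow> 0"
      using dich
    proof eventually_elim
      case (elim \<omega>)
      show ?case
      proof
        assume "\<omega> \<in> A"
        then have 0: "(\<lambda>n. X (real (Suc n)) \<omega>) \<longlonglongrightarrow> 0" by (simp add: A_def)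
        have "\<not> ((\<lambda>t. X t \<omega>) \<longlongrightarrow> \<infinity>) at_top"
          using LIMSEQ_unique[OF 0 filterlim_compose[OF _ seq]] by fastforce
        then show "(\<lambda>n. averaged_tail C \<alpha> L n \<omega>) \<longlonglongrightarrow> 0" using elim L by blast
      qed
    qed
  qed
  moreover have "A \<in> sets M" using A sets.sigma_sets_subset[of "\<Union>n. sets (F (real n))" M] sets_F by blast
  ultimately have "AE \<omega> in M. \<omega> \<notin> A" by (intro AE_not_in) (simp add: null_sets_def emeasure_eq_measure)
  with dich AE_space show ?thesis
  proof eventually_elim
    case (elim \<omega>)
    then show ?case using filterlim_compose[OF _ seq, of "\<lambda>t. X t \<omega>" "nhds 0"] by (auto simp: A_def)
  qed
qed

end
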